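(* Let $T^4=\mathbb{R}^4/\mathbb{Z}^4$ with constant metric $G$ and constant 2-form $B$ having all components in $\mathbb{Q}$ (i.e. the $\mathcal N=(1,1)$ SCFT for $(T^4;G,B)$ is rational). Let $I$ be a polarizable complex structure with which $G$ is compatible and such that $B^{(2,0)}=0$. Let $\Gamma_f\subset H_1(T^4;\mathbb{Z})$ be any rank-2 primitive subgroup along which $(T^4;G,B;I)$ has a geometric SYZ-mirror (i.e. $\omega|_{\Gamma_f\otimes\mathbb{R}}=0$ and $B|_{\Gamma_f\otimes\mathbb{R}}=0$), with filtration $W^\bullet_v$ as defined below. Then for every $k=0,1,2,3,4$, the subspaces $W^k_v\otimes\mathbb{R}$ and $W^{k+2}_v\otimes\mathbb{R}$ are invariant under $\rho_{\omega,B}$, the induced vertical rational Hodge structure of weight $k$ on $W^k_v/W^{k+2}_v$ is of CM-type, and it is isomorphic, as a rational Hodge structure, to the (CM-type) rational Hodge structure on $H^k(T^4;\mathbb{Q})$ defined by $I$.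
   Context: Coordinates $X^I$ normalized so that $H_1(T^4;\mathbb{Z})=\mathbb{Z}^4$, $2\pi\sqrt{\alpha'}=1$. Compatible: $G(Iu,Iv)=G(u,v)$. Polarizable: some $\psi\in H^2(T^4;\mathbb{Z})\cap H^{1,1}$ with $\psi(I\cdot,\cdot)>0$. $B^{(2,0)}$: Hodge $(2,0)$ component of $[B]$ w.r.t. $I$. Kähler form $\omega=\frac12\omega_{IJ}dX^I\wedge dX^J$, $\omega_{IJ}=I^K{}_IG_{KJ}$. Filtration: pick a complement $\Gamma_b$ with $\Gamma_f\oplus\Gamma_b=H_1(T^4;\mathbb{Z})$, a basis $\gamma_1,\gamma_2$ of $\Gamma_f$, $\gamma_3,\gamma_4$ of $\Gamma_b$, and the dual basis $\theta^1,\dots,\theta^4$ of $H^1(T^4;\mathbb{Z})$; for $S\subset\{1,2,3,4\}$ let $\theta^S$ be the wedge product in increasing order. Put $d^\circ(S)=|S\cap\{3,4\}|+|\{1,2\}\setminus S|$, $V^j=\mathrm{span}_{\mathbb{Q}}\{\theta^S: d^\circ(S)=j\}$ (this is the image of $H^j$ of the T-dual torus under the D-brane charge mirror map $g^*$), and $W^k_v=\bigoplus_{j\ge k,\ j\equiv k\ (2)}V^j$ (with $W^5_v=W^6_v=0$). Vertical $U(1)$ action: $\Lambda_\mathbb{R}=H_1(T^4;\mathbb{R})\oplus H^1(T^4;\mathbb{R})$ with $q((v,\xi),(v',\xi'))=\xi(v')+\xi'(v)$; $\tilde\omega(v)=\iota_v\omega$; $J_0(v,\xi)=(-\tilde\omega^{-1}\xi,\tilde\omega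 v)$; $e_B(v,\xi)=(v,\xi-\iota_vB)$; $J_B=e_BJ_0e_B^{-1}\in\mathfrak{so}(\Lambda_\mathbb{R},q)$. On $S=H^*(T^4;\mathbb{R})$ let $c(v,\xi)\phi=2\iota_v\phi+\xi\wedge\phi$, and let $d\rho:\mathfrak{so}(\Lambda_\mathbb{R},q)\to\mathrm{End}(S)$ be the spin representation, the unique linear map with $[d\rho(A),c(\lambda)]=c(A\lambda)$ and $\mathrm{tr}\,d\rho(A)=0$. Set $\rho_{\omega,B}(e^{i\alpha})=\exp(\alpha\, d\rho(J_B))$, the sign of $J_B$ being normalized so that $d\rho(J_B)e^{(B+i\omega)/2}=-2i\,e^{(B+i\omega)/2}$. The charge-$\Delta$ part of a $\rho$-invariant complex space is where $\rho_{\omega,B}(e^{i\alpha})$ acts by $e^{-i\alpha\Delta}$; on $W^k_v/W^{k+2}_v$ the vertical weight-$k$ Hodge structure has $(p,q)$-part equal to the charge $p-q$ part, $p+q=k$. A polarizable rational Hodge structure $V$ is of CM-type if $\mathrm{End}(V)^{\mathrm{Hdg}}$ contains a commutative semisimple $\mathbb{Q}$-subalgebra of dimension $\dim_{\mathbb{Q}}V$. *)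

theory Defs
  imports Complex_Main
begin

text \<open>Indices 1..4 are the coordinates X^1..X^4. Vectors in H_1(T^4;R)=R^4 and
covectors are functions nat => 'a (only indices in idx matter); matrices are
nat => nat => 'a, with M K J the (K,J) entry; differential forms
(cohomology classes of T^4) are functions nat set => 'a giving the
coefficient of dX^S (wedge in increasing order) for S a subset of idx.\<close>

type_synonym 'a vec = "nat \<Rightarrow> 'a"
type_synonym 'a mat = "nat \<Rightarrow> nat \<Rightarrow> 'a"
type_synonym 'a form = "nat set \<Rightarrow> 'a"

definition idx :: "nat set" where "idx = {1..4}"

definition valid_vec :: "'a::zero vec \<Rightarrow> bool" where
  "valid_vec v \<longleftrightarrow> (\<forall>i. i \<notin> idx \<longrightarrow> v i = 0)"

definition valid_form :: "'a::zero form \<Rightarrow> bool" where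
  "valid_form \<phi> \<longleftrightarrow> (\<forall>S. \<not> S \<subseteq> idx \<longrightarrow> \<phi> S = 0)"

definition mvec :: "'a::comm_ring_1 mat \<Rightarrow> 'a vec \<Rightarrow> 'a vec" where
  "mvec M u = (\<lambda>K. if K \<in> idx then (\<Sum>J\<in>idx. M K J * u J) else 0)"

definition bil :: "'a::comm_ring_1 mat \<Rightarrow> 'a vec \<Rightarrow> 'a vec \<Rightarrow> 'a" where
  "bil M u v = (\<Sum>I\<in>idx. \<Sum>J\<in>idx. u I * M I J * v J)"

definition wsign :: "nat set \<Rightarrow> nat set \<Rightarrow> 'a::comm_ring_1" where
  "wsign S T = (-1) ^ card {(i,j). i \<in> S \<and> j \<in> T \<and> j < i}"

definition wedge :: "'a::comm_ring_1 form \<Rightarrow> 'a form \<Rightarrow> 'a form" where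
  "wedge \<phi> \<psi> = (\<lambda>U. \<Sum>S\<in>Pow U. wsign S (U - S) * \<phi> S * \<psi> (U - S))"

definition unit_form :: "'a::comm_ring_1 form" where
  "unit_form = (\<lambda>S. if S = {} then 1 else 0)"

fun wedge_list :: "'a::comm_ring_1 form list \<Rightarrow> 'a form" where
  "wedge_list [] = unit_form"
| "wedge_list (x # xs) = wedge x (wedge_list xs)"

fun wedge_pow :: "'a::comm_ring_1 form \<Rightarrow> nat \<Rightarrow> 'a form" where
  "wedge_pow \<beta> 0 = unit_form"
| "wedge_pow \<beta> (Suc n) = wedge \<beta> (wedge_pow \<beta> n)"

definition form1 :: "'a::comm_ring_1 vec \<Rightarrow> 'a form" where
  "form1 \<xi> = (\<lambda>S. if (\<exists>i\<in>idx. S = {i}) then \<xi> (the_elem S) else 0)"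

text \<open>the 2-form 1/2 M_{IJ} dX^I wedge dX^J for antisymmetric M\<close>
definition form2 :: "'a::comm_ring_1 mat \<Rightarrow> 'a form" where
  "form2 M = (\<lambda>S. if (\<exists>I\<in>idx. \<exists>J\<in>idx. I < J \<and> S = {I, J}) then M (Min S) (Max S) else 0)"

definition interior :: "'a::comm_ring_1 vec \<Rightarrow> 'a form \<Rightarrow> 'a form" where
  "interior v \<phi> = (\<lambda>S. if S \<subseteq> idx then
      (\<Sum>i\<in>idx - S. v i * wsign {i} S * \<phi> (insert i S)) else 0)"

definition lincomb :: "complex list \<Rightarrow> ('x \<Rightarrow> complex) list \<Rightarrow> 'x \<Rightarrow> complex" where
  "lincomb cs vs = (\<lambda>x. \<Sum>i<length vs. cs ! i * (vs ! i) x)"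

definition span_in :: "complex set \<Rightarrow> ('x \<Rightarrow> complex) set \<Rightarrow> ('x \<Rightarrow> complex) set" where
  "span_in K X = {\<phi>. \<exists>vs cs. set vs \<subseteq> X \<and> length cs = length vs \<and> set cs \<subseteq> K
                        \<and> \<phi> = lincomb cs vs}"

definition qindep :: "('x \<Rightarrow> complex) list \<Rightarrow> bool" where
  "qindep vs \<longleftrightarrow> (\<forall>cs. length cs = length vs \<and> set cs \<subseteq> \<rat> \<and> lincomb cs vs = (\<lambda>x. 0)
                      \<longrightarrow> set cs \<subseteq> {0})"

definition has_qdim :: "('x \<Rightarrow> complex) set \<Rightarrow> nat \<Rightarrow> bool" where
  "has_qdim X n \<longleftrightarrow> (\<exists>vs. length vs = n \<and> distinct vs \<and> set vs \<subseteq> X \<and> qindep vs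
                         \<and> X = span_in \<rat> (set vs))"

text \<open>A rational Hodge structure of weight k is given by a Q-subspace L of
rational forms, and the complex subspaces hp p (the (p,k-p)-part) of the
complexification span_in UNIV L, p = 0..k. Q-linear maps between such spaces
are (restrictions of) rational matrices acting on form coefficients.\<close>

definition fapp :: "(nat set \<Rightarrow> nat set \<Rightarrow> complex) \<Rightarrow> complex form \<Rightarrow> complex form" where
  "fapp M \<phi> = (\<lambda>S. if S \<subseteq> idx then (\<Sum>T\<in>Pow idx. M S T * \<phi> T) else 0)"

definition qfapp :: "(nat set \<Rightarrow> nat set \<Rightarrow> rat) \<Rightarrow> complex form \<Rightarrow> complex form" where
  "qfapp M = fapp (\<lambda>S T. of_rat (M S T))"

definition hs_iso :: "complex form set \<Rightarrow> (nat \<Rightarrow> complex form set)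
                      \<Rightarrow> complex form set \<Rightarrow> (nat \<Rightarrow> complex form set) \<Rightarrow> nat \<Rightarrow> bool" where
  "hs_iso L hp L' hp' k \<longleftrightarrow> (\<exists>M. inj_on (qfapp M) L \<and> qfapp M ` L = L'
        \<and> (\<forall>p\<le>k. qfapp M ` hp p = hp' p))"

text \<open>Q-linear endomorphisms of L, represented by their C-linear extension to
span_in UNIV L (and 0 outside it)\<close>
definition restr_end :: "complex form set \<Rightarrow> (nat set \<Rightarrow> nat set \<Rightarrow> rat)
                         \<Rightarrow> complex form \<Rightarrow> complex form" where
  "restr_end L M = (\<lambda>\<phi>. if \<phi> \<in> span_in UNIV L then qfapp M \<phi> else (\<lambda>S. 0))"

definition end_id :: "complex form set \<Rightarrow> complex form \<Rightarrow> complex form" where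
  "end_id L = (\<lambda>\<phi>. if \<phi> \<in> span_in UNIV L then \<phi> else (\<lambda>S. 0))"

definition hdg_end :: "complex form set \<Rightarrow> (nat \<Rightarrow> complex form set) \<Rightarrow> nat
                       \<Rightarrow> (complex form \<Rightarrow> complex form) set" where
  "hdg_end L hp k = {restr_end L M | M. qfapp M ` L \<subseteq> L \<and> (\<forall>p\<le>k. qfapp M ` hp p \<subseteq> hp p)}"

definition end_add :: "(complex form \<Rightarrow> complex form) \<Rightarrow> (complex form \<Rightarrow> complex form)
                       \<Rightarrow> complex form \<Rightarrow> complex form" where
  "end_add E F = (\<lambda>\<phi> S. E \<phi> S + F \<phi> S)"

definition end_scale :: "complex \<Rightarrow> (complex form \<Rightarrow> complex form) \<Rightarrow> complex form \<Rightarrow> complex form" where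
  "end_scale c E = (\<lambda>\<phi> S. c * E \<phi> S)"

definition end_zero :: "complex form \<Rightarrow> complex form" where
  "end_zero = (\<lambda>\<phi> S. 0)"

definition q_subalgebra :: "complex form set \<Rightarrow> (complex form \<Rightarrow> complex form) set \<Rightarrow> bool" where
  "q_subalgebra L A \<longleftrightarrow> end_id L \<in> A \<and> end_zero \<in> A
     \<and> (\<forall>E\<in>A. \<forall>F\<in>A. end_add E F \<in> A \<and> E \<circ> F \<in> A)
     \<and> (\<forall>c\<in>\<rat>. \<forall>E\<in>A. end_scale c E \<in> A)"

definition ideal_in :: "(complex form \<Rightarrow> complex form) set \<Rightarrow> (complex form \<Rightarrow> complex form) set \<Rightarrow> bool" where
  "ideal_in A I \<longleftrightarrow> I \<subseteq> A \<and> end_zero \<in> I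
     \<and> (\<forall>E\<in>I. \<forall>F\<in>I. end_add E F \<in> I)
     \<and> (\<forall>c\<in>\<rat>. \<forall>E\<in>I. end_scale c E \<in> I)
     \<and> (\<forall>E\<in>I. \<forall>F\<in>A. F \<circ> E \<in> I \<and> E \<circ> F \<in> I)"

definition nilpotent_ideal :: "complex form set \<Rightarrow> (complex form \<Rightarrow> complex form) set \<Rightarrow> bool" where
  "nilpotent_ideal L I \<longleftrightarrow> (\<exists>n>0. \<forall>xs. length xs = n \<and> set xs \<subseteq> I
       \<longrightarrow> foldr (\<circ>) xs (end_id L) = end_zero)"

definition semisimple_alg :: "complex form set \<Rightarrow> (complex form \<Rightarrow> complex form) set \<Rightarrow> bool" where
  "semisimple_alg L A \<longleftrightarrow> (\<forall>I. ideal_in A I \<and> nilpotent_ideal L I \<longrightarrow> I = {end_zero})"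

definition end_uncurry :: "(complex form \<Rightarrow> complex form) \<Rightarrow> complex form \<times> nat set \<Rightarrow> complex" where
  "end_uncurry E = (\<lambda>(\<phi>, S). E \<phi> S)"

definition cm_type :: "complex form set \<Rightarrow> (nat \<Rightarrow> complex form set) \<Rightarrow> nat \<Rightarrow> bool" where
  "cm_type L hp k \<longleftrightarrow> (\<exists>A n. A \<subseteq> hdg_end L hp k \<and> q_subalgebra L A
      \<and> (\<forall>E\<in>A. \<forall>F\<in>A. E \<circ> F = F \<circ> E) \<and> semisimple_alg L A
      \<and> has_qdim (end_uncurry ` A) n \<and> has_qdim L n)"

definition H10 :: "real mat \<Rightarrow> complex vec set" where
  "H10 Icx = {\<xi>. valid_vec \<xi> \<and> (\<forall>J\<in>idx. (\<Sum>K\<in>idx. \<xi> K * of_real (Icx K J)) = \<i> * \<xi> J)}"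

definition H01 :: "real mat \<Rightarrow> complex vec set" where
  "H01 Icx = {\<xi>. valid_vec \<xi> \<and> (\<forall>J\<in>idx. (\<Sum>K\<in>idx. \<xi> K * of_real (Icx K J)) = - \<i> * \<xi> J)}"

definition Hpq :: "real mat \<Rightarrow> nat \<Rightarrow> nat \<Rightarrow> complex form set" where
  "Hpq Icx p q = span_in UNIV {wedge_list (map form1 (xs @ ys)) | xs ys.
      length xs = p \<and> set xs \<subseteq> H10 Icx \<and> length ys = q \<and> set ys \<subseteq> H01 Icx}"

definition HQ :: "nat \<Rightarrow> complex form set" where
  "HQ k = {\<phi>. valid_form \<phi> \<and> (\<forall>S. \<phi> S \<in> \<rat>) \<and> (\<forall>S. \<phi> S \<noteq> 0 \<longrightarrow> card S = k)}"

definition hpH :: "real mat \<Rightarrow> nat \<Rightarrow> nat \<Rightarrow> complex form set" where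
  "hpH Icx k p = Hpq Icx p (k - p)"

type_synonym lam = "real vec \<times> real vec"

definition omega :: "real mat \<Rightarrow> real mat \<Rightarrow> real mat" where
  "omega G Icx = (\<lambda>I J. \<Sum>K\<in>idx. Icx K I * G K J)"

definition iota2 :: "real vec \<Rightarrow> real mat \<Rightarrow> real vec" where
  "iota2 v M = (\<lambda>J. if J \<in> idx then (\<Sum>I\<in>idx. v I * M I J) else 0)"

definition omt_inv :: "real mat \<Rightarrow> real vec \<Rightarrow> real vec" where
  "omt_inv om \<xi> = (THE v. valid_vec v \<and> iota2 v om = (\<lambda>J. if J \<in> idx then \<xi> J else 0))"

definition J0 :: "real mat \<Rightarrow> lam \<Rightarrow> lam" where
  "J0 om = (\<lambda>(v, \<xi>). (\<lambda>i. - omt_inv om \<xi> i, iota2 v om))"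

definition eB :: "real mat \<Rightarrow> lam \<Rightarrow> lam" where
  "eB Bm = (\<lambda>(v, \<xi>). (v, \<lambda>J. \<xi> J - iota2 v Bm J))"

definition eBinv :: "real mat \<Rightarrow> lam \<Rightarrow> lam" where
  "eBinv Bm = (\<lambda>(v, \<xi>). (v, \<lambda>J. \<xi> J + iota2 v Bm J))"

definition JB :: "real mat \<Rightarrow> real mat \<Rightarrow> lam \<Rightarrow> lam" where
  "JB om Bm = eB Bm \<circ> J0 om \<circ> eBinv Bm"

definition cliff :: "lam \<Rightarrow> real form \<Rightarrow> real form" where
  "cliff = (\<lambda>(v, \<xi>) \<phi>. (\<lambda>S. 2 * interior v \<phi> S + wedge (form1 \<xi>) \<phi> S))"

definition rapp :: "(nat set \<Rightarrow> nat set \<Rightarrow> real) \<Rightarrow> real form \<Rightarrow> real form" where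
  "rapp M \<phi> = (\<lambda>S. if S \<subseteq> idx then (\<Sum>T\<in>Pow idx. M S T * \<phi> T) else 0)"

definition spin_mat :: "(lam \<Rightarrow> lam) \<Rightarrow> (nat set \<Rightarrow> nat set \<Rightarrow> real) \<Rightarrow> bool" where
  "spin_mat A M \<longleftrightarrow> (\<forall>S T. \<not> (S \<subseteq> idx \<and> T \<subseteq> idx) \<longrightarrow> M S T = 0)
     \<and> (\<forall>l \<phi>. valid_form \<phi> \<longrightarrow>
           (\<lambda>S. rapp M (cliff l \<phi>) S - cliff l (rapp M \<phi>) S) = cliff (A l) \<phi>)
     \<and> (\<Sum>S\<in>Pow idx. M S S) = 0"

text \<open>d rho(A): the unique traceless linear map with [d rho(A), c(l)] = c(A l)\<close>
definition dspin :: "(lam \<Rightarrow> lam) \<Rightarrow> nat set \<Rightarrow> nat set \<Rightarrow> real" where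
  "dspin A = (THE M. spin_mat A M)"

definition capp :: "(nat set \<Rightarrow> nat set \<Rightarrow> real) \<Rightarrow> complex form \<Rightarrow> complex form" where
  "capp M = fapp (\<lambda>S T. of_real (M S T))"

definition expw :: "complex form \<Rightarrow> complex form" where
  "expw \<beta> = (\<lambda>S. \<Sum>n\<le>4. wedge_pow \<beta> n S / of_nat (fact n))"

definition cmat :: "real mat \<Rightarrow> complex mat" where
  "cmat M = (\<lambda>I J. of_real (M I J))"

definition eBom :: "real mat \<Rightarrow> real mat \<Rightarrow> real mat \<Rightarrow> complex form" where
  "eBom G Icx Bm = expw (\<lambda>S. (form2 (cmat Bm) S + \<i> * form2 (cmat (omega G Icx)) S) / 2)"

text \<open>d rho(J_B) with the sign of J_B normalised so that
  d rho(J_B) e^{(B+i omega)/2} = -2i e^{(B+i omega)/2}\<close>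
definition dJ :: "real mat \<Rightarrow> real mat \<Rightarrow> real mat \<Rightarrow> nat set \<Rightarrow> nat set \<Rightarrow> real" where
  "dJ G Icx Bm = (let M = dspin (JB (omega G Icx) Bm);
                     E = eBom G Icx Bm in
                 if capp M E = (\<lambda>S. - 2 * \<i> * E S) then M else (\<lambda>S T. - M S T))"

definition rho :: "real mat \<Rightarrow> real mat \<Rightarrow> real mat \<Rightarrow> real \<Rightarrow> complex form \<Rightarrow> complex form" where
  "rho G Icx Bm \<alpha> \<phi> = (\<lambda>S. \<Sum>n. (of_real \<alpha>) ^ n / of_nat (fact n)
                              * ((capp (dJ G Icx Bm) ^^ n) \<phi>) S)"

text \<open>Pinv i K: coefficients of theta^i = sum_K Pinv i K dX^K (dual basis to
gamma_j = sum_K P K j e_K)\<close>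
definition theta :: "int mat \<Rightarrow> nat \<Rightarrow> complex vec" where
  "theta Pinv i = (\<lambda>K. if K \<in> idx then of_int (Pinv i K) else 0)"

definition thetaS :: "int mat \<Rightarrow> nat set \<Rightarrow> complex form" where
  "thetaS Pinv S = wedge_list (map (\<lambda>i. form1 (theta Pinv i)) (sorted_list_of_set S))"

definition dcirc :: "nat set \<Rightarrow> nat" where
  "dcirc S = card (S \<inter> {3, 4}) + card ({1, 2} - S)"

definition Vgen :: "int mat \<Rightarrow> nat \<Rightarrow> complex form set" where
  "Vgen Pinv j = {thetaS Pinv S | S. S \<subseteq> idx \<and> dcirc S = j}"

definition Wgen :: "int mat \<Rightarrow> nat \<Rightarrow> complex form set" where
  "Wgen Pinv k = {thetaS Pinv S | S. S \<subseteq> idx \<and> k \<le> dcirc S \<and> even (dcirc S - k)}"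

definition WQ :: "int mat \<Rightarrow> nat \<Rightarrow> complex form set" where
  "WQ Pinv k = span_in \<rat> (Wgen Pinv k)"

definition WR :: "int mat \<Rightarrow> nat \<Rightarrow> complex form set" where
  "WR Pinv k = span_in \<real> (Wgen Pinv k)"

definition VQ :: "int mat \<Rightarrow> nat \<Rightarrow> complex form set" where
  "VQ Pinv k = span_in \<rat> (Vgen Pinv k)"

text \<open>Vertical Hodge structure on W^k/W^{k+2}, transported to the canonical
complement V^k of W^{k+2} in W^k: the (p,k-p)-part consists of those phi in
V^k tensor C whose class in the quotient has charge p-(k-p), i.e.
rho(e^{i alpha}) phi = e^{-i alpha (p-q)} phi modulo W^{k+2} tensor C.\<close>
definition hpV :: "real mat \<Rightarrow> real mat \<Rightarrow> real mat \<Rightarrow> int mat \<Rightarrow> nat \<Rightarrow> nat \<Rightarrow> complex form set" where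
  "hpV G Icx Bm Pinv k p = {\<phi> \<in> span_in UNIV (VQ Pinv k). \<forall>\<alpha>::real.
      (\<lambda>S. rho G Icx Bm \<alpha> \<phi> S - exp (- (\<i> * of_real \<alpha> * of_int (int p - int (k - p)))) * \<phi> S)
        \<in> span_in UNIV (Wgen Pinv (k + 2))}"

end

theory Submission
  imports Defs "HOL-Library.Function_Algebras" "HOL-Computational_Algebra.Polynomial"
begin

text \<open>
  Let \<open>F\<close> be the span of \<open>\<Gamma>\<^sub>f\<close> and of the annihilator of \<open>\<Gamma>\<^sub>f\<close> in \<open>H\<^sup>1\<close>. Since \<open>\<omega>\<close> and \<open>B\<close>
  vanish on \<open>\<Gamma>\<^sub>f\<close>, it is a \<open>J\<^sub>B\<close>-invariant maximal isotropic subspace, and Clifford multiplication by \<open>F\<close>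
  on the vacuum \<open>\<theta>\<^sup>1 \<and> \<theta>\<^sup>2\<close> identifies \<open>\<Lambda>\<^sup>k F\<close> with \<open>V\<^sup>k\<close>. For \<open>s = 1\<close> and \<open>s = -1\<close> the rational map
  \<open>g\<^sub>s (v, \<xi>) = \<xi> + \<iota>\<^sub>v B + s G v\<close> from \<open>F\<close> to \<open>H\<^sup>1\<close> is injective because \<open>\<xi>(v) = 0\<close> on \<open>F\<close>, and
  it satisfies \<open>g\<^sub>s (J\<^sub>B x) = - s (g\<^sub>s x) \<circ> I\<close>. So whichever sign the normalisation of \<open>J\<^sub>B\<close> selects, one
  of the two maps induces a rational isomorphism from \<open>\<Lambda>\<^sup>k H\<^sup>1\<close> onto \<open>V\<^sup>k\<close> that carries the action of \<open>I\<close>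
  to the vertical action modulo \<open>W\<^sup>k\<^sup>+\<^sup>2\<close>.

  For complex multiplication, \<open>A = G\<^sup>-\<^sup>1 \<psi>\<close> is rational, commutes with \<open>I\<close> and is skew for \<open>G\<close>. Either
  \<open>A\<close> has four distinct eigenvalues, or it is a real multiple of \<open>I\<close> on two orthogonal complex lines, one
  of them spanned by a rational vector, and then a rational operator of rank two can be added to separate
  the eigenvalues. The derivation of a generic rational polynomial in this operator has simple
  spectrum on \<open>\<Lambda>\<^sup>k H\<^sup>1\<close>, so the rational operators diagonal in its eigenbasis form a commutative
  semisimple algebra of full dimension.
\<close>

section \<open>Exterior algebra and Clifford operators\<close>

text \<open>The maps \<open>g\<^sub>s\<close> come from the generalized metric. Let
  \<open>C\<^sub>s\<close> be the image under \<open>e\<^sub>B\<close> of the graph of s G. The form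
  q is definite of sign s on it, the spaces for the two signs are orthogonal complements of each
  other, and \<open>J\<^sub>B\<close> acts on \<open>C\<^sub>s\<close> through the vector part as s
  I. Pairing with \<open>C\<^sub>s\<close> is \<open>g\<^sub>s\<close>; its kernel is the other
  space, which is definite and so meets the isotropic \<open>F\<close> only in 0. The intertwining
  rule is the skewness of \<open>J\<^sub>B\<close> read off on \<open>C\<^sub>s\<close>. Only G, B
  and the lattice enter \<open>g\<^sub>s\<close>, so it is rational although I, \<omega> and
  \<open>J\<^sub>B\<close> need not be. That I need not be rational is also the obstacle for complex
  multiplication: a rational operator commuting with I has to be manufactured, and the polarization
  supplies it. The full dimension of the algebra is squeezed between two counts: evaluation at a
  rational vector without zero eigencoordinates embeds it in the rational space, and the powers of
  one operator with simple spectrum already fill that dimension.\<close>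

lemma finite_idx [simp]: "finite idx"
  by (simp add: idx_def)

lemma idx_set: "idx = {1, 2, 3, 4}"
  by (auto simp: idx_def)

lemma finite_subset_idx: "S \<subseteq> idx \<Longrightarrow> finite S"
  using finite_subset[of S idx] by simp

section \<open>Pointwise scaling and linear operators on function spaces\<close>

definition sc :: "'a::times \<Rightarrow> ('b \<Rightarrow> 'a) \<Rightarrow> 'b \<Rightarrow> 'a" where
  "sc c f = (\<lambda>x. c * f x)"

lemma sc_apply [simp]: "sc c f x = c * f x"
  by (simp add: sc_def)

interpretation sc: vector_space "sc :: 'a::field \<Rightarrow> ('b \<Rightarrow> 'a) \<Rightarrow> 'b \<Rightarrow> 'a"
  by unfold_locales (auto simp: fun_eq_iff algebra_simps)

lemma sum_fun_apply: "(\<Sum>i\<in>A. f i) x = (\<Sum>i\<in>A. f i x)"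
  by (induction A rule: infinite_finite_induct) auto

text \<open>Linearity is asked on all functions, so that it composes freely. Validity of forms is
  brought in only where an operator is compared through its values on the basis forms
  \<open>dl S\<close>.\<close>

definition lin :: "(('b \<Rightarrow> 'a::field) \<Rightarrow> ('c \<Rightarrow> 'a)) \<Rightarrow> bool" where
  "lin f \<longleftrightarrow> (\<forall>\<phi> \<psi>. f (\<phi> + \<psi>) = f \<phi> + f \<psi>) \<and> (\<forall>c \<phi>. f (sc c \<phi>) = sc c (f \<phi>))"

lemma lin_add: "lin f \<Longrightarrow> f (\<phi> + \<psi>) = f \<phi> + f \<psi>"
  and lin_sc: "lin f \<Longrightarrow> f (sc c \<phi>) = sc c (f \<phi>)"
  by (auto simp: lin_def)

lemma lin_0: "lin f \<Longrightarrow> f 0 = 0"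
  using lin_sc[of f 0 0] by simp

lemma lin_minus: "lin f \<Longrightarrow> f (- \<phi>) = - f \<phi>"
  using lin_sc[of f "-1" \<phi>] by simp

lemma lin_diff: "lin f \<Longrightarrow> f (\<phi> - \<psi>) = f \<phi> - f \<psi>"
  using lin_add[of f \<phi> "- \<psi>"] by (simp add: lin_minus[of f])

lemma lin_sum: "lin f \<Longrightarrow> f (\<Sum>i\<in>A. g i) = (\<Sum>i\<in>A. f (g i))"
  by (induction A rule: infinite_finite_induct) (auto simp: lin_0 lin_add)

lemma lin_zero: "lin (\<lambda>\<phi>. 0)"
  by (simp add: lin_def)

lemma lin_comp: "lin f \<Longrightarrow> lin g \<Longrightarrow> lin (\<lambda>\<phi>. f (g \<phi>))"
  by (simp add: lin_def)

lemma lin_plus: "lin f \<Longrightarrow> lin g \<Longrightarrow> lin (\<lambda>\<phi>. f \<phi> + g \<phi>)"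
  by (simp add: lin_def algebra_simps sc.scale_right_distrib)

lemma lin_scale: "lin f \<Longrightarrow> lin (\<lambda>\<phi>. sc c (f \<phi>))"
  by (simp add: lin_def algebra_simps sc.scale_right_distrib)

lemma lin_setsum: "(\<And>i. i \<in> A \<Longrightarrow> lin (f i)) \<Longrightarrow> lin (\<lambda>\<phi>. \<Sum>i\<in>A. f i \<phi>)"
  by (induction A rule: infinite_finite_induct) (auto simp: lin_zero intro: lin_plus)

lemma valid_form_0 [simp]: "valid_form 0"
  by (simp add: valid_form_def)

lemma valid_form_add: "valid_form \<phi> \<Longrightarrow> valid_form \<psi> \<Longrightarrow> valid_form (\<phi> + \<psi> :: 'a::field form)"
  by (simp add: valid_form_def)

lemma valid_form_sc: "valid_form \<phi> \<Longrightarrow> valid_form (sc c \<phi> :: 'a::field form)"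
  by (simp add: valid_form_def)

lemma valid_form_sum: "(\<And>i. i \<in> A \<Longrightarrow> valid_form (f i)) \<Longrightarrow> valid_form (\<Sum>i\<in>A. f i :: 'a::field form)"
  by (induction A rule: infinite_finite_induct) (auto intro: valid_form_add)

definition dl :: "nat set \<Rightarrow> 'a::field form" where
  "dl S = (\<lambda>U. if U = S then 1 else 0)"

lemma valid_dl: "S \<subseteq> idx \<Longrightarrow> valid_form (dl S)"
  by (auto simp: valid_form_def dl_def)

lemma unit_form_dl: "unit_form = dl {}"
  by (auto simp: unit_form_def dl_def)

lemma form_decomp:
  assumes "valid_form \<phi>" shows "\<phi> = (\<Sum>S\<in>Pow idx. sc (\<phi> S) (dl S))"
proof
  fix U
  have "(\<Sum>S\<in>Pow idx. sc (\<phi> S) (dl S)) U = (\<Sum>S\<in>Pow idx. if S = U then \<phi> S else 0)"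
    unfolding sum_fun_apply by (rule sum.cong) (auto simp: dl_def)
  also have "\<dots> = (if U \<in> Pow idx then \<phi> U else 0)"
    by (rule sum.delta) simp
  also have "\<dots> = \<phi> U"
    using assms by (auto simp: valid_form_def)
  finally show "\<phi> U = (\<Sum>S\<in>Pow idx. sc (\<phi> S) (dl S)) U" ..
qed

lemma lin_decomp:
  assumes "lin f" "valid_form \<phi>"
  shows "f \<phi> = (\<Sum>S\<in>Pow idx. sc (\<phi> S) (f (dl S)))"
proof -
  have "f \<phi> = f (\<Sum>S\<in>Pow idx. sc (\<phi> S) (dl S))"
    by (rule arg_cong[OF form_decomp[OF assms(2)]])
  then show ?thesis by (simp add: lin_sum[OF assms(1)] lin_sc[OF assms(1)])
qed

lemma lin_eq_on_valid:
  assumes "lin f" "lin g" "\<And>S. S \<subseteq> idx \<Longrightarrow> f (dl S) = g (dl S)" "valid_form \<phi>"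
  shows "f \<phi> = g \<phi>"
  using assms(3) by (simp add: lin_decomp[OF assms(1,4)] lin_decomp[OF assms(2,4)])

section \<open>Koszul signs and the canonical anticommutation relations\<close>

definition sg :: "nat \<Rightarrow> nat set \<Rightarrow> 'a::comm_ring_1" where
  "sg i S = (-1) ^ card {j \<in> S. j < i}"

lemma wsign_sing: "wsign {i} S = sg i S"
proof -
  have "{(a, b). a \<in> {i} \<and> b \<in> S \<and> b < a} = Pair i ` {j \<in> S. j < i}" by auto
  then show ?thesis
    by (simp add: wsign_def sg_def card_image inj_on_def)
qed

lemma sg_sq: "sg i S * sg i S = 1"
  by (simp add: sg_def flip: power_mult_distrib)

lemma sg_insert:
  assumes "finite S" "j \<notin> S"
  shows "sg i (insert j S) = (if j < i then - sg i S else sg i S)"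
proof -
  have "{k \<in> insert j S. k < i} = (if j < i then insert j {k \<in> S. k < i} else {k \<in> S. k < i})"
    by auto
  then show ?thesis using assms by (simp add: sg_def)
qed

lemma sg_remove_self: "sg i (S - {i}) = sg i S"
proof -
  have "{j \<in> S - {i}. j < i} = {j \<in> S. j < i}" by auto
  then show ?thesis by (simp add: sg_def)
qed

lemma sg_insert_self: "sg i (insert i S) = sg i S"
proof -
  have "{j \<in> insert i S. j < i} = {j \<in> S. j < i}" by auto
  then show ?thesis by (simp add: sg_def)
qed

lemma sg_remove:
  assumes "finite S" "j \<in> S"
  shows "sg i (S - {j}) = (if j < i then - sg i S else sg i S :: 'a::comm_ring_1)"
proof -
  have "insert j (S - {j}) = S" using assms by auto
  with sg_insert[of "S - {j}" j i, where 'a='a] assms show ?thesis by auto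
qed

text \<open>Creation and annihilation by \<open>dX\<^sup>i\<close>; both truncate to subsets of \<open>idx\<close>, so they agree with
  \<open>wedge\<close> and \<open>interior\<close> on valid forms only.\<close>

definition cr0 :: "nat \<Rightarrow> 'a::field form \<Rightarrow> 'a form" where
  "cr0 i \<phi> = (\<lambda>U. if i \<in> U \<and> U \<subseteq> idx then sg i U * \<phi> (U - {i}) else 0)"

definition an0 :: "nat \<Rightarrow> 'a::field form \<Rightarrow> 'a form" where
  "an0 i \<phi> = (\<lambda>U. if i \<notin> U \<and> U \<subseteq> idx then sg i U * \<phi> (insert i U) else 0)"

lemma lin_cr0: "lin (cr0 i)" and lin_an0: "lin (an0 i)"
  by (auto simp: lin_def cr0_def an0_def fun_eq_iff algebra_simps)

lemma valid_cr0: "valid_form (cr0 i \<phi>)" and valid_an0: "valid_form (an0 i \<phi>)"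
  by (auto simp: valid_form_def cr0_def an0_def)

lemma cr0_cr0: "cr0 i (cr0 j (\<phi> :: 'a::field form)) + cr0 j (cr0 i \<phi>) = 0"
proof
  fix U
  have "U - {i} - {j} = U - {j} - {i}" by auto
  then show "(cr0 i (cr0 j \<phi>) + cr0 j (cr0 i \<phi>)) U = 0 U"
    using sg_remove[of U i j, where 'a='a] sg_remove[of U j i, where 'a='a] finite_subset_idx[of U]
    by (cases "i = j") (auto simp: cr0_def)
qed

lemma an0_an0: assumes "i \<in> idx" "j \<in> idx" shows "an0 i (an0 j (\<phi> :: 'a::field form)) + an0 j (an0 i \<phi>) = 0"
proof
  fix U
  have "insert i (insert j U) = insert j (insert i U)" by auto
  then show "(an0 i (an0 j \<phi>) + an0 j (an0 i \<phi>)) U = 0 U"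
    using sg_insert[of U i j, where 'a='a] sg_insert[of U j i, where 'a='a] finite_subset_idx[of U] assms
    by (cases "i = j") (auto simp: an0_def)
qed

text \<open>Validity matters in the diagonal case: the left side vanishes off the subsets of
  \<open>idx\<close>, so it can return \<phi> only if \<phi> vanishes there too.\<close>

lemma an0_cr0:
  assumes "valid_form (\<phi> :: 'a::field form)" "i \<in> idx" "j \<in> idx"
  shows "an0 i (cr0 j \<phi>) + cr0 j (an0 i \<phi>) = (if i = j then \<phi> else 0)"
proof
  fix U
  consider "\<not> U \<subseteq> idx" | "U \<subseteq> idx" "i = j" | "U \<subseteq> idx" "i \<noteq> j" by blast
  then show "(an0 i (cr0 j \<phi>) + cr0 j (an0 i \<phi>)) U = (if i = j then \<phi> else 0) U"
  proof cases
    case 1 then show ?thesis using assms by (auto simp: an0_def cr0_def valid_form_def)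
  next
    case 2
    have "sg i U * (sg i U * x) = (x::'a)" for x
      using sg_sq[of i U, where 'a='a] by (simp flip: mult.assoc)
    then show ?thesis using 2 assms
      by (auto simp: an0_def cr0_def sg_insert_self sg_remove_self insert_absorb)
  next
    case 3
    then have "insert i (U - {j}) = insert i U - {j}" by auto
    then show ?thesis using 3 assms sg_insert[of U i j, where 'a='a] sg_remove[of U j i, where 'a='a] finite_subset_idx[of U]
      by (auto simp: an0_def cr0_def)
  qed
qed

section \<open>The Clifford action of the doubled space\<close>

type_synonym 'a dvec = "'a vec \<times> 'a vec"

definition qf :: "'a::field dvec \<Rightarrow> 'a dvec \<Rightarrow> 'a" where
  "qf x y = (\<Sum>i\<in>idx. snd x i * fst y i + snd y i * fst x i)"

lemma qf_sym: "qf x y = qf y x"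
  by (simp add: qf_def algebra_simps)

definition ext1 :: "'a::field vec \<Rightarrow> 'a form \<Rightarrow> 'a form" where
  "ext1 \<xi> \<phi> = (\<Sum>i\<in>idx. sc (\<xi> i) (cr0 i \<phi>))"

definition cl :: "'a::field dvec \<Rightarrow> 'a form \<Rightarrow> 'a form" where
  "cl x \<phi> = (\<Sum>i\<in>idx. sc (2 * fst x i) (an0 i \<phi>) + sc (snd x i) (cr0 i \<phi>))"

lemma cl_ext1: "cl (0, \<xi>) = ext1 \<xi>"
  by (simp add: fun_eq_iff cl_def ext1_def)

lemma valid_cl: "valid_form (cl x \<phi>)"
  by (auto simp: cl_def intro!: valid_form_sum valid_form_add valid_form_sc valid_cr0 valid_an0)

lemma lin_cl: "lin (cl x)"
  unfolding cl_def by (intro lin_setsum lin_plus lin_scale lin_cr0 lin_an0)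

text \<open>Creators and annihilators are indexed together by pairs (coordinate, flag). The
  canonical relations then become the single symbol \<open>e\<close>, which is nonzero only between
  a creator and the annihilator of the same coordinate, and the bilinear expansion collapses to q.
  The 2 is the factor in front of the contraction.\<close>

lemma cl_anticomm:
  assumes "valid_form (\<phi> :: 'a::field form)"
  shows "cl x (cl y \<phi>) + cl y (cl x \<phi>) = sc (2 * qf x y) \<phi>"
proof -
  let ?X = "idx \<times> (UNIV :: bool set)"
  define op where "op p = (if snd p then an0 (fst p) else cr0 (fst p) :: 'a form \<Rightarrow> 'a form)" for p :: "nat \<times> bool"
  define co where "co z p = (if snd p then 2 * fst z (fst p) else snd z (fst p))" for z :: "'a dvec" and p :: "nat \<times> bool"
  define e where "e p r = (if fst p = fst r \<and> snd p \<noteq> snd r then 1 else 0 :: 'a)" for p r :: "nat \<times> bool"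
  have SX: "(\<Sum>p\<in>?X. h p) = (\<Sum>i\<in>idx. h (i, False) + h (i, True))" for h :: "nat \<times> bool \<Rightarrow> 'x::comm_monoid_add"
    by (simp add: sum.cartesian_product' UNIV_bool)
  have cl: "cl z \<psi> = (\<Sum>p\<in>?X. sc (co z p) (op p \<psi>))" for z and \<psi> :: "'a form"
    by (simp add: cl_def SX op_def co_def add.commute)
  have lop: "lin (op p)" for p
    by (simp add: op_def lin_cr0 lin_an0)
  have op: "op p (op r \<phi>) + op r (op p \<phi>) = sc (e p r) \<phi>" if "p \<in> ?X" "r \<in> ?X" for p r
    using that cr0_cr0[of "fst p" "fst r" \<phi>] an0_an0[of "fst p" "fst r" \<phi>]
      an0_cr0[OF assms, of "fst p" "fst r"] an0_cr0[OF assms, of "fst r" "fst p"]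
    by (auto simp: op_def e_def add.commute)
  have prod: "cl z (cl w \<phi>) = (\<Sum>p\<in>?X. \<Sum>r\<in>?X. sc (co z p * co w r) (op p (op r \<phi>)))" for z w
    by (simp add: cl lin_sum[OF lop] lin_sc[OF lop] sc.scale_sum_right)
  have "cl x (cl y \<phi>) + cl y (cl x \<phi>)
      = (\<Sum>p\<in>?X. \<Sum>r\<in>?X. sc (co x p * co y r) (op p (op r \<phi>))) + (\<Sum>p\<in>?X. \<Sum>r\<in>?X. sc (co x p * co y r) (op r (op p \<phi>)))"
    unfolding prod by (subst (3) sum.swap) (simp add: mult.commute)
  also have "\<dots> = (\<Sum>p\<in>?X. \<Sum>r\<in>?X. sc (co x p * co y r) (op p (op r \<phi>) + op r (op p \<phi>)))"
    by (simp add: sum.distrib sc.scale_right_distrib)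
  also have "\<dots> = (\<Sum>p\<in>?X. \<Sum>r\<in>?X. sc (co x p * co y r * e p r) \<phi>)"
    by (intro sum.cong refl) (simp add: op)
  also have "\<dots> = sc (\<Sum>p\<in>?X. \<Sum>r\<in>?X. co x p * co y r * e p r) \<phi>"
    by (simp add: sc.scale_sum_left)
  also have "(\<Sum>p\<in>?X. \<Sum>r\<in>?X. co x p * co y r * e p r) = (\<Sum>p\<in>?X. co x p * co y (fst p, \<not> snd p))"
  proof (intro sum.cong refl)
    fix p assume "p \<in> ?X"
    have "(\<Sum>r\<in>?X. co x p * co y r * e p r) = (\<Sum>r\<in>?X. if r = (fst p, \<not> snd p) then co x p * co y r else 0)"
      by (intro sum.cong) (auto simp: e_def)
    also have "\<dots> = co x p * co y (fst p, \<not> snd p)"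
      using \<open>p \<in> ?X\<close> by (subst sum.delta) auto
    finally show "(\<Sum>r\<in>?X. co x p * co y r * e p r) = co x p * co y (fst p, \<not> snd p)" .
  qed
  also have "\<dots> = 2 * qf x y"
    by (simp add: SX co_def qf_def sum_distrib_left algebra_simps)
  finally show ?thesis .
qed

text \<open>A Witt basis with its pure spinor: \<open>l\<close> and \<open>m\<close> are isotropic
  and dual to each other, and \<open>vac\<close> is annihilated by all \<open>m i\<close>. The
  states \<open>st S\<close> form a Fock space, a copy of the exterior algebra on the span of
  \<open>l\<close>. The coordinate basis, the lattice basis, the basis of \<open>F\<close> and the
  eigenbasis of I are all instances.\<close>

locale frame =
  fixes l m :: "nat \<Rightarrow> 'a::field_char_0 dvec" and vac :: "'a form"
  assumes ll: "\<And>i j. i \<in> idx \<Longrightarrow> j \<in> idx \<Longrightarrow> qf (l i) (l j) = 0"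
    and mm: "\<And>i j. i \<in> idx \<Longrightarrow> j \<in> idx \<Longrightarrow> qf (m i) (m j) = 0"
    and lm: "\<And>i j. i \<in> idx \<Longrightarrow> j \<in> idx \<Longrightarrow> qf (l i) (m j) = (if i = j then 1 else 0)"
    and vac_valid: "valid_form vac"
    and vac_nz: "vac \<noteq> 0"
    and vac_ann: "\<And>i. i \<in> idx \<Longrightarrow> cl (m i) vac = 0"
begin

definition st :: "nat set \<Rightarrow> 'a form" where
  "st S = foldr (\<lambda>i. cl (l i)) (sorted_list_of_set S) vac"

lemma valid_foldr: "valid_form (foldr (\<lambda>i. cl (l i)) xs vac)"
  by (cases xs) (auto simp: vac_valid valid_cl)

lemma valid_st: "valid_form (st S)"
  by (simp add: st_def valid_foldr)

lemma st_empty: "st {} = vac"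
  by (simp add: st_def)

lemma cr_cr: "i \<in> idx \<Longrightarrow> j \<in> idx \<Longrightarrow> valid_form \<phi> \<Longrightarrow> cl (l i) (cl (l j) \<phi>) = - cl (l j) (cl (l i) \<phi>)"
  using cl_anticomm[of \<phi> "l i" "l j"] by (simp add: ll eq_neg_iff_add_eq_0)

lemma cr_sq: assumes "i \<in> idx" "valid_form \<phi>" shows "cl (l i) (cl (l i) \<phi>) = 0"
proof -
  let ?f = "cl (l i) (cl (l i) \<phi>)"
  have "?f U = - ?f U" for U
    using fun_cong[OF cr_cr[OF assms(1) assms(1) assms(2)], of U] by simp
  then show ?thesis by (simp add: fun_eq_iff)
qed

lemma an_cr:
  assumes "i \<in> idx" "j \<in> idx" "valid_form \<phi>"
  shows "cl (m i) (cl (l j) \<phi>) = (if i = j then sc 2 \<phi> else 0) - cl (l j) (cl (m i) \<phi>)"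
  using cl_anticomm[of \<phi> "m i" "l j"] assms lm[of j i] qf_sym[of "m i" "l j"]
  by (auto simp: eq_diff_eq)

text \<open>A new creator is moved to its sorted place by anticommuting it past every smaller entry,
  one sign each, which is exactly \<open>sg\<close>. If the entry is already present, the square of
  a creator kills the product.\<close>

lemma cr_foldr:
  assumes "sorted xs" "distinct xs" "set xs \<subseteq> idx" "a \<in> idx"
  shows "cl (l a) (foldr (\<lambda>i. cl (l i)) xs vac) =
    (if a \<in> set xs then 0 else sc (sg a (set xs)) (foldr (\<lambda>i. cl (l i)) (insort a xs) vac))"
  using assms
proof (induction xs)
  case Nil
  then show ?case by (simp add: sg_def)
next
  case (Cons x xs)
  let ?Y = "foldr (\<lambda>i. cl (l i)) xs vac"
  have v: "valid_form ?Y" by (rule valid_foldr)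
  consider "a < x" | "a = x" | "x < a" by linarith
  then show ?case
  proof cases
    case 1
    then have "{j \<in> set (x # xs). j < a} = {}" using Cons.prems by auto
    moreover have "a \<notin> set (x # xs)" using 1 Cons.prems by auto
    moreover have "sg a (set (x # xs)) = (1::'a)"
      unfolding sg_def \<open>{j \<in> set (x # xs). j < a} = {}\<close> by simp
    ultimately show ?thesis using 1 by simp
  next
    case 2
    then show ?thesis using cr_sq[OF _ v] Cons.prems by simp
  next
    case 3
    have *: "cl (l a) (foldr (\<lambda>i. cl (l i)) (x # xs) vac) = - cl (l x) (cl (l a) ?Y)"
      using cr_cr[OF _ _ v, of a x] Cons.prems by simp
    have s: "sg a (set (x # xs)) = (- sg a (set xs) :: 'a)"
      using sg_insert[of "set xs" x a] 3 Cons.prems by auto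
    show ?thesis unfolding * s using 3 Cons
      by (auto simp: lin_sc[OF lin_cl] lin_0[OF lin_cl])
  qed
qed

lemma cr_st:
  assumes "a \<in> idx" "S \<subseteq> idx"
  shows "cl (l a) (st S) = (if a \<in> S then 0 else sc (sg a S) (st (insert a S)))"
  using cr_foldr[of "sorted_list_of_set S" a] assms finite_subset_idx[of S]
  by (auto simp: st_def)

lemma st_insert:
  assumes "a \<in> idx" "S \<subseteq> idx" "a \<notin> S"
  shows "st (insert a S) = sc (sg a S) (cl (l a) (st S))"
  using cr_st[OF assms(1,2)] assms(3) by (simp add: sg_sq)

lemma an_foldr: "set xs \<subseteq> idx \<Longrightarrow> a \<in> idx \<Longrightarrow> a \<notin> set xs \<Longrightarrow> cl (m a) (foldr (\<lambda>i. cl (l i)) xs vac) = 0"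
  by (induction xs) (auto simp: vac_ann an_cr valid_foldr lin_0[OF lin_cl])

lemma an_st:
  assumes "a \<in> idx" "S \<subseteq> idx"
  shows "cl (m a) (st S) = (if a \<in> S then sc (2 * sg a S) (st (S - {a})) else 0)"
proof -
  have 0: "cl (m a) (st U) = 0" if "U \<subseteq> idx" "a \<notin> U" for U
    using an_foldr[of "sorted_list_of_set U" a] that assms(1) finite_subset_idx[of U] by (simp add: st_def)
  show ?thesis
  proof (cases "a \<in> S")
    case True
    let ?U = "S - {a}"
    have S: "S = insert a ?U" using True by auto
    have U: "?U \<subseteq> idx" using assms by auto
    have "cl (m a) (st S) = sc (sg a ?U) (cl (m a) (cl (l a) (st ?U)))"
      by (subst S, subst st_insert) (use assms in \<open>auto simp: lin_sc[OF lin_cl]\<close>)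
    also have "\<dots> = sc (sg a ?U) (sc 2 (st ?U))"
      using 0[OF U] assms by (subst an_cr) (auto simp: valid_st lin_0[OF lin_cl])
    finally show ?thesis using True by (simp add: sg_remove_self mult.commute)
  qed (use 0 assms in auto)
qed

text \<open>The isomorphism of Clifford modules from the standard Fock space to the one over
  \<open>vac\<close>: it sends the basis form of S to \<open>st S\<close>, \<open>cr0\<close> to the
  action of \<open>l\<close>, and twice \<open>an0\<close> to that of \<open>m\<close>.\<close>

definition Psi :: "'a form \<Rightarrow> 'a form" where
  "Psi \<phi> = (\<Sum>S\<in>Pow idx. sc (\<phi> S) (st S))"

lemma lin_Psi: "lin Psi"
  by (simp add: lin_def Psi_def sc.scale_left_distrib sum.distrib sc.scale_sum_right)

lemma valid_Psi: "valid_form (Psi \<phi>)"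
  by (auto simp: Psi_def intro!: valid_form_sum valid_form_sc valid_st)

lemma Psi_dl: assumes "S \<subseteq> idx" shows "Psi (dl S) = st S"
proof -
  have "Psi (dl S) = (\<Sum>T\<in>Pow idx. if T = S then st T else 0)"
    unfolding Psi_def by (intro sum.cong) (auto simp: dl_def)
  then show ?thesis using assms by (simp add: sum.delta')
qed

end

lemma cr0_dl: "a \<in> idx \<Longrightarrow> S \<subseteq> idx \<Longrightarrow> cr0 a (dl S) = (if a \<in> S then 0 else sc (sg a S) (dl (insert a S)))"
  by (auto simp: fun_eq_iff cr0_def dl_def sg_insert_self sg_remove_self)

lemma an0_dl: "a \<in> idx \<Longrightarrow> S \<subseteq> idx \<Longrightarrow> an0 a (dl S) = (if a \<in> S then sc (sg a S) (dl (S - {a})) else 0)"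
  by (auto simp: fun_eq_iff an0_def dl_def sg_insert_self sg_remove_self insert_absorb)

context frame begin

lemma Psi_cr0:
  assumes "valid_form \<phi>" "i \<in> idx" shows "Psi (cr0 i \<phi>) = cl (l i) (Psi \<phi>)"
proof (rule lin_eq_on_valid[OF lin_comp[OF lin_Psi lin_cr0] lin_comp[OF lin_cl lin_Psi] _ assms(1)])
  fix S assume "S \<subseteq> idx"
  then show "Psi (cr0 i (dl S)) = cl (l i) (Psi (dl S))"
    using assms(2) by (simp add: cr0_dl Psi_dl cr_st lin_0[OF lin_Psi] lin_sc[OF lin_Psi])
qed

text \<open>The factor 2 appears because \<open>m i\<close> and \<open>l i\<close> anticommute to 2,
  whereas \<open>an0 i\<close> and \<open>cr0 i\<close> anticommute to 1.\<close>

lemma Psi_an0: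
  assumes "valid_form \<phi>" "i \<in> idx" shows "sc 2 (Psi (an0 i \<phi>)) = cl (m i) (Psi \<phi>)"
proof (rule lin_eq_on_valid[OF lin_scale[OF lin_comp[OF lin_Psi lin_an0]] lin_comp[OF lin_cl lin_Psi] _ assms(1)])
  fix S assume S: "S \<subseteq> idx"
  then have "S - {i} \<subseteq> idx" by auto
  then show "sc 2 (Psi (an0 i (dl S))) = cl (m i) (Psi (dl S))"
    using assms(2) S by (simp add: an0_dl Psi_dl an_st lin_0[OF lin_Psi] lin_sc[OF lin_Psi])
qed

text \<open>A coefficient of maximal size is stripped down to the vacuum: \<open>an0 a\<close> keeps
  the kernel of \<open>Psi\<close> and lowers the top size by one, until only a multiple of the
  nonzero \<open>vac\<close> remains.\<close>

lemma Psi_inj_0: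
  assumes "valid_form \<phi>" "Psi \<phi> = 0" shows "\<phi> = 0"
proof (rule ccontr)
  assume "\<phi> \<noteq> 0"
  have step: "\<psi> S = 0" if "S \<subseteq> idx" "valid_form \<psi>" "Psi \<psi> = 0" "\<forall>T. card S < card T \<longrightarrow> \<psi> T = 0" for S \<psi>
    using that
  proof (induction "card S" arbitrary: S \<psi>)
    case 0
    then have "S = {}" using finite_subset_idx by auto
    have "\<psi> T = sc (\<psi> {}) (dl {}) T" for T
    proof (cases "T = {} \<or> \<not> T \<subseteq> idx")
      case False
      then have "card S < card T" using \<open>S = {}\<close> finite_subset_idx[of T] by (simp add: card_gt_0_iff)
      then have "\<psi> T = 0" using 0 by blast
      then show ?thesis using False by (simp add: dl_def)
    next
      case True
      then show ?thesis using \<open>valid_form \<psi>\<close> by (auto simp: dl_def valid_form_def)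
    qed
    then have "\<psi> = sc (\<psi> {}) (dl {})" by (rule ext)
    then have "sc (\<psi> {}) vac = 0"
      using \<open>Psi \<psi> = 0\<close> lin_sc[OF lin_Psi] Psi_dl[of "{}"] st_empty by (metis empty_subsetI)
    then show ?case using vac_nz \<open>S = {}\<close> by simp
  next
    case (Suc n)
    then obtain a where a: "a \<in> S" by fastforce
    have fin: "finite S" using Suc finite_subset_idx by auto
    have ai: "a \<in> idx" using a Suc by auto
    have z: "Psi (an0 a \<psi>) = 0"
      using Psi_an0[OF Suc(4) ai] Suc.prems by (simp add: lin_0[OF lin_cl])
    have "an0 a \<psi> (S - {a}) = 0"
    proof (rule Suc(1))
      show "n = card (S - {a})" using Suc a fin by simp
      show "\<forall>T. card (S - {a}) < card T \<longrightarrow> an0 a \<psi> T = 0"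
      proof (intro allI impI)
        fix T :: "nat set" assume "card (S - {a}) < card T"
        then have "card S < card (insert a T)" if "T \<subseteq> idx" "a \<notin> T"
          using that a fin finite_subset_idx[of T] by simp
        then show "an0 a \<psi> T = 0" using Suc.prems by (auto simp: an0_def)
      qed
    qed (use z Suc.prems valid_an0 in auto)
    moreover have "S - {a} \<subseteq> idx" using Suc.prems by auto
    ultimately have "sg a (S - {a}) * \<psi> S = 0"
      using a by (simp add: an0_def insert_absorb)
    then show ?case by (simp add: sg_def)
  qed
  from \<open>\<phi> \<noteq> 0\<close> obtain S where S: "\<phi> S \<noteq> 0" by (auto simp: fun_eq_iff)
  let ?A = "{S. \<phi> S \<noteq> 0}"
  have A: "?A \<subseteq> Pow idx" using assms(1) by (auto simp: valid_form_def)
  then have "finite ?A" by (rule finite_subset) simp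
  then have fin: "finite (card ` ?A)" "card ` ?A \<noteq> {}" using S by auto
  obtain M where M: "M \<in> ?A" "card M = Max (card ` ?A)"
    using Max_in[OF fin] unfolding image_iff by metis
  have max: "card T \<le> card M" if "\<phi> T \<noteq> 0" for T
    using Max_ge[OF fin(1)] that M(2) by simp
  have "\<phi> M = 0"
  proof (rule step)
    show "M \<subseteq> idx" using M A by blast
    show "\<forall>T. card M < card T \<longrightarrow> \<phi> T = 0" using max leD by blast
  qed (use assms in auto)
  with M show False by simp
qed

lemma Psi_inj: "valid_form \<phi> \<Longrightarrow> valid_form \<psi> \<Longrightarrow> Psi \<phi> = Psi \<psi> \<Longrightarrow> \<phi> = \<psi>"
  using Psi_inj_0[of "\<phi> - \<psi>"] by (simp add: lin_diff[OF lin_Psi] valid_form_def)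

end

section \<open>The spin representation\<close>

text \<open>Higher-order unification leaves eta-expanded operands behind, and on these the pointwise rules
  would destroy the vector space structure of a goal.\<close>

declare sc_apply [simp del]

lemma wedge_form1:
  fixes \<phi> :: "'a::field form"
  assumes "valid_form \<phi>" shows "wedge (form1 \<xi>) \<phi> = ext1 \<xi> \<phi>"
proof
  fix U
  show "wedge (form1 \<xi>) \<phi> U = ext1 \<xi> \<phi> U"
  proof (cases "finite U")
    case False
    then have "\<not> U \<subseteq> idx" using finite_subset_idx by auto
    with False show ?thesis
      by (simp add: wedge_def ext1_def sum_fun_apply sc_apply cr0_def)
  next
    case True
    let ?h = "\<lambda>S. wsign S (U - S) * form1 \<xi> S * \<phi> (U - S)"
    have "wedge (form1 \<xi>) \<phi> U = (\<Sum>S\<in>(\<lambda>i. {i}) ` (U \<inter> idx). ?h S)"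
      unfolding wedge_def using True by (intro sum.mono_neutral_right) (auto simp: form1_def)
    also have "\<dots> = (\<Sum>i\<in>U \<inter> idx. ?h {i})"
      by (subst sum.reindex) (auto simp: inj_on_def)
    also have "\<dots> = (\<Sum>i\<in>U \<inter> idx. \<xi> i * cr0 i \<phi> U)"
    proof (intro sum.cong refl)
      fix i assume i: "i \<in> U \<inter> idx"
      show "?h {i} = \<xi> i * cr0 i \<phi> U"
      proof (cases "U \<subseteq> idx")
        case True
        then show ?thesis using i
          by (simp add: form1_def wsign_sing sg_remove_self cr0_def mult.left_commute)
      next
        case False
        then have "\<not> U - {i} \<subseteq> idx" using i by auto
        then have "\<phi> (U - {i}) = 0" using assms by (simp add: valid_form_def)
        then show ?thesis using False by (simp add: cr0_def)
      qed
    qed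
    also have "\<dots> = (\<Sum>i\<in>idx. \<xi> i * cr0 i \<phi> U)"
      by (intro sum.mono_neutral_left) (auto simp: cr0_def)
    finally show ?thesis by (simp add: ext1_def sum_fun_apply sc_apply)
  qed
qed

lemma interior_an0: "interior v \<phi> = (\<Sum>i\<in>idx. sc (v i) (an0 i \<phi>))"
proof
  fix S
  show "interior v \<phi> S = (\<Sum>i\<in>idx. sc (v i) (an0 i \<phi>)) S"
  proof (cases "S \<subseteq> idx")
    case True
    have "interior v \<phi> S = (\<Sum>i\<in>idx - S. v i * an0 i \<phi> S)"
      using True by (auto simp: interior_def an0_def wsign_sing mult.assoc intro!: sum.cong)
    also have "\<dots> = (\<Sum>i\<in>idx. v i * an0 i \<phi> S)"
      by (intro sum.mono_neutral_left) (auto simp: an0_def)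
    finally show ?thesis by (simp add: sum_fun_apply sc_apply)
  qed (simp add: interior_def sum_fun_apply sc_apply an0_def)
qed

lemma cliff_cl: "valid_form \<phi> \<Longrightarrow> cliff x \<phi> = cl x \<phi>"
  by (cases x) (simp add: fun_eq_iff cliff_def wedge_form1 interior_an0 cl_def ext1_def sum_fun_apply sc_apply
      sum.distrib sum_distrib_left algebra_simps)

definition bv :: "nat \<Rightarrow> 'a::field vec" where
  "bv i = (\<lambda>j. if j = i then 1 else 0)"

lemma sum_bv [simp]:
  "i \<in> idx \<Longrightarrow> (\<Sum>j\<in>idx. f j * bv i j) = f i"
  "i \<in> idx \<Longrightarrow> (\<Sum>j\<in>idx. bv i j * f j) = f i"
  by (auto simp: bv_def if_distrib[of "(*) _"] if_distrib[of "\<lambda>x. x * _"] cong: if_cong)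

lemma sum_sc_bv: "i \<in> idx \<Longrightarrow> (\<Sum>j\<in>idx. sc (bv i j) (g j)) = g i"
  by (rule ext) (simp add: sum_fun_apply sc_apply)

lemma cl_cr0: "i \<in> idx \<Longrightarrow> cl (0, bv i) \<phi> = cr0 i \<phi>"
  by (simp add: cl_def sum_sc_bv)

lemma cl_an0: assumes "i \<in> idx" shows "cl (bv i, 0) \<phi> = sc 2 (an0 i \<phi>)"
proof -
  have "cl (bv i, 0) \<phi> = sc 2 (\<Sum>j\<in>idx. sc (bv i j) (an0 j \<phi>))"
    by (simp add: cl_def sc.scale_sum_right)
  then show ?thesis by (simp add: sum_sc_bv assms)
qed

section \<open>Operators on forms as matrices; uniqueness of the spin representation\<close>

definition opmat :: "('a::field form \<Rightarrow> 'a form) \<Rightarrow> nat set \<Rightarrow> nat set \<Rightarrow> 'a" where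
  "opmat f S T = (if S \<subseteq> idx \<and> T \<subseteq> idx then f (dl T) S else 0)"

lemma opmat_sum:
  assumes "lin f" "\<And>\<phi>. valid_form (f \<phi>)" "valid_form \<phi>"
  shows "(\<lambda>S. if S \<subseteq> idx then (\<Sum>T\<in>Pow idx. opmat f S T * \<phi> T) else 0) = f \<phi>"
proof
  fix S
  show "(if S \<subseteq> idx then (\<Sum>T\<in>Pow idx. opmat f S T * \<phi> T) else 0) = f \<phi> S"
    using assms(2)[of \<phi>] lin_decomp[OF assms(1,3)]
    by (auto simp: opmat_def sum_fun_apply sc_apply valid_form_def mult.commute)
qed

lemma rapp_opmat: "lin f \<Longrightarrow> (\<And>\<phi>. valid_form (f \<phi>)) \<Longrightarrow> valid_form \<phi> \<Longrightarrow> rapp (opmat f) \<phi> = f \<phi>"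
  unfolding rapp_def by (rule opmat_sum)

lemma lin_rapp: "lin (rapp M)"
  by (auto simp: lin_def rapp_def fun_eq_iff sc_apply algebra_simps sum.distrib sum_distrib_left)

lemma valid_rapp: "valid_form (rapp M \<phi>)"
  by (simp add: valid_form_def rapp_def)

lemma sum_mult_dl:
  assumes "T \<subseteq> idx" shows "(\<Sum>U\<in>Pow idx. f U * dl T U) = (f T :: 'a::field)"
proof -
  have "(\<Sum>U\<in>Pow idx. f U * dl T U) = (\<Sum>U\<in>Pow idx. if U = T then f U else 0)"
    by (intro sum.cong) (auto simp: dl_def)
  also have "\<dots> = (if T \<in> Pow idx then f T else 0)" by (rule sum.delta) simp
  finally show ?thesis using assms by simp
qed

lemma rapp_dl: "S \<subseteq> idx \<Longrightarrow> T \<subseteq> idx \<Longrightarrow> rapp M (dl T) S = M S T"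
  by (simp add: rapp_def sum_mult_dl)

text \<open>Schur's lemma for the Fock space. The image of the form 1 is killed by all annihilators,
  hence is a multiple of 1; the creators carry the same multiple to every basis form.\<close>

lemma commutant_scalar:
  fixes N :: "'a::field form \<Rightarrow> 'a form"
  assumes N: "lin N" "\<And>\<phi>. valid_form \<phi> \<Longrightarrow> valid_form (N \<phi>)"
    and cr: "\<And>i \<phi>. i \<in> idx \<Longrightarrow> valid_form \<phi> \<Longrightarrow> N (cr0 i \<phi>) = cr0 i (N \<phi>)"
    and an: "\<And>i \<phi>. i \<in> idx \<Longrightarrow> valid_form \<phi> \<Longrightarrow> N (an0 i \<phi>) = an0 i (N \<phi>)"
  obtains c where "\<And>S. S \<subseteq> idx \<Longrightarrow> N (dl S) = sc c (dl S)"
proof -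
  let ?\<psi> = "N (dl {})"
  have v: "valid_form ?\<psi>" by (intro N valid_dl) simp
  have z: "an0 i ?\<psi> = 0" if "i \<in> idx" for i
    using an[OF that, of "dl {}"] that by (simp add: valid_dl an0_dl lin_0[OF N(1)])
  have "?\<psi> S = sc (?\<psi> {}) (dl {}) S" for S
  proof (cases "S = {} \<or> \<not> S \<subseteq> idx")
    case True then show ?thesis using v by (auto simp: valid_form_def dl_def sc_apply)
  next
    case False
    then obtain i where i: "i \<in> S" by auto
    have "an0 i ?\<psi> (S - {i}) = 0" using z i False by (metis subsetD zero_fun_apply)
    moreover have "S - {i} \<subseteq> idx" using False by auto
    ultimately have "?\<psi> S = 0" using i by (simp add: an0_def insert_absorb sg_def)
    then show ?thesis using False by (simp add: dl_def sc_apply)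
  qed
  then have e: "?\<psi> = sc (?\<psi> {}) (dl {})" by (rule ext)
  have "N (dl S) = sc (?\<psi> {}) (dl S)" if "S \<subseteq> idx" for S
    using finite_subset_idx[OF that] that
  proof (induction S rule: finite_induct)
    case empty then show ?case using e by simp
  next
    case (insert a S)
    then have *: "dl (insert a S) = sc (sg a S) (cr0 a (dl S))"
      by (simp add: cr0_dl sg_sq)
    have "N (cr0 a (dl S)) = sc (?\<psi> {}) (cr0 a (dl S))"
      using insert by (simp add: cr valid_dl lin_sc[OF lin_cr0])
    then show ?case unfolding * by (simp add: lin_sc[OF N(1)] sc.scale_left_commute)
  qed
  then show ?thesis by (rule that)
qed

text \<open>The difference of two solutions commutes with the whole Clifford action, hence is scalar
  on a space of dimension 16, and the trace condition makes that scalar zero.\<close>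

lemma spin_mat_unique:
  assumes "spin_mat A M" "spin_mat A M'" shows "M = M'"
proof -
  define N where "N \<phi> = rapp M \<phi> - rapp M' \<phi>" for \<phi>
  have lN: "lin N" using lin_rapp[of M] lin_rapp[of M'] by (auto simp: N_def lin_def sc.scale_right_diff_distrib)
  have vN: "valid_form (N \<phi>)" for \<phi>
    using valid_rapp[of M \<phi>] valid_rapp[of M' \<phi>] by (simp add: N_def valid_form_def)
  have comm: "N (cl x \<phi>) = cl x (N \<phi>)" if v: "valid_form \<phi>" for x \<phi>
  proof -
    have "rapp R (cl x \<phi>) - cl x (rapp R \<phi>) = cl (A x) \<phi>" if "spin_mat A R" for R
    proof -
      from that v have "(\<lambda>S. rapp R (cliff x \<phi>) S - cliff x (rapp R \<phi>) S) = cliff (A x) \<phi>"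
        unfolding spin_mat_def by blast
      then show ?thesis using v by (simp add: cliff_cl valid_rapp fun_eq_iff)
    qed
    from this[OF assms(1)] this[OF assms(2)] show ?thesis
      by (simp add: N_def lin_diff[OF lin_cl] algebra_simps)
  qed
  have "N (an0 i \<phi>) = an0 i (N \<phi>)" if "i \<in> idx" "valid_form \<phi>" for i \<phi>
    using comm[OF that(2), of "(bv i, 0)"] that by (simp add: cl_an0 lin_sc[OF lN])
  moreover have "N (cr0 i \<phi>) = cr0 i (N \<phi>)" if "i \<in> idx" "valid_form \<phi>" for i \<phi>
    using comm[OF that(2), of "(0, bv i)"] that by (simp add: cl_cr0)
  ultimately obtain c where c: "\<And>S. S \<subseteq> idx \<Longrightarrow> N (dl S) = sc c (dl S)"
    using commutant_scalar[OF lN vN] by metis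
  have MM: "M S T - M' S T = c * dl T S" if "S \<subseteq> idx" "T \<subseteq> idx" for S T
    using fun_cong[OF c[OF that(2)], of S] that by (simp add: N_def rapp_dl sc_apply)
  have "0 = (\<Sum>S\<in>Pow idx. M S S - M' S S)"
    using assms by (simp add: spin_mat_def sum_subtractf)
  also have "\<dots> = (\<Sum>S\<in>Pow idx. c)"
    by (intro sum.cong refl) (use MM in \<open>auto simp: dl_def\<close>)
  also have "\<dots> = 16 * c" by (simp add: card_Pow idx_def)
  finally have "c = 0" by simp
  show ?thesis
  proof (intro ext)
    fix S T
    show "M S T = M' S T"
      using MM[of S T] \<open>c = 0\<close> assms by (cases "S \<subseteq> idx \<and> T \<subseteq> idx") (auto simp: spin_mat_def)
  qed
qed

definition optr :: "('a::field form \<Rightarrow> 'a form) \<Rightarrow> 'a" where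
  "optr f = (\<Sum>S\<in>Pow idx. f (dl S) S)"

lemma optr_swap:
  fixes f g :: "'a::field form \<Rightarrow> 'a form"
  assumes "lin f" "lin g" "\<And>\<phi>. valid_form (f \<phi>)" "\<And>\<phi>. valid_form (g \<phi>)"
  shows "optr (\<lambda>\<phi>. f (g \<phi>)) = optr (\<lambda>\<phi>. g (f \<phi>))"
proof -
  have e: "optr (\<lambda>\<phi>. f (g \<phi>)) = (\<Sum>S\<in>Pow idx. \<Sum>T\<in>Pow idx. g (dl S) T * f (dl T) S)"
    if "lin f" "\<And>\<phi>. valid_form (g \<phi>)" for f g :: "'a form \<Rightarrow> 'a form"
    unfolding optr_def using lin_decomp[OF that(1) that(2)] by (simp add: sum_fun_apply sc_apply)
  show ?thesis unfolding e[OF assms(1,4)] e[OF assms(2,3)]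
    by (subst sum.swap) (simp add: mult.commute)
qed

text \<open>By cyclicity the two orders of the product have equal trace, and their sum is
  multiplication by 2 q(x, y) on a space of dimension 16.\<close>

lemma optr_cl: "optr (\<lambda>\<phi>. cl x (cl y \<phi>)) = (16 * qf x y :: 'a::field_char_0)"
proof -
  have "optr (\<lambda>\<phi>. cl x (cl y \<phi>)) + optr (\<lambda>\<phi>. cl y (cl x \<phi>)) = (\<Sum>S\<in>Pow idx. (2 * qf x y :: 'a))"
    unfolding optr_def sum.distrib[symmetric]
  proof (intro sum.cong refl)
    fix S assume "S \<in> Pow idx"
    then have "valid_form (dl S :: 'a form)" by (simp add: valid_dl)
    from fun_cong[OF cl_anticomm[OF this, of x y], of S]
    show "cl x (cl y (dl S)) S + cl y (cl x (dl S)) S = 2 * qf x y"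
      by (simp add: dl_def sc_apply)
  qed
  also have "\<dots> = 32 * qf x y" by (simp add: card_Pow idx_def)
  finally have "2 * optr (\<lambda>\<phi>. cl x (cl y \<phi>)) = 2 * (16 * qf x y)"
    using optr_swap[of "cl x" "cl y", OF lin_cl lin_cl valid_cl valid_cl] by simp
  then show ?thesis by (simp only: mult_cancel_left) simp
qed

text \<open>The quadratic Clifford element \<open>1/4 \<Sum> c(A e\<^sub>a) c(e\<^sup>a)\<close> representing a skew map \<open>A\<close> that preserves the span of
  \<open>l\<close>, where \<open>J\<close> and \<open>K\<close> are the blocks of \<open>A\<close> from \<open>l\<close> to \<open>l\<close> and from \<open>m\<close> to \<open>l\<close>; normal ordering is
  harmless because \<open>J\<close> has trace zero.\<close>

definition quadop :: "(nat \<Rightarrow> 'a::field dvec) \<Rightarrow> (nat \<Rightarrow> 'a dvec) \<Rightarrow> 'a mat \<Rightarrow> 'a mat \<Rightarrow> 'a form \<Rightarrow> 'a form" where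
  "quadop l m J K \<phi> = (\<Sum>i\<in>idx. \<Sum>j\<in>idx. sc (J j i / 2) (cl (l j) (cl (m i) \<phi>)) + sc (K j i / 4) (cl (l j) (cl (l i) \<phi>)))"

lemma lin_cl_cl: "lin (\<lambda>\<phi>. cl x (cl y \<phi>))"
  by (rule lin_comp[OF lin_cl lin_cl])

lemma lin_quadop: "lin (quadop l m J K)"
  unfolding quadop_def by (intro lin_setsum lin_plus lin_scale lin_cl_cl)

lemma valid_quadop: "valid_form (quadop l m J K \<phi>)"
  by (auto simp: quadop_def intro!: valid_form_sum valid_form_add valid_form_sc valid_cl)

lemma cl_cl_comm:
  assumes "valid_form \<phi>"
  shows "cl a (cl b (cl x \<phi>)) - cl x (cl a (cl b \<phi>)) = sc (2 * qf b x) (cl a \<phi>) - sc (2 * qf a x) (cl b \<phi>)"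
proof -
  have "cl b (cl x \<phi>) = sc (2 * qf b x) \<phi> - cl x (cl b \<phi>)"
    using cl_anticomm[OF assms, of b x] by (simp add: eq_diff_eq)
  moreover have "cl a (cl x (cl b \<phi>)) = sc (2 * qf a x) (cl b \<phi>) - cl x (cl a (cl b \<phi>))"
    using cl_anticomm[OF valid_cl, of a x b \<phi>] by (simp add: eq_diff_eq)
  ultimately show ?thesis by (simp add: lin_diff[OF lin_cl] lin_sc[OF lin_cl])
qed

lemma qf_bv: "i \<in> idx \<Longrightarrow> qf x (bv i, 0) = snd x i" "i \<in> idx \<Longrightarrow> qf x (0, bv i) = fst x i"
  by (simp_all add: qf_def sum.distrib)

text \<open>\<open>qcomp\<close> says that \<open>l\<close> and \<open>m\<close> together span the
  doubled space. It is phrased through q, which sees only the entries indexed by \<open>idx\<close>,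
  so that values outside \<open>idx\<close> need no separate treatment.\<close>

locale cframe = frame +
  assumes qcomp: "\<And>x y. qf x y = (\<Sum>i\<in>idx. qf x (m i) * qf (l i) y + qf x (l i) * qf (m i) y)"
begin

lemma cl_comp: "cl x \<phi> = (\<Sum>i\<in>idx. sc (qf x (m i)) (cl (l i) \<phi>) + sc (qf x (l i)) (cl (m i) \<phi>))"
proof -
  have f: "fst x k = (\<Sum>i\<in>idx. qf x (m i) * fst (l i) k + qf x (l i) * fst (m i) k)" if "k \<in> idx" for k
    using qcomp[of x "(0, bv k)"] that by (simp add: qf_bv)
  have s: "snd x k = (\<Sum>i\<in>idx. qf x (m i) * snd (l i) k + qf x (l i) * snd (m i) k)" if "k \<in> idx" for k
    using qcomp[of x "(bv k, 0)"] that by (simp add: qf_bv)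
  show ?thesis
  proof
    fix U
    have "cl x \<phi> U = (\<Sum>k\<in>idx. 2 * fst x k * an0 k \<phi> U + snd x k * cr0 k \<phi> U)"
      by (simp add: cl_def sum_fun_apply sc_apply)
    also have "\<dots> = (\<Sum>k\<in>idx. \<Sum>i\<in>idx. qf x (m i) * (2 * fst (l i) k * an0 k \<phi> U + snd (l i) k * cr0 k \<phi> U)
        + qf x (l i) * (2 * fst (m i) k * an0 k \<phi> U + snd (m i) k * cr0 k \<phi> U))"
      by (intro sum.cong refl) (simp add: f s sum_distrib_left sum_distrib_right sum.distrib[symmetric] algebra_simps)
    also have "\<dots> = (\<Sum>i\<in>idx. \<Sum>k\<in>idx. qf x (m i) * (2 * fst (l i) k * an0 k \<phi> U + snd (l i) k * cr0 k \<phi> U)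
        + qf x (l i) * (2 * fst (m i) k * an0 k \<phi> U + snd (m i) k * cr0 k \<phi> U))"
      by (rule sum.swap)
    also have "\<dots> = (\<Sum>i\<in>idx. sc (qf x (m i)) (cl (l i) \<phi>) + sc (qf x (l i)) (cl (m i) \<phi>)) U"
      by (simp add: cl_def sum_fun_apply sc_apply sum_distrib_left sum.distrib algebra_simps)
    finally show "cl x \<phi> U = (\<Sum>i\<in>idx. sc (qf x (m i)) (cl (l i) \<phi>) + sc (qf x (l i)) (cl (m i) \<phi>)) U" .
  qed
qed

text \<open>The commutator of a product of two Clifford elements with c(x) is again linear in
  Clifford elements. Skewness and completeness identify the coefficients obtained with the frame
  components of \<open>A x\<close>; \<open>inv\<close> is why no product of two \<open>m\<close>
  occurs. The matrix K is antisymmetric, so its two contributions are equal, which accounts for 1/4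
  against the 1/2 at J.\<close>

lemma quadop_comm:
  fixes A :: "'a dvec \<Rightarrow> 'a dvec"
  assumes skew: "\<And>x y. qf (A x) y = - qf x (A y)"
    and inv: "\<And>i j. i \<in> idx \<Longrightarrow> j \<in> idx \<Longrightarrow> qf (A (l i)) (l j) = 0"
    and J: "\<And>i j. i \<in> idx \<Longrightarrow> j \<in> idx \<Longrightarrow> J j i = qf (A (l i)) (m j)"
    and K: "\<And>i j. i \<in> idx \<Longrightarrow> j \<in> idx \<Longrightarrow> K j i = qf (A (m i)) (m j)"
    and v: "valid_form \<phi>"
  shows "quadop l m J K (cl x \<phi>) - cl x (quadop l m J K \<phi>) = cl (A x) \<phi>"
proof
  fix U
  let ?a = "\<lambda>i. cl (l i) \<phi> U" and ?b = "\<lambda>i. cl (m i) \<phi> U"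
  have comm: "cl a (cl b (cl x \<phi>)) U - cl x (cl a (cl b \<phi>)) U = 2 * qf b x * cl a \<phi> U - 2 * qf a x * cl b \<phi> U" for a b
    using fun_cong[OF cl_cl_comm[OF v, of a b x], of U] by (simp add: sc_apply)
  have Kanti: "K j i = - K i j" if "i \<in> idx" "j \<in> idx" for i j
    using that skew[of "m i" "m j"] by (simp add: K qf_sym)
  have "(quadop l m J K (cl x \<phi>) - cl x (quadop l m J K \<phi>)) U
     = (\<Sum>i\<in>idx. \<Sum>j\<in>idx. J j i / 2 * (cl (l j) (cl (m i) (cl x \<phi>)) U - cl x (cl (l j) (cl (m i) \<phi>)) U)
          + K j i / 4 * (cl (l j) (cl (l i) (cl x \<phi>)) U - cl x (cl (l j) (cl (l i) \<phi>)) U))"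
    by (simp add: quadop_def lin_sum[OF lin_cl] lin_add[OF lin_cl] lin_sc[OF lin_cl] sum_fun_apply sc_apply
        sum_subtractf[symmetric] right_diff_distrib)
      (intro sum.cong refl, simp)
  also have "\<dots> = (\<Sum>i\<in>idx. \<Sum>j\<in>idx. J j i * qf (m i) x * ?a j - J j i * qf (l j) x * ?b i
        + K j i * qf (l i) x / 2 * ?a j - K j i * qf (l j) x / 2 * ?a i)"
    unfolding comm by (simp add: algebra_simps)
  also have "\<dots> = (\<Sum>i\<in>idx. \<Sum>j\<in>idx. (J j i * qf (m i) x + K j i * qf (l i) x / 2) * ?a j)
      - (\<Sum>i\<in>idx. \<Sum>j\<in>idx. K j i * qf (l j) x / 2 * ?a i) - (\<Sum>i\<in>idx. \<Sum>j\<in>idx. J j i * qf (l j) x * ?b i)"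
    by (simp add: sum_subtractf[symmetric] algebra_simps)
  also have "(\<Sum>i\<in>idx. \<Sum>j\<in>idx. K j i * qf (l j) x / 2 * ?a i) = (\<Sum>i\<in>idx. \<Sum>j\<in>idx. - K j i * qf (l i) x / 2 * ?a j)"
  proof (subst sum.swap, intro sum.cong refl)
    fix a b assume a: "a \<in> idx" and b: "b \<in> idx"
    show "K a b * qf (l a) x / 2 * ?a b = - K b a * qf (l a) x / 2 * ?a b"
      using Kanti[OF b a] by simp
  qed
  also have "(\<Sum>i\<in>idx. \<Sum>j\<in>idx. (J j i * qf (m i) x + K j i * qf (l i) x / 2) * ?a j)
      - (\<Sum>i\<in>idx. \<Sum>j\<in>idx. - K j i * qf (l i) x / 2 * ?a j)
      = (\<Sum>i\<in>idx. \<Sum>j\<in>idx. (J j i * qf (m i) x + K j i * qf (l i) x) * ?a j)"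
    unfolding sum_subtractf[symmetric] by (intro sum.cong refl) (simp add: field_simps)
  also have "\<dots> = (\<Sum>j\<in>idx. qf (A x) (m j) * ?a j)"
  proof (subst sum.swap, intro sum.cong refl)
    fix j assume j: "j \<in> idx"
    have "qf (A x) (m j) = - qf x (A (m j))" by (rule skew)
    also have "\<dots> = - (\<Sum>i\<in>idx. qf x (m i) * qf (l i) (A (m j)) + qf x (l i) * qf (m i) (A (m j)))"
      using qcomp by metis
    also have "\<dots> = (\<Sum>i\<in>idx. J j i * qf (m i) x + K j i * qf (l i) x)"
      unfolding sum_negf[symmetric]
    proof (intro sum.cong refl)
      fix i assume i: "i \<in> idx"
      have "qf (l i) (A (m j)) = - J j i" using skew[of "l i" "m j"] J[OF i j] by simp
      moreover have "qf (m i) (A (m j)) = - K j i" using Kanti[OF i j] K[OF j i] by (simp add: qf_sym)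
      ultimately show "- (qf x (m i) * qf (l i) (A (m j)) + qf x (l i) * qf (m i) (A (m j))) = J j i * qf (m i) x + K j i * qf (l i) x"
        by (simp add: qf_sym)
    qed
    finally show "(\<Sum>i\<in>idx. (J j i * qf (m i) x + K j i * qf (l i) x) * ?a j) = qf (A x) (m j) * ?a j"
      by (simp add: sum_distrib_right)
  qed
  also have "(\<Sum>i\<in>idx. \<Sum>j\<in>idx. J j i * qf (l j) x * ?b i) = (\<Sum>i\<in>idx. - qf (A x) (l i) * ?b i)"
  proof (intro sum.cong refl)
    fix i assume i: "i \<in> idx"
    have "qf (A x) (l i) = - qf x (A (l i))" by (rule skew)
    also have "\<dots> = - (\<Sum>j\<in>idx. qf x (m j) * qf (l j) (A (l i)) + qf x (l j) * qf (m j) (A (l i)))"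
      using qcomp by metis
    also have "\<dots> = - (\<Sum>j\<in>idx. J j i * qf (l j) x)"
      using i by (simp add: J inv qf_sym[of _ "A _"] qf_sym[of x] mult.commute)
    finally show "(\<Sum>j\<in>idx. J j i * qf (l j) x * ?b i) = - qf (A x) (l i) * ?b i"
      by (simp add: sum_distrib_right)
  qed
  finally show "(quadop l m J K (cl x \<phi>) - cl x (quadop l m J K \<phi>)) U = cl (A x) \<phi> U"
    by (subst cl_comp[of "A x"]) (simp add: sum_fun_apply sc_apply sum.distrib sum_negf)
qed

lemma optr_quadop:
  assumes "(\<Sum>i\<in>idx. J i i) = 0"
  shows "optr (quadop l m J K) = 0"
proof -
  have "optr (quadop l m J K) = (\<Sum>i\<in>idx. \<Sum>j\<in>idx. J j i / 2 * optr (\<lambda>\<phi>. cl (l j) (cl (m i) \<phi>)) + K j i / 4 * optr (\<lambda>\<phi>. cl (l j) (cl (l i) \<phi>)))"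
  proof -
    have sw: "(\<Sum>S\<in>Pow idx. \<Sum>i\<in>idx. \<Sum>j\<in>idx. t S i j) = (\<Sum>i\<in>idx. \<Sum>j\<in>idx. \<Sum>S\<in>Pow idx. t S i j)" for t :: "nat set \<Rightarrow> nat \<Rightarrow> nat \<Rightarrow> 'a"
      by (subst sum.swap, intro sum.cong refl, rule sum.swap)
    show ?thesis
      unfolding optr_def quadop_def sum_distrib_left sum.distrib[symmetric]
      by (simp add: sum_fun_apply sc_apply sw)
  qed
  also have "\<dots> = (\<Sum>i\<in>idx. \<Sum>j\<in>idx. if j = i then 8 * J j i else 0)"
    by (intro sum.cong refl) (simp add: optr_cl ll lm)
  also have "\<dots> = 8 * (\<Sum>i\<in>idx. J i i)" by (simp add: sum_distrib_left)
  finally show ?thesis using assms by simp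
qed

end

text \<open>Evaluates the definite description \<open>dspin\<close>: the quadratic element satisfies
  the commutation rule and has trace 8 times that of J, hence zero, and such a matrix is
  unique.\<close>

lemma spin_mat_quadop:
  fixes l m :: "nat \<Rightarrow> lam"
  assumes "cframe l m vac"
    and skew: "\<And>x y. qf (A x) y = - qf x (A y)"
    and inv: "\<And>i j. i \<in> idx \<Longrightarrow> j \<in> idx \<Longrightarrow> qf (A (l i)) (l j) = 0"
    and J: "\<And>i j. i \<in> idx \<Longrightarrow> j \<in> idx \<Longrightarrow> J j i = qf (A (l i)) (m j)"
    and K: "\<And>i j. i \<in> idx \<Longrightarrow> j \<in> idx \<Longrightarrow> K j i = qf (A (m i)) (m j)"
    and tr: "(\<Sum>i\<in>idx. J i i) = 0"
  shows "dspin A = opmat (quadop l m J K)"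
proof -
  interpret cframe l m vac by fact
  let ?D = "quadop l m J K"
  have r: "rapp (opmat ?D) \<phi> = ?D \<phi>" if "valid_form \<phi>" for \<phi>
    by (rule rapp_opmat[OF lin_quadop valid_quadop that])
  have "spin_mat A (opmat ?D)"
    unfolding spin_mat_def
  proof (intro conjI allI impI)
    fix x :: lam and \<phi> :: "real form" assume v: "valid_form \<phi>"
    have "?D (cl x \<phi>) - cl x (?D \<phi>) = cl (A x) \<phi>"
      by (rule quadop_comm[OF skew inv J K v])
    then show "(\<lambda>S. rapp (opmat ?D) (cliff x \<phi>) S - cliff x (rapp (opmat ?D) \<phi>) S) = cliff (A x) \<phi>"
      using v by (simp add: cliff_cl r valid_cl valid_quadop fun_eq_iff)
  next
    show "(\<Sum>S\<in>Pow idx. opmat ?D S S) = 0"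
      using optr_quadop[of J K, OF tr] by (simp add: opmat_def optr_def)
  qed (auto simp: opmat_def)
  then show ?thesis unfolding dspin_def using spin_mat_unique by blast
qed

section \<open>Frames of the doubled lattice\<close>

text \<open>Trivial left kernel makes the rows independent, and a dimension count makes them span,
  which gives a left inverse N. The rows of M N - 1 lie again in the left kernel of M, so N is also
  a right inverse.\<close>

lemma idx_matrix_inverse:
  fixes M :: "'a::field mat"
  assumes ker: "\<And>c a. (\<And>K. K \<in> idx \<Longrightarrow> (\<Sum>a\<in>idx. c a * M a K) = 0) \<Longrightarrow> a \<in> idx \<Longrightarrow> c a = 0"
  obtains N where "\<And>i j. i \<in> idx \<Longrightarrow> j \<in> idx \<Longrightarrow> (\<Sum>k\<in>idx. N i k * M k j) = (if i = j then 1 else 0)"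
    and "\<And>i j. i \<in> idx \<Longrightarrow> j \<in> idx \<Longrightarrow> (\<Sum>k\<in>idx. M i k * N k j) = (if i = j then 1 else 0)"
proof -
  define r where "r a = (\<lambda>K. if K \<in> idx then M a K else 0)" for a
  have inj: "inj_on r idx"
  proof (rule inj_onI, rule ccontr)
    fix a b assume ab: "a \<in> idx" "b \<in> idx" "r a = r b" "a \<noteq> b"
    have "(\<Sum>k\<in>idx. (bv a k - bv b k) * M k K) = 0" if "K \<in> idx" for K
      using fun_cong[OF ab(3), of K] ab that by (simp add: left_diff_distrib sum_subtractf r_def)
    from ker[OF this ab(1)] ab(4) show False by (simp add: bv_def)
  qed
  have comb: "(\<Sum>v\<in>r ` idx. sc (u v) v) = (\<Sum>a\<in>idx. sc (u (r a)) (r a))" for u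
    by (simp add: sum.reindex[OF inj])
  have ind: "sc.independent (r ` idx)"
  proof
    assume "sc.dependent (r ` idx)"
    then obtain u where u: "\<exists>v\<in>r ` idx. u v \<noteq> 0" "(\<Sum>a\<in>idx. sc (u (r a)) (r a)) = 0"
      unfolding sc.dependent_finite[OF finite_imageI[OF finite_idx]] comb by blast
    have "(\<Sum>a\<in>idx. u (r a) * M a K) = 0" if "K \<in> idx" for K
      using fun_cong[OF u(2), of K] that by (simp add: sum_fun_apply sc_apply r_def)
    from ker[OF this] u(1) show False by auto
  qed
  have sub: "v \<in> sc.span (bv ` idx)" if "\<And>K. K \<notin> idx \<Longrightarrow> v K = 0" for v :: "nat \<Rightarrow> 'a"
  proof -
    have "v K = (\<Sum>j\<in>idx. sc (v j) (bv j)) K" for K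
    proof (cases "K \<in> idx")
      case True
      have "(\<Sum>j\<in>idx. v j * bv j K) = (\<Sum>j\<in>idx. v j * bv K j)" by (intro sum.cong refl) (auto simp: bv_def)
      then show ?thesis using True by (simp add: sum_fun_apply sc_apply)
    next
      case False
      then have "(\<Sum>j\<in>idx. v j * bv j K) = 0" by (intro sum.neutral) (auto simp: bv_def)
      then show ?thesis using that[OF False] by (simp add: sum_fun_apply sc_apply)
    qed
    then have "v = (\<Sum>j\<in>idx. sc (v j) (bv j))" by (rule ext)
    moreover have "(\<Sum>j\<in>idx. sc (v j) (bv j)) \<in> sc.span (bv ` idx)"
      by (intro sc.span_sum sc.span_scale sc.span_base imageI)
    ultimately show ?thesis by simp
  qed
  have bi: "bv j \<in> sc.span (r ` idx)" if "j \<in> idx" for j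
  proof (rule ccontr)
    assume no: "bv j \<notin> sc.span (r ` idx)"
    then have "sc.independent (insert (bv j) (r ` idx))"
      using ind by (rule sc.independent_insertI)
    moreover have "insert (bv j) (r ` idx) \<subseteq> sc.span (bv ` idx)"
    proof -
      have "bv j \<in> sc.span (bv ` idx)" using that by (intro sc.span_base) simp
      moreover have "r a \<in> sc.span (bv ` idx)" for a by (rule sub) (simp add: r_def)
      ultimately show ?thesis by auto
    qed
    ultimately have "card (insert (bv j) (r ` idx)) \<le> card (bv ` idx :: 'a vec set)"
      using sc.independent_span_bound[OF finite_imageI[OF finite_idx]] by (metis (no_types))
    also have "\<dots> \<le> card idx" by (simp add: card_image_le)
    finally have "card (insert (bv j) (r ` idx)) \<le> card idx" .
    moreover have "bv j \<notin> r ` idx" using no sc.span_base by blast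
    ultimately show False using card_image[OF inj] by simp
  qed
  have "\<forall>j\<in>idx. \<exists>n. \<forall>K\<in>idx. (\<Sum>k\<in>idx. n k * M k K) = (if j = K then 1 else 0)"
  proof
    fix j assume j: "j \<in> idx"
    obtain u where "bv j = (\<Sum>v\<in>r ` idx. sc (u v) v)"
      using bi[OF j] unfolding sc.span_finite[OF finite_imageI[OF finite_idx]] by blast
    then have u: "bv j = (\<Sum>a\<in>idx. sc (u (r a)) (r a))" unfolding comb .
    have "(\<Sum>a\<in>idx. u (r a) * M a K) = (if j = K then 1 else 0)" if "K \<in> idx" for K
      using fun_cong[OF u, of K] that by (auto simp: sum_fun_apply sc_apply r_def bv_def)
    then show "\<exists>n. \<forall>K\<in>idx. (\<Sum>k\<in>idx. n k * M k K) = (if j = K then 1 else 0)"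
      by (intro exI[of _ "\<lambda>a. u (r a)"]) blast
  qed
  then obtain N where N: "\<And>i j. i \<in> idx \<Longrightarrow> j \<in> idx \<Longrightarrow> (\<Sum>k\<in>idx. N i k * M k j) = (if i = j then 1 else 0)"
    by (drule_tac bchoice) blast
  have "(\<Sum>k\<in>idx. M i k * N k j) = (if i = j then 1 else 0)" if ij: "i \<in> idx" "j \<in> idx" for i j
  proof -
    let ?c = "\<lambda>a. (\<Sum>k\<in>idx. M i k * N k a) - bv i a"
    have "(\<Sum>a\<in>idx. ?c a * M a K) = 0" if K: "K \<in> idx" for K
    proof -
      have "(\<Sum>a\<in>idx. (\<Sum>k\<in>idx. M i k * N k a) * M a K) = (\<Sum>k\<in>idx. M i k * (\<Sum>a\<in>idx. N k a * M a K))"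
        by (simp add: sum_distrib_left sum_distrib_right mult.assoc) (rule sum.swap)
      also have "\<dots> = (\<Sum>k\<in>idx. M i k * bv K k)"
        by (intro sum.cong refl) (simp add: N K bv_def)
      finally show ?thesis using K ij by (simp add: left_diff_distrib sum_subtractf)
    qed
    from ker[OF this ij(2)] show ?thesis by (auto simp: bv_def)
  qed
  with N show ?thesis by (rule that)
qed

definition lc :: "'a::field vec \<Rightarrow> (nat \<Rightarrow> 'a dvec) \<Rightarrow> 'a dvec" where
  "lc c l = (\<Sum>a\<in>idx. sc (c a) (fst (l a)), \<Sum>a\<in>idx. sc (c a) (snd (l a)))"

lemma qf_lc: "qf (lc c l) y = (\<Sum>a\<in>idx. c a * qf (l a) y)"
proof -
  have "qf (lc c l) y = (\<Sum>i\<in>idx. \<Sum>a\<in>idx. c a * (snd (l a) i * fst y i + snd y i * fst (l a) i))"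
    unfolding qf_def lc_def
    by (intro sum.cong refl) (simp add: sum_fun_apply sc_apply sum_distrib_left sum_distrib_right
        sum.distrib distrib_left mult.assoc mult.left_commute)
  also have "\<dots> = (\<Sum>a\<in>idx. c a * qf (l a) y)"
    unfolding qf_def sum_distrib_left by (rule sum.swap)
  finally show ?thesis .
qed

lemma cl_lc: "cl (lc c l) \<phi> = (\<Sum>a\<in>idx. sc (c a) (cl (l a) \<phi>))"
proof
  fix U
  have "cl (lc c l) \<phi> U = (\<Sum>i\<in>idx. \<Sum>a\<in>idx. c a * (2 * fst (l a) i * an0 i \<phi> U + snd (l a) i * cr0 i \<phi> U))"
    unfolding cl_def lc_def sum_fun_apply plus_fun_apply sc_apply
    by (intro sum.cong refl) (simp add: sum_fun_apply sc_apply sum_distrib_left sum_distrib_right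
        sum.distrib distrib_left mult.assoc mult.left_commute)
  also have "\<dots> = (\<Sum>a\<in>idx. c a * (\<Sum>i\<in>idx. 2 * fst (l a) i * an0 i \<phi> U + snd (l a) i * cr0 i \<phi> U))"
    unfolding sum_distrib_left by (rule sum.swap)
  finally show "cl (lc c l) \<phi> U = (\<Sum>a\<in>idx. sc (c a) (cl (l a) \<phi>)) U"
    by (simp add: cl_def sum_fun_apply sc_apply)
qed

lemma sum_swap3: "(\<Sum>i\<in>A. \<Sum>a\<in>B. \<Sum>b\<in>C. t i a b) = (\<Sum>a\<in>B. \<Sum>b\<in>C. \<Sum>i\<in>A. t i a b)"
proof -
  have "(\<Sum>i\<in>A. \<Sum>a\<in>B. \<Sum>b\<in>C. t i a b) = (\<Sum>a\<in>B. \<Sum>i\<in>A. \<Sum>b\<in>C. t i a b)" by (rule sum.swap)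
  also have "\<dots> = (\<Sum>a\<in>B. \<Sum>b\<in>C. \<Sum>i\<in>A. t i a b)" by (intro sum.cong refl sum.swap)
  finally show ?thesis .
qed

lemma sum_delta_idx:
  "i \<in> idx \<Longrightarrow> (\<Sum>a\<in>idx. f a * (if a = i then 1 else 0)) = (f i :: 'a::field)"
  "i \<in> idx \<Longrightarrow> (\<Sum>a\<in>idx. f a * (if i = a then 1 else 0)) = (f i :: 'a::field)"
  using sum_bv(1)[of i f] unfolding bv_def eq_commute[of i] by auto

text \<open>\<open>l\<close> transforms by X and \<open>m\<close> contragrediently by the inverse Y,
  which preserves their duality. The vacuum stays, because the span of \<open>m\<close>
  does.\<close>

lemma cframe_change:
  assumes "cframe l m vac"
    and XY: "\<And>i j. i \<in> idx \<Longrightarrow> j \<in> idx \<Longrightarrow> (\<Sum>a\<in>idx. X i a * Y a j) = (if i = j then 1 else 0)"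
    and YX: "\<And>i j. i \<in> idx \<Longrightarrow> j \<in> idx \<Longrightarrow> (\<Sum>a\<in>idx. Y i a * X a j) = (if i = j then 1 else 0)"
  shows "cframe (\<lambda>i. lc (X i) l) (\<lambda>i. lc (\<lambda>a. Y a i) m) vac"
proof -
  interpret cframe l m vac by fact
  have qr: "qf y (lc c l) = (\<Sum>a\<in>idx. c a * qf y (l a))" for c l y
    using qf_lc[of c l y] by (simp add: qf_sym)
  show ?thesis
  proof
    fix i j assume "i \<in> idx" "j \<in> idx"
    then show "qf (lc (X i) l) (lc (X j) l) = 0" by (simp add: qf_lc qr ll)
  next
    fix i j assume "i \<in> idx" "j \<in> idx"
    then show "qf (lc (\<lambda>a. Y a i) m) (lc (\<lambda>a. Y a j) m) = 0" by (simp add: qf_lc qr mm)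
  next
    fix i j assume ij: "i \<in> idx" "j \<in> idx"
    have "qf (lc (X i) l) (lc (\<lambda>a. Y a j) m) = (\<Sum>a\<in>idx. X i a * (\<Sum>b\<in>idx. Y b j * (if a = b then 1 else 0)))"
      by (subst qf_lc) (simp add: qr lm)
    also have "\<dots> = (\<Sum>a\<in>idx. X i a * Y a j)"
      by (intro sum.cong refl) (simp add: sum_delta_idx)
    finally show "qf (lc (X i) l) (lc (\<lambda>a. Y a j) m) = (if i = j then 1 else 0)" using XY[OF ij] by simp
  next
    fix i assume "i \<in> idx"
    then show "cl (lc (\<lambda>a. Y a i) m) vac = 0" by (simp add: cl_lc vac_ann)
  next
    fix x y
    have *: "(\<Sum>i\<in>idx. (\<Sum>a\<in>idx. Y a i * p a) * (\<Sum>b\<in>idx. X i b * r b)) = (\<Sum>a\<in>idx. p a * r a)" for p r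
    proof -
      have "(\<Sum>i\<in>idx. (\<Sum>a\<in>idx. Y a i * p a) * (\<Sum>b\<in>idx. X i b * r b)) = (\<Sum>i\<in>idx. \<Sum>a\<in>idx. \<Sum>b\<in>idx. p a * r b * (Y a i * X i b))"
        by (simp add: sum_product algebra_simps)
      also have "\<dots> = (\<Sum>a\<in>idx. \<Sum>b\<in>idx. p a * r b * (\<Sum>i\<in>idx. Y a i * X i b))"
        unfolding sum_distrib_left by (rule sum_swap3)
      also have "\<dots> = (\<Sum>a\<in>idx. \<Sum>b\<in>idx. p a * r b * (if a = b then 1 else 0))"
        by (intro sum.cong refl) (simp add: YX)
      also have "\<dots> = (\<Sum>a\<in>idx. p a * r a)"
        by (intro sum.cong refl) (rule sum_delta_idx)
      finally show ?thesis .
    qed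
    have "qf x y = (\<Sum>i\<in>idx. qf x (m i) * qf (l i) y) + (\<Sum>i\<in>idx. qf (m i) y * qf x (l i))"
      by (subst qcomp) (simp add: sum.distrib mult.commute)
    also have "\<dots> = (\<Sum>i\<in>idx. (\<Sum>a\<in>idx. Y a i * qf x (m a)) * (\<Sum>b\<in>idx. X i b * qf (l b) y))
        + (\<Sum>i\<in>idx. (\<Sum>a\<in>idx. Y a i * qf (m a) y) * (\<Sum>b\<in>idx. X i b * qf x (l b)))"
      unfolding * ..
    finally show "qf x y = (\<Sum>i\<in>idx. qf x (lc (\<lambda>a. Y a i) m) * qf (lc (X i) l) y + qf x (lc (X i) l) * qf (lc (\<lambda>a. Y a i) m) y)"
      by (simp add: qf_lc qr sum.distrib mult.commute)
  qed (rule vac_valid vac_nz)+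
qed

text \<open>Exchanges \<open>l\<close> and \<open>m\<close> at the indices 1 and 2. The new vacuum
  is the state with exactly 1 and 2 occupied: \<open>l 1\<close> and \<open>l 2\<close> kill it
  because these places are full, \<open>m 3\<close> and \<open>m 4\<close> because those are empty.
  For the lattice frame this is T-duality along the fibre.\<close>

lemma cframe_flip:
  fixes l m :: "nat \<Rightarrow> 'a::field_char_0 dvec"
  assumes "cframe l m vac"
  shows "cframe (\<lambda>a. if a \<in> {1, 2} then m a else l a) (\<lambda>a. if a \<in> {1, 2} then l a else m a)
           (cl (l 1) (cl (l 2) vac))"
proof -
  interpret cframe l m vac by fact
  have i: "1 \<in> idx" "2 \<in> idx" by (auto simp: idx_def)
  have lm': "qf (m i) (l j) = (if i = j then 1 else 0)" if "i \<in> idx" "j \<in> idx" for i j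
    using lm[OF that(2,1)] by (simp add: qf_sym)
  have st12: "st {1, 2} = cl (l 1) (cl (l 2) vac)"
    by (simp add: st_def)
  show ?thesis
  proof
    fix i j assume "i \<in> idx" "j \<in> idx"
    then show "qf (if i \<in> {1, 2} then m i else l i) (if j \<in> {1, 2} then m j else l j) = 0"
      by (auto simp: ll mm lm lm')
  next
    fix i j assume "i \<in> idx" "j \<in> idx"
    then show "qf (if i \<in> {1, 2} then l i else m i) (if j \<in> {1, 2} then l j else m j) = 0"
      by (auto simp: ll mm lm lm')
  next
    fix i j assume "i \<in> idx" "j \<in> idx"
    then show "qf (if i \<in> {1, 2} then m i else l i) (if j \<in> {1, 2} then l j else m j) = (if i = j then 1 else 0)"
      by (auto simp: ll mm lm lm')
  next
    show "valid_form (cl (l 1) (cl (l 2) vac))" by (rule valid_cl)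
  next
    show "cl (l 1) (cl (l 2) vac) \<noteq> 0"
    proof
      assume "cl (l 1) (cl (l 2) vac) = 0"
      then have "Psi (dl {1, 2}) = 0" using st12 i by (simp add: Psi_dl)
      from Psi_inj_0[OF _ this] i have "dl {1, 2} = (0 :: 'a form)" by (simp add: valid_dl)
      from fun_cong[OF this, of "{1, 2}"] show False by (simp add: dl_def)
    qed
  next
    fix a assume a: "a \<in> idx"
    show "cl (if a \<in> {1, 2} then l a else m a) (cl (l 1) (cl (l 2) vac)) = 0"
      unfolding st12[symmetric] using a i cr_st[of a "{1, 2}"] an_st[of a "{1, 2}"] by auto
  next
    fix x y
    show "qf x y = (\<Sum>i\<in>idx. qf x (if i \<in> {1, 2} then l i else m i) * qf (if i \<in> {1, 2} then m i else l i) y +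
             qf x (if i \<in> {1, 2} then m i else l i) * qf (if i \<in> {1, 2} then l i else m i) y)"
      by (subst qcomp) (auto intro!: sum.cong)
  qed
qed

lemma cframe_std: "cframe (\<lambda>i. (0, bv i)) (\<lambda>i. (bv i, 0)) (unit_form :: 'a::field_char_0 form)"
proof
  fix i j :: nat assume "i \<in> idx" "j \<in> idx"
  then show "qf (0, bv i) (bv j, 0) = (if i = j then 1 else 0 :: 'a)"
    by (simp add: qf_bv) (simp add: bv_def)
next
  fix i :: nat assume "i \<in> idx"
  then show "cl (bv i, 0) (unit_form :: 'a form) = 0"
    by (simp add: cl_an0 unit_form_dl an0_dl)
next
  fix x y :: "'a dvec"
  have "(\<Sum>i\<in>idx. qf x (bv i, 0) * qf (0, bv i) y + qf x (0, bv i) * qf (bv i, 0) y) = (\<Sum>i\<in>idx. snd x i * fst y i + fst x i * snd y i)"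
    by (intro sum.cong refl) (simp add: qf_bv qf_sym[of _ y])
  then show "qf x y = (\<Sum>i\<in>idx. qf x (bv i, 0) * qf (0, bv i) y + qf x (0, bv i) * qf (bv i, 0) y)"
    by (simp add: qf_def mult.commute)
next
  show "(unit_form :: 'a form) \<noteq> 0"
    by (auto simp: fun_eq_iff unit_form_def)
qed (auto simp: qf_def unit_form_dl valid_dl)

section \<open>The complex structure on the doubled lattice\<close>

definition gamv :: "int mat \<Rightarrow> nat \<Rightarrow> 'a::field vec" where
  "gamv P a = (\<lambda>K. if K \<in> idx then of_int (P K a) else 0)"

definition thtv :: "int mat \<Rightarrow> nat \<Rightarrow> 'a::field vec" where
  "thtv Pinv a = (\<lambda>K. if K \<in> idx then of_int (Pinv a K) else 0)"

text \<open>\<open>fl0\<close> lists \<open>\<gamma>\<^sub>1, \<gamma>\<^sub>2, \<theta>\<^sup>3, \<theta>\<^sup>4\<close>, a basis of \<open>F\<close>, and \<open>fm0\<close> the dual isotropic basis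
  \<open>\<theta>\<^sup>1, \<theta>\<^sup>2, \<gamma>\<^sub>3, \<gamma>\<^sub>4\<close>.\<close>

definition fl0 :: "int mat \<Rightarrow> int mat \<Rightarrow> nat \<Rightarrow> 'a::field dvec" where
  "fl0 P Pinv a = (if a \<in> {1, 2} then (gamv P a, 0) else (0, thtv Pinv a))"

definition fm0 :: "int mat \<Rightarrow> int mat \<Rightarrow> nat \<Rightarrow> 'a::field dvec" where
  "fm0 P Pinv a = (if a \<in> {1, 2} then (0, thtv Pinv a) else (gamv P a, 0))"

definition vac0 :: "int mat \<Rightarrow> 'a::field form" where
  "vac0 Pinv = cl (0, thtv Pinv 1) (cl (0, thtv Pinv 2) unit_form)"

text \<open>\<open>H\<close> will be the matrix of \<open>g\<^sub>s\<close> on the basis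
  \<open>fl0\<close>. Changing basis by its inverse \<open>Hi\<close> makes \<open>g\<^sub>s\<close>
  send the i-th vector to the coordinate covector dX^i, so the frame itself carries the rational
  isomorphism.\<close>

definition fl :: "int mat \<Rightarrow> int mat \<Rightarrow> rat mat \<Rightarrow> nat \<Rightarrow> 'a::field_char_0 dvec" where
  "fl P Pinv Hi i = lc (\<lambda>a. of_rat (Hi i a)) (fl0 P Pinv)"

definition fm :: "int mat \<Rightarrow> int mat \<Rightarrow> rat mat \<Rightarrow> nat \<Rightarrow> 'a::field_char_0 dvec" where
  "fm P Pinv H i = lc (\<lambda>a. of_rat (H a i)) (fm0 P Pinv)"

definition inv_mats :: "'a::comm_ring_1 mat \<Rightarrow> 'a mat \<Rightarrow> bool" where
  "inv_mats X Y \<longleftrightarrow> (\<forall>i\<in>idx. \<forall>j\<in>idx. (\<Sum>k\<in>idx. X i k * Y k j) = (if i = j then 1 else 0))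
     \<and> (\<forall>i\<in>idx. \<forall>j\<in>idx. (\<Sum>k\<in>idx. Y i k * X k j) = (if i = j then 1 else 0))"

lemma inv_matsD:
  assumes "inv_mats X Y" "i \<in> idx" "j \<in> idx"
  shows "(\<Sum>k\<in>idx. X i k * Y k j) = (if i = j then 1 else 0)"
    and "(\<Sum>k\<in>idx. Y i k * X k j) = (if i = j then 1 else 0)"
  using assms by (auto simp: inv_mats_def)

lemma inv_mats_exists:
  fixes M :: "'a::field mat"
  assumes "\<forall>c. (\<forall>K\<in>idx. (\<Sum>a\<in>idx. c a * M a K) = 0) \<longrightarrow> (\<forall>a\<in>idx. c a = 0)"
  shows "\<exists>N. inv_mats N M"
proof (rule idx_matrix_inverse[where M = M])
  show "c a = 0" if "\<And>K. K \<in> idx \<Longrightarrow> (\<Sum>a\<in>idx. c a * M a K) = 0" "a \<in> idx" for c a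
    using assms that by blast
qed (unfold inv_mats_def, blast)

lemma inv_mats_of_int:
  assumes "inv_mats X Y" shows "inv_mats (\<lambda>i j. of_int (X i j) :: 'a::field_char_0) (\<lambda>i j. of_int (Y i j))"
proof -
  have "(\<Sum>k\<in>idx. of_int (X i k) * of_int (Y k j)) = (if i = j then 1 else 0 :: 'a)"
    "(\<Sum>k\<in>idx. of_int (Y i k) * of_int (X k j)) = (if i = j then 1 else 0 :: 'a)"
    if "i \<in> idx" "j \<in> idx" for i j
    using inv_matsD[OF assms that, THEN arg_cong, of "of_int :: int \<Rightarrow> 'a"]
    by (simp_all split: if_splits)
  then show ?thesis by (simp add: inv_mats_def)
qed

lemma inv_mats_of_rat:
  assumes "inv_mats X Y" shows "inv_mats (\<lambda>i j. of_rat (X i j) :: 'a::field_char_0) (\<lambda>i j. of_rat (Y i j))"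
proof -
  have "(\<Sum>k\<in>idx. of_rat (X i k) * of_rat (Y k j)) = (if i = j then 1 else 0 :: 'a)"
    "(\<Sum>k\<in>idx. of_rat (Y i k) * of_rat (X k j)) = (if i = j then 1 else 0 :: 'a)"
    if "i \<in> idx" "j \<in> idx" for i j
    using inv_matsD[OF assms that, THEN arg_cong, of "of_rat :: rat \<Rightarrow> 'a"]
    by (simp_all add: of_rat_sum of_rat_mult split: if_splits)
  then show ?thesis by (simp add: inv_mats_def)
qed

lemma cframe_change':
  assumes "cframe l m vac" "inv_mats X Y"
  shows "cframe (\<lambda>i. lc (X i) l) (\<lambda>i. lc (\<lambda>a. Y a i) m) vac"
  by (rule cframe_change[OF assms(1)]) (simp_all add: inv_matsD[OF assms(2)])

lemma sum_sc_bv_idx: "(\<Sum>a\<in>idx. sc (c a) (bv a)) = (\<lambda>K. if K \<in> idx then c K else (0::'a::field))"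
proof
  fix K
  have "(\<Sum>a\<in>idx. c a * bv a K) = (\<Sum>a\<in>idx. if a = K then c a else 0)"
    by (intro sum.cong refl) (auto simp: bv_def)
  also have "\<dots> = (if K \<in> idx then c K else 0)" by (rule sum.delta) simp
  finally show "(\<Sum>a\<in>idx. sc (c a) (bv a)) K = (if K \<in> idx then c K else 0)"
    by (simp add: sum_fun_apply sc_apply)
qed

lemma cframe_theta:
  assumes "inv_mats Pinv P"
  shows "cframe (\<lambda>a. (0, thtv Pinv a)) (\<lambda>a. (gamv P a, 0)) (unit_form :: 'a::field_char_0 form)"
proof -
  have "lc c (\<lambda>i. (0, bv i)) = (0 :: 'a vec, \<lambda>K. if K \<in> idx then c K else 0)"
    "lc c (\<lambda>i. (bv i, 0)) = (\<lambda>K. if K \<in> idx then c K else 0, 0 :: 'a vec)" for c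
    by (simp_all add: lc_def sum_sc_bv_idx)
  with cframe_change'[OF cframe_std inv_mats_of_int[OF assms], where 'a='a]
  show ?thesis by (simp add: thtv_def[abs_def] gamv_def[abs_def])
qed

lemma cframe_F0:
  assumes "inv_mats Pinv P"
  shows "cframe (fl0 P Pinv) (fm0 P Pinv) (vac0 Pinv :: 'a::field_char_0 form)"
  using cframe_flip[OF cframe_theta[OF assms], where 'a='a]
  by (simp add: fl0_def[abs_def] fm0_def[abs_def] vac0_def)

lemma cframe_F:
  assumes "inv_mats Pinv P" "inv_mats Hi H"
  shows "cframe (fl P Pinv Hi) (fm P Pinv H) (vac0 Pinv :: 'a::field_char_0 form)"
  using cframe_change'[OF cframe_F0[OF assms(1)] inv_mats_of_rat[OF assms(2)], where 'a='a]
  by (simp add: fl_def[abs_def] fm_def[abs_def])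

lemma fl0_comb:
  assumes "inv_mats Hi H" "a \<in> idx"
  shows "cl (fl0 P Pinv a) \<phi> = (\<Sum>i\<in>idx. sc (of_rat (H a i)) (cl (fl P Pinv Hi i) \<phi>))"
proof -
  have "(\<Sum>i\<in>idx. sc (of_rat (H a i)) (cl (fl P Pinv Hi i) \<phi>))
      = (\<Sum>i\<in>idx. \<Sum>b\<in>idx. sc (of_rat (H a i) * of_rat (Hi i b)) (cl (fl0 P Pinv b) \<phi>))"
    by (simp add: fl_def cl_lc sc.scale_sum_right)
  also have "\<dots> = (\<Sum>b\<in>idx. sc (\<Sum>i\<in>idx. of_rat (H a i) * of_rat (Hi i b)) (cl (fl0 P Pinv b) \<phi>))"
    unfolding sc.scale_sum_left by (rule sum.swap)
  also have "\<dots> = (\<Sum>b\<in>idx. sc (bv a b) (cl (fl0 P Pinv b) \<phi>))"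
    by (intro sum.cong refl) (simp add: inv_matsD(2)[OF inv_mats_of_rat[OF assms(1)]] assms(2) bv_def)
  finally show ?thesis by (simp add: sum_sc_bv assms)
qed

section \<open>Constant bilinear forms and the compatible metric\<close>

lemma bil_iota2: "bil M u v = (\<Sum>J\<in>idx. iota2 u M J * v J)"
  unfolding bil_def by (subst sum.swap) (simp add: iota2_def sum_distrib_right)

lemma bil_right: "bil M u v = (\<Sum>I\<in>idx. u I * (\<Sum>J\<in>idx. M I J * v J))"
  by (simp add: bil_def sum_distrib_left mult.assoc)

lemma bil_add_right: "bil M u (v + w) = bil M u v + bil M u w"
  by (simp add: bil_def algebra_simps sum.distrib)

lemma bil_add_left: "bil M (v + w) u = bil M v u + bil M w u"
  by (simp add: bil_def algebra_simps sum.distrib)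

lemma bil_sc_right: "bil M u (sc c v) = c * bil M u v"
  by (simp add: bil_def sc_apply sum_distrib_left mult.left_commute)

lemma bil_sc_left: "bil M (sc c v) u = c * bil M v u"
  by (simp add: bil_def sc_apply sum_distrib_left mult.assoc)

lemma bil_transpose:
  assumes "\<And>I J. I \<in> idx \<Longrightarrow> J \<in> idx \<Longrightarrow> M I J = e * M J I"
  shows "bil M u v = e * bil M v u"
proof -
  have "bil M u v = (\<Sum>J\<in>idx. \<Sum>I\<in>idx. u I * M I J * v J)"
    unfolding bil_def by (rule sum.swap)
  also have "\<dots> = (\<Sum>J\<in>idx. \<Sum>I\<in>idx. e * (v J * M J I * u I))"
    by (intro sum.cong refl) (subst assms, simp_all add: algebra_simps)
  finally show ?thesis by (simp add: bil_def sum_distrib_left)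
qed

lemma bil_bv: "i \<in> idx \<Longrightarrow> bil M u (bv i) = (\<Sum>I\<in>idx. u I * M I i)"
  "i \<in> idx \<Longrightarrow> j \<in> idx \<Longrightarrow> bil M (bv i) (bv j) = M i j"
proof -
  show "bil M u (bv i) = (\<Sum>I\<in>idx. u I * M I i)" if "i \<in> idx" for u i
    using that by (simp add: bil_right)
  then show "i \<in> idx \<Longrightarrow> j \<in> idx \<Longrightarrow> bil M (bv i) (bv j) = M i j" by simp
qed

lemma valid_vec_add: "valid_vec u \<Longrightarrow> valid_vec v \<Longrightarrow> valid_vec (u + v :: 'a::field vec)"
  and valid_vec_sc: "valid_vec u \<Longrightarrow> valid_vec (sc c u :: 'a::field vec)"
  and valid_vec_bv: "i \<in> idx \<Longrightarrow> valid_vec (bv i :: 'a::field vec)"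
  and valid_vec_mvec: "valid_vec (mvec M w)"
  and valid_vec_gamv: "valid_vec (gamv P a :: 'a::field vec)"
  by (auto simp: valid_vec_def sc_apply bv_def mvec_def gamv_def)

lemma bil_omega: "bil (omega G Icx) u v = bil G (mvec Icx u) v"
proof -
  have "bil G (mvec Icx u) v = (\<Sum>K\<in>idx. \<Sum>J\<in>idx. \<Sum>I\<in>idx. u I * (Icx K I * G K J) * v J)"
    unfolding bil_def by (intro sum.cong refl) (simp add: mvec_def sum_distrib_left sum_distrib_right algebra_simps)
  also have "\<dots> = (\<Sum>J\<in>idx. \<Sum>I\<in>idx. \<Sum>K\<in>idx. u I * (Icx K I * G K J) * v J)" by (rule sum_swap3)
  also have "\<dots> = (\<Sum>I\<in>idx. \<Sum>J\<in>idx. \<Sum>K\<in>idx. u I * (Icx K I * G K J) * v J)" by (rule sum.swap)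
  finally show ?thesis by (simp add: bil_def omega_def sum_distrib_left sum_distrib_right)
qed

lemma qf_bil: "qf x y = (\<Sum>i\<in>idx. snd x i * fst y i) + (\<Sum>i\<in>idx. snd y i * fst x i)"
  by (simp add: qf_def sum.distrib)

locale metric =
  fixes G Icx :: "real mat"
  assumes G_sym: "\<forall>I\<in>idx. \<forall>J\<in>idx. G I J = G J I"
    and G_pos: "\<forall>u. valid_vec u \<and> u \<noteq> (\<lambda>_. 0) \<longrightarrow> bil G u u > 0"
    and I_cx: "\<forall>u. valid_vec u \<longrightarrow> mvec Icx (mvec Icx u) = (\<lambda>K. - u K)"
    and compat: "\<forall>u v. valid_vec u \<and> valid_vec v \<longrightarrow> bil G (mvec Icx u) (mvec Icx v) = bil G u v"
begin

abbreviation "om \<equiv> omega G Icx"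

lemma bil_G_sym: "bil G u v = bil G v u"
  using bil_transpose[of G 1 u v] G_sym by simp

lemma I_I: "valid_vec u \<Longrightarrow> mvec Icx (mvec Icx u) = sc (-1) u"
  using I_cx by (simp add: fun_eq_iff sc_apply)

lemma G_skew: assumes "valid_vec u" "valid_vec v" shows "bil G (mvec Icx u) v = - bil G u (mvec Icx v)"
proof -
  have "bil G (mvec Icx u) (mvec Icx (mvec Icx v)) = bil G u (mvec Icx v)"
    using compat assms valid_vec_mvec by blast
  then show ?thesis unfolding I_I[OF assms(2)] bil_sc_right by simp
qed

lemma om_anti: assumes "valid_vec u" "valid_vec v" shows "bil om u v = - bil om v u"
  using G_skew[OF assms] bil_G_sym by (simp add: bil_omega)

lemma G_definite: "valid_vec u \<Longrightarrow> bil G u u = 0 \<Longrightarrow> u = 0"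
  using G_pos by (force simp: zero_fun_def)

lemma om_inj:
  assumes "valid_vec v" "\<And>K. K \<in> idx \<Longrightarrow> iota2 v om K = 0" shows "v = 0"
proof -
  have "bil om v (mvec Icx v) = 0" by (simp add: bil_iota2 assms(2))
  then have "bil G v v = 0" using compat assms(1) by (simp add: bil_omega)
  then show ?thesis using G_definite assms(1) by blast
qed

lemma om_inj_eq:
  assumes "valid_vec v" "valid_vec w" "\<And>K. K \<in> idx \<Longrightarrow> iota2 v om K = iota2 w om K" shows "v = w"
proof -
  have "v - w = 0"
  proof (rule om_inj)
    show "valid_vec (v - w)" using assms by (simp add: valid_vec_def)
    show "iota2 (v - w) om K = 0" if "K \<in> idx" for K
      using assms(3)[OF that] that by (simp add: iota2_def left_diff_distrib sum_subtractf)
  qed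
  then show ?thesis by simp
qed

text \<open>Pairing v with I v under \<omega> gives G(v, v), so \<omega> is nondegenerate. Hence the
  description in \<open>omt_inv\<close> has exactly one solution and may be used through its
  defining equation.\<close>

lemma omt_inv_props:
  shows "valid_vec (omt_inv om \<xi>)" and "K \<in> idx \<Longrightarrow> iota2 (omt_inv om \<xi>) om K = \<xi> K"
proof -
  have "c a = 0" if c: "\<And>K. K \<in> idx \<Longrightarrow> (\<Sum>a\<in>idx. c a * om a K) = 0" and a: "a \<in> idx" for c a
  proof -
    let ?v = "\<lambda>a. if a \<in> idx then c a else 0"
    have "?v = 0"
      by (rule om_inj) (use c in \<open>auto simp: valid_vec_def iota2_def\<close>)
    from fun_cong[OF this, of a] a show ?thesis by simp
  qed
  then have "\<exists>N. inv_mats N om" by (intro inv_mats_exists) blast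
  then obtain N where "inv_mats N om" ..
  note N = inv_matsD(1)[OF this]
  let ?v = "\<lambda>J. if J \<in> idx then (\<Sum>K\<in>idx. \<xi> K * N K J) else 0"
  have v: "iota2 ?v om = (\<lambda>J. if J \<in> idx then \<xi> J else 0)"
  proof
    fix J
    show "iota2 ?v om J = (if J \<in> idx then \<xi> J else 0)"
    proof (cases "J \<in> idx")
      case True
      have "iota2 ?v om J = (\<Sum>I\<in>idx. \<Sum>K\<in>idx. \<xi> K * (N K I * om I J))"
        using True by (simp add: iota2_def sum_distrib_right mult.assoc)
      also have "\<dots> = (\<Sum>K\<in>idx. \<xi> K * (\<Sum>I\<in>idx. N K I * om I J))"
        unfolding sum_distrib_left by (rule sum.swap)
      also have "\<dots> = (\<Sum>K\<in>idx. \<xi> K * (if K = J then 1 else 0))"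
        by (intro sum.cong refl) (simp add: N True)
      finally show ?thesis using True by (simp add: sum_delta_idx)
    qed (simp add: iota2_def)
  qed
  have "\<exists>!v. valid_vec v \<and> iota2 v om = (\<lambda>J. if J \<in> idx then \<xi> J else 0)"
  proof (rule ex1I[of _ ?v])
    show "valid_vec ?v \<and> iota2 ?v om = (\<lambda>J. if J \<in> idx then \<xi> J else 0)"
      using v by (simp add: valid_vec_def)
  next
    fix w assume w: "valid_vec w \<and> iota2 w om = (\<lambda>J. if J \<in> idx then \<xi> J else 0)"
    show "w = ?v"
      by (rule om_inj_eq) (use w v in \<open>auto simp: valid_vec_def\<close>)
  qed
  from theI'[OF this] show "valid_vec (omt_inv om \<xi>)" and "K \<in> idx \<Longrightarrow> iota2 (omt_inv om \<xi>) om K = \<xi> K"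
    unfolding omt_inv_def by auto
qed

text \<open>G I is antisymmetric and the inverse of G is symmetric, so the trace of I, being the
  trace of their product, equals its own negative. This is the trace condition on the block of
  \<open>J\<^sub>B\<close> along \<open>F\<close>.\<close>

lemma trace_I: "(\<Sum>K\<in>idx. Icx K K) = 0"
proof -
  have "c a = 0" if c: "\<And>K. K \<in> idx \<Longrightarrow> (\<Sum>a\<in>idx. c a * G a K) = 0" and a: "a \<in> idx" for c a
  proof -
    let ?v = "\<lambda>a. if a \<in> idx then c a else 0"
    have "bil G ?v ?v = 0"
      unfolding bil_iota2 using c by (simp add: iota2_def)
    then have "?v = 0" by (intro G_definite) (auto simp: valid_vec_def)
    from fun_cong[OF this, of a] a show ?thesis by simp
  qed
  then have "\<exists>N. inv_mats N G" by (intro inv_mats_exists) blast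
  then obtain N where "inv_mats N G" ..
  note N = inv_matsD(1)[OF this] and N' = inv_matsD(2)[OF this]
  have Nsym: "N i k = N k i" if ik: "i \<in> idx" "k \<in> idx" for i k
  proof -
    have "N i k = (\<Sum>m\<in>idx. N m k * (\<Sum>j\<in>idx. G m j * N j i))"
      using ik by (subst sum.cong[OF refl, of _ _ "\<lambda>m. N m k * (if m = i then 1 else 0)"]) (simp_all add: N' sum_delta_idx)
    also have "\<dots> = (\<Sum>j\<in>idx. (\<Sum>m\<in>idx. G j m * N m k) * N j i)"
      unfolding sum_distrib_left sum_distrib_right
      by (subst sum.swap, intro sum.cong refl) (use G_sym in \<open>simp add: algebra_simps\<close>)
    also have "\<dots> = N k i"
      using ik by (subst sum.cong[OF refl, of _ _ "\<lambda>j. N j i * (if j = k then 1 else 0)"]) (simp_all add: N' sum_delta_idx)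
    finally show ?thesis .
  qed
  define W where "W i j = (\<Sum>k\<in>idx. G i k * Icx k j)" for i j
  have Wb: "W i j = bil G (bv i) (mvec Icx (bv j))" if "i \<in> idx" "j \<in> idx" for i j
    using that by (simp add: W_def bil_right mvec_def)
  have Wanti: "W i j = - W j i" if "i \<in> idx" "j \<in> idx" for i j
    using G_skew[of "bv j" "bv i"] bil_G_sym that by (simp add: Wb valid_vec_bv)
  have "(\<Sum>K\<in>idx. Icx K K) = (\<Sum>K\<in>idx. \<Sum>i\<in>idx. N K i * W i K)"
  proof (intro sum.cong refl)
    fix K assume K: "K \<in> idx"
    have "(\<Sum>i\<in>idx. N K i * W i K) = (\<Sum>k\<in>idx. (\<Sum>i\<in>idx. N K i * G i k) * Icx k K)"
      unfolding W_def sum_distrib_left sum_distrib_right by (subst sum.swap) (simp add: mult.assoc)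
    also have "\<dots> = (\<Sum>k\<in>idx. Icx k K * (if k = K then 1 else 0))"
      by (intro sum.cong refl) (simp add: N K)
    finally show "Icx K K = (\<Sum>i\<in>idx. N K i * W i K)" using K by (simp add: sum_delta_idx)
  qed
  moreover have "(\<Sum>K\<in>idx. \<Sum>i\<in>idx. N K i * W i K) = - (\<Sum>K\<in>idx. \<Sum>i\<in>idx. N K i * W i K)"
    unfolding sum_negf[symmetric]
  proof (subst sum.swap, intro sum.cong refl)
    fix a b assume ab: "a \<in> idx" "b \<in> idx"
    show "N b a * W a b = - (N a b * W b a)" using Wanti[OF ab] Nsym[OF ab] by simp
  qed
  ultimately show ?thesis by simp
qed

end

locale torus = metric G Icx for G Icx :: "real mat" +
  fixes Bm :: "real mat" and P Pinv :: "int mat"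
  assumes G_rat: "\<forall>I\<in>idx. \<forall>J\<in>idx. G I J \<in> \<rat>"
    and B_anti: "\<forall>I\<in>idx. \<forall>J\<in>idx. Bm I J = - Bm J I"
    and B_rat: "\<forall>I\<in>idx. \<forall>J\<in>idx. Bm I J \<in> \<rat>"
    and basis1: "\<forall>I\<in>idx. \<forall>J\<in>idx. (\<Sum>K\<in>idx. Pinv I K * P K J) = (if I = J then 1 else 0)"
    and basis2: "\<forall>I\<in>idx. \<forall>J\<in>idx. (\<Sum>K\<in>idx. P I K * Pinv K J) = (if I = J then 1 else 0)"
    and fib_omega: "\<forall>a b c d :: real.
          bil (omega G Icx)
              (\<lambda>K. if K \<in> idx then a * of_int (P K 1) + b * of_int (P K 2) else 0)
              (\<lambda>K. if K \<in> idx then c * of_int (P K 1) + d * of_int (P K 2) else 0) = 0"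
    and fib_B: "\<forall>a b c d :: real.
          bil Bm
              (\<lambda>K. if K \<in> idx then a * of_int (P K 1) + b * of_int (P K 2) else 0)
              (\<lambda>K. if K \<in> idx then c * of_int (P K 1) + d * of_int (P K 2) else 0) = 0"
begin

lemma P_inv: "inv_mats Pinv P"
  using basis1 basis2 by (auto simp: inv_mats_def)

abbreviation "JJ \<equiv> JB om Bm"

definition fib :: "real \<Rightarrow> real \<Rightarrow> real vec" where
  "fib s t = sc s (gamv P 1) + sc t (gamv P 2)"

lemma fib_eq: "fib a b = (\<lambda>K. if K \<in> idx then a * of_int (P K 1) + b * of_int (P K 2) else 0)"
  by (auto simp: fun_eq_iff fib_def sc_apply gamv_def)

lemma bil_om_fib: "bil om (fib a b) (fib c d) = 0" and bil_B_fib: "bil Bm (fib a b) (fib c d) = 0"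
  using fib_omega fib_B unfolding fib_eq by blast+

lemma valid_fib: "valid_vec (fib s t)"
  unfolding fib_def by (intro valid_vec_add valid_vec_sc valid_vec_gamv)

lemma bil_B_anti: "bil Bm u v = - bil Bm v u"
proof -
  have "bil Bm u v = (- 1) * bil Bm v u"
  proof (rule bil_transpose)
    fix I J assume "I \<in> idx" "J \<in> idx"
    then have "Bm I J = - Bm J I" using B_anti by blast
    then show "Bm I J = (- 1) * Bm J I" by linarith
  qed
  then show ?thesis by simp
qed

lemma JJ_fst: "valid_vec (fst (JJ x))"
  and JJ_fst_eq: "K \<in> idx \<Longrightarrow> iota2 (fst (JJ x)) om K = - (snd x K + iota2 (fst x) Bm K)"
  and JJ_snd: "snd (JJ x) K = iota2 (fst x) om K - iota2 (fst (JJ x)) Bm K"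
proof -
  let ?\<xi> = "\<lambda>J. snd x J + iota2 (fst x) Bm J"
  have f: "fst (JJ x) = (\<lambda>i. - omt_inv om ?\<xi> i)"
    by (cases x) (simp add: JB_def eB_def J0_def eBinv_def)
  show "valid_vec (fst (JJ x))" unfolding f using omt_inv_props(1)[of ?\<xi>] by (simp add: valid_vec_def)
  show "iota2 (fst (JJ x)) om K = - (snd x K + iota2 (fst x) Bm K)" if "K \<in> idx"
    unfolding f using omt_inv_props(2)[of K ?\<xi>] that by (simp add: iota2_def sum_negf)
  show "snd (JJ x) K = iota2 (fst x) om K - iota2 (fst (JJ x)) Bm K"
    by (cases x) (simp add: JB_def eB_def J0_def eBinv_def)
qed

text \<open>Both terms on the right are values of \<omega> on vector parts. Skewness of
  \<open>J\<^sub>B\<close> follows from antisymmetry of \<omega>, and invariance of \<open>F\<close>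
  from \<omega> being zero on the fibre.\<close>

lemma qf_JJ:
  "qf (JJ x) y = bil om (fst x) (fst y) + bil om (fst (JJ x)) (fst (JJ y))"
proof -
  have 1: "(\<Sum>i\<in>idx. snd (JJ x) i * fst y i) = bil om (fst x) (fst y) - bil Bm (fst (JJ x)) (fst y)"
    by (simp add: JJ_snd left_diff_distrib sum_subtractf bil_iota2)
  have "(\<Sum>i\<in>idx. snd y i * fst (JJ x) i) = (\<Sum>i\<in>idx. (- iota2 (fst (JJ y)) om i - iota2 (fst y) Bm i) * fst (JJ x) i)"
    by (intro sum.cong refl) (simp add: JJ_fst_eq)
  also have "\<dots> = - bil om (fst (JJ y)) (fst (JJ x)) - bil Bm (fst y) (fst (JJ x))"
    by (simp add: left_diff_distrib sum_subtractf sum_negf bil_iota2)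
  finally show ?thesis
    using om_anti[OF JJ_fst JJ_fst, of y x] bil_B_anti[of "fst y"] 1 by (simp add: qf_bil)
qed

lemma bil_om_anti_all: "bil om u v = - bil om v u"
proof -
  have "om I J = (- 1) * om J I" if "I \<in> idx" "J \<in> idx" for I J
    using om_anti[of "bv I" "bv J"] that by (simp add: valid_vec_bv bil_bv)
  then have "bil om u v = (- 1) * bil om v u" by (rule bil_transpose)
  then show ?thesis by simp
qed

lemma JJ_skew: "qf (JJ x) y = - qf x (JJ y)"
  using qf_JJ[of x y] qf_JJ[of y x] bil_om_anti_all[of "fst x" "fst y"]
    bil_om_anti_all[of "fst (JJ x)" "fst (JJ y)"] qf_sym[of x "JJ y"] by linarith

lemma vec_eq_pair:
  assumes "\<And>a. a \<in> idx \<Longrightarrow> (\<Sum>K\<in>idx. x K * gamv P a K) = (\<Sum>K\<in>idx. y K * gamv P a K)" "K \<in> idx"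
  shows "x K = (y K :: real)"
proof -
  have e: "z K = (\<Sum>a\<in>idx. (\<Sum>L\<in>idx. z L * gamv P a L) * of_int (Pinv a K))" for z :: "real vec"
  proof -
    have "(\<Sum>a\<in>idx. (\<Sum>L\<in>idx. z L * gamv P a L) * of_int (Pinv a K)) = (\<Sum>a\<in>idx. \<Sum>L\<in>idx. z L * (of_int (P L a) * of_int (Pinv a K)))"
      by (simp add: sum_distrib_right mult.assoc gamv_def)
    also have "\<dots> = (\<Sum>L\<in>idx. z L * (\<Sum>a\<in>idx. of_int (P L a) * of_int (Pinv a K)))"
      unfolding sum_distrib_left by (rule sum.swap)
    also have "\<dots> = (\<Sum>L\<in>idx. z L * (if L = K then 1 else 0))"
      by (intro sum.cong refl) (simp add: inv_matsD(2)[OF inv_mats_of_int[OF P_inv, where 'a=real]] assms(2))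
    finally show ?thesis using assms(2) by (simp add: sum_delta_idx)
  qed
  show ?thesis using e[of x] e[of y] assms(1) by simp
qed

section \<open>The isotropic subspace \<open>F\<close> and its invariance under
  \<open>J\<^sub>B\<close>\<close>

definition inF :: "lam \<Rightarrow> bool" where
  "inF x \<longleftrightarrow> (\<exists>s t. fst x = fib s t) \<and> (\<Sum>K\<in>idx. snd x K * gamv P 1 K) = 0 \<and> (\<Sum>K\<in>idx. snd x K * gamv P 2 K) = 0"

lemma gamv_fib: "gamv P 1 = fib 1 0" "gamv P 2 = fib 0 1"
  by (simp_all add: fib_def)

text \<open>This is the determinant of the block of \<omega> between the fibre and the complement.
  If it vanished, a nonzero fibre vector would be \<omega>-orthogonal to the complement, and to the
  fibre by assumption, hence to everything.\<close>

lemma fib_nondeg: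
  defines "w \<equiv> \<lambda>i j. bil om (gamv P i) (gamv P j)"
  shows "w 1 3 * w 2 4 - w 1 4 * w 2 3 \<noteq> 0"
proof
  assume D: "w 1 3 * w 2 4 - w 1 4 * w 2 3 = 0"
  have z: "s = 0 \<and> t = 0" if st: "s * w 1 3 + t * w 2 3 = 0" "s * w 1 4 + t * w 2 4 = 0" for s t
  proof -
    have pair: "bil om (fib s t) (gamv P a) = 0" if "a \<in> idx" for a
    proof -
      consider "a = 1" | "a = 2" | "a = 3" | "a = 4" using \<open>a \<in> idx\<close> by (auto simp: idx_set)
      then show ?thesis
      proof cases
        case 1 then show ?thesis using bil_om_fib[of s t 1 0] by (simp only: gamv_fib)
      next
        case 2 then show ?thesis using bil_om_fib[of s t 0 1] by (simp only: gamv_fib)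
      qed (use st in \<open>simp_all add: fib_def bil_add_left bil_sc_left w_def\<close>)
    qed
    have "fib s t = 0" (is ?fib)
    proof (rule om_inj[OF valid_fib])
      fix K assume "K \<in> idx"
      show "iota2 (fib s t) om K = 0"
        using vec_eq_pair[of "iota2 (fib s t) om" "\<lambda>_. 0" K] pair \<open>K \<in> idx\<close> by (simp add: bil_iota2)
    qed
    have f: "s * gamv P 1 K + t * gamv P 2 K = 0" for K
      using fun_cong[OF \<open>?fib\<close>, of K] unfolding fib_def by (simp only: plus_fun_apply sc_apply zero_fun_apply)
    have d: "(\<Sum>K\<in>idx. of_int (Pinv a K) * gamv P b K) = (if a = b then 1 else 0 :: real)" if "a \<in> idx" "b \<in> idx" for a b
      using inv_matsD(1)[OF inv_mats_of_int[OF P_inv] that] by (simp add: gamv_def)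
    have "s * (\<Sum>K\<in>idx. of_int (Pinv a K) * gamv P 1 K) + t * (\<Sum>K\<in>idx. of_int (Pinv a K) * gamv P 2 K) = 0" for a
    proof -
      have "s * (\<Sum>K\<in>idx. of_int (Pinv a K) * gamv P 1 K) + t * (\<Sum>K\<in>idx. of_int (Pinv a K) * gamv P 2 K)
         = (\<Sum>K\<in>idx. of_int (Pinv a K) * (s * gamv P 1 K + t * gamv P 2 K))"
        by (simp add: sum_distrib_left distrib_left sum.distrib mult.left_commute)
      then show ?thesis unfolding f by simp
    qed
    note e = this
    have i: "1 \<in> idx" "2 \<in> idx" by (simp_all add: idx_def)
    have "s = 0" using e[of 1] unfolding d[OF i(1) i(1)] d[OF i(1) i(2)] by simp
    moreover have "t = 0" using e[of 2] unfolding d[OF i(2) i(1)] d[OF i(2) i(2)] by simp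
    ultimately show ?thesis by simp
  qed
  \<comment> \<open>A singular 2 by 2 block is annihilated by the vectors built from its own
    entries. Since only 0 is annihilated, all entries vanish, and then (1, 0) is annihilated as
    well.\<close>
  have "w 2 3 = 0 \<and> w 1 3 = 0" using z[of "w 2 3" "- w 1 3"] D by (simp add: algebra_simps)
  moreover have "w 2 4 = 0 \<and> w 1 4 = 0" using z[of "w 2 4" "- w 1 4"] D by (simp add: algebra_simps)
  ultimately show False using z[of 1 0] by simp
qed

text \<open>The fibre is Lagrangian, so it is its own \<omega>-complement. The coefficients s and t
  come from Cramer's rule for the pairings of v with \<open>gamv P 3\<close> and
  \<open>gamv P 4\<close>.\<close>

lemma om_lagrangian:
  assumes v: "valid_vec v" and "bil om v (gamv P 1) = 0" "bil om v (gamv P 2) = 0"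
  obtains s t where "v = fib s t"
proof -
  define w where "w i j = bil om (gamv P i) (gamv P j)" for i j
  define D where "D = w 1 3 * w 2 4 - w 1 4 * w 2 3"
  have D: "D \<noteq> 0" using fib_nondeg by (simp add: D_def w_def)
  define x3 x4 where "x3 = bil om v (gamv P 3)" and "x4 = bil om v (gamv P 4)"
  define s where "s = (x3 * w 2 4 - x4 * w 2 3) / D"
  define t where "t = (w 1 3 * x4 - w 1 4 * x3) / D"
  have "(s * w 1 3 + t * w 2 3) * D = x3 * D" "(s * w 1 4 + t * w 2 4) * D = x4 * D"
    using D by (simp_all add: s_def t_def distrib_right) (simp_all add: D_def algebra_simps)
  then have st: "s * w 1 3 + t * w 2 3 = x3" "s * w 1 4 + t * w 2 4 = x4" using D by simp_all
  have pair: "bil om v (gamv P a) = bil om (fib s t) (gamv P a)" if "a \<in> idx" for a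
  proof -
    consider "a = 1" | "a = 2" | "a = 3" | "a = 4" using \<open>a \<in> idx\<close> by (auto simp: idx_set)
    then show ?thesis
    proof cases
      case 1 then show ?thesis using assms bil_om_fib[of s t 1 0] by (simp only: gamv_fib)
    next
      case 2 then show ?thesis using assms bil_om_fib[of s t 0 1] by (simp only: gamv_fib)
    qed (use st in \<open>simp_all add: fib_def bil_add_left bil_sc_left w_def x3_def x4_def\<close>)
  qed
  have "v = fib s t"
    by (rule om_inj_eq[OF v valid_fib]) (use vec_eq_pair pair in \<open>auto simp: bil_iota2\<close>)
  then show ?thesis by (rule that)
qed

text \<open>For a fibre vector \<gamma> the value \<omega>(u, \<gamma>) is -\<xi>(\<gamma>) - B(v,
  \<gamma>), where u is the vector part of the image. The first term vanishes since \<xi>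
  annihilates the fibre, the second since v lies in it.\<close>

lemma inF_JJ: assumes "inF x" obtains s t where "fst (JJ x) = fib s t"
proof -
  obtain a b where ab: "fst x = fib a b" using assms by (auto simp: inF_def)
  have "bil om (fst (JJ x)) (gamv P c) = 0" if c: "c \<in> {1, 2}" for c
  proof -
    have "bil om (fst (JJ x)) (gamv P c) = (\<Sum>K\<in>idx. - (snd x K + iota2 (fst x) Bm K) * gamv P c K)"
      unfolding bil_iota2 by (intro sum.cong refl) (simp add: JJ_fst_eq)
    also have "\<dots> = - (\<Sum>K\<in>idx. snd x K * gamv P c K) - bil Bm (fst x) (gamv P c)"
      by (simp add: bil_iota2 sum_subtractf[symmetric] sum_negf[symmetric] algebra_simps)
    also have "bil Bm (fst x) (gamv P c) = 0"
      using c ab bil_B_fib[of a b 1 0] bil_B_fib[of a b 0 1] by (auto simp: gamv_fib simp del: One_nat_def)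
    finally show ?thesis using assms c by (auto simp: inF_def)
  qed
  then show ?thesis using om_lagrangian[OF JJ_fst] that by (metis insertCI)
qed

text \<open>\<open>F\<close> is maximal isotropic, so orthogonality of the image of \<open>F\<close>
  to \<open>F\<close> is the invariance of \<open>F\<close>.\<close>

lemma JJ_inF: "inF x \<Longrightarrow> inF y \<Longrightarrow> qf (JJ x) y = 0"
  by (rule inF_JJ[of x], assumption, rule inF_JJ[of y], assumption) (auto simp: qf_JJ inF_def bil_om_fib)

text \<open>Pairing with \<open>nn s K\<close> is the \<open>K\<close>-th component of the map \<open>g\<^sub>s\<close>.\<close>

definition nn :: "real \<Rightarrow> nat \<Rightarrow> lam" where
  "nn s K = (bv K, \<lambda>L. Bm L K + s * G L K)"

lemma qf_nn: "K \<in> idx \<Longrightarrow> qf x (nn s K) = snd x K + iota2 (fst x) Bm K + s * (\<Sum>L\<in>idx. fst x L * G L K)"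
  by (simp add: qf_bil nn_def iota2_def distrib_right sum.distrib sum_distrib_left algebra_simps)

text \<open>By the implicit description of \<open>J\<^sub>B\<close>, \<open>g\<^sub>s\<close> x is
  the G-dual of s v minus the \<omega>-contraction of u, where u is the vector part of the image.
  Composition with I turns the contraction of \<omega> with u into the G-dual of u, and the G-dual
  of v into minus the contraction of \<omega> with v. Because s s = 1, the factor -s then gives
  \<open>g\<^sub>s\<close> of the image.\<close>

lemma JJ_nn:
  assumes "s * s = 1" "K \<in> idx" "valid_vec (fst x)"
  shows "qf (JJ x) (nn s K) = - s * (\<Sum>L\<in>idx. qf x (nn s L) * Icx L K)"
proof -
  have mv: "mvec Icx (bv K) L = Icx L K" if "L \<in> idx" for L
    using that assms(2) by (simp add: mvec_def)
  have bvr: "bil M u (mvec Icx (bv K)) = (\<Sum>L\<in>idx. iota2 u M L * Icx L K)" for M u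
    unfolding bil_iota2 by (intro sum.cong refl) (simp add: mv)
  have a: "(\<Sum>L\<in>idx. iota2 (fst (JJ x)) om L * Icx L K) = (\<Sum>L\<in>idx. fst (JJ x) L * G L K)"
    using compat JJ_fst[of x] assms(2) bil_bv(1)[OF assms(2), of G]
    by (simp add: bvr[symmetric] bil_omega valid_vec_bv)
  have b: "(\<Sum>L\<in>idx. (\<Sum>M\<in>idx. fst x M * G M L) * Icx L K) = - iota2 (fst x) om K"
  proof -
    have "(\<Sum>L\<in>idx. (\<Sum>M\<in>idx. fst x M * G M L) * Icx L K) = bil G (fst x) (mvec Icx (bv K))"
      unfolding bvr by (intro sum.cong refl) (simp add: iota2_def)
    also have "\<dots> = - bil om (fst x) (bv K)"
      using G_skew[OF assms(3) valid_vec_bv[OF assms(2)]] by (simp add: bil_omega)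
    also have "bil om (fst x) (bv K) = iota2 (fst x) om K"
      using assms(2) by (simp add: bil_iota2)
    finally show ?thesis .
  qed
  have c: "qf x (nn s L) = - iota2 (fst (JJ x)) om L + s * (\<Sum>M\<in>idx. fst x M * G M L)" if "L \<in> idx" for L
    using that by (simp add: qf_nn JJ_fst_eq)
  have "- s * (\<Sum>L\<in>idx. qf x (nn s L) * Icx L K)
     = s * (\<Sum>L\<in>idx. iota2 (fst (JJ x)) om L * Icx L K) - (s * s) * (\<Sum>L\<in>idx. (\<Sum>M\<in>idx. fst x M * G M L) * Icx L K)"
    unfolding sum_distrib_left[of s] sum_distrib_left[of "s * s"] sum_distrib_left[of "- s"] sum_subtractf[symmetric]
    by (intro sum.cong refl) (simp add: c algebra_simps)
  also have "\<dots> = s * (\<Sum>L\<in>idx. fst (JJ x) L * G L K) + iota2 (fst x) om K"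
    unfolding a b using assms(1) by simp
  also have "\<dots> = qf (JJ x) (nn s K)"
    using assms(2) by (simp add: qf_nn JJ_snd)
  finally show ?thesis by simp
qed

end

section \<open>Rational and graded spans\<close>

declare plus_fun_apply [simp del] zero_fun_apply [simp del] minus_apply [simp del] uminus_apply [simp del]

lemmas fun_apply = plus_fun_apply zero_fun_apply minus_apply uminus_apply sc_apply

lemma lincomb_Nil: "lincomb [] [] = 0"
  by (simp add: fun_eq_iff lincomb_def fun_apply)

lemma lincomb_Cons: "length cs = length vs \<Longrightarrow> lincomb (c # cs) (v # vs) = sc c v + lincomb cs vs"
  by (simp add: fun_eq_iff lincomb_def fun_apply sum.lessThan_Suc_shift del: sum.lessThan_Suc)

text \<open>Used for the rational, real and complex numbers: lattices, invariance of the real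
  filtration, and Hodge decompositions. A common closure condition lets each span statement be
  proved once.\<close>

definition qclosed :: "complex set \<Rightarrow> bool" where
  "qclosed K \<longleftrightarrow> \<rat> \<subseteq> K \<and> (\<forall>x\<in>K. \<forall>y\<in>K. x + y \<in> K \<and> x * y \<in> K)"

lemma qclosed_Rats: "qclosed \<rat>" and qclosed_Reals: "qclosed \<real>" and qclosed_UNIV: "qclosed UNIV"
proof -
  have "complex_of_rat q \<in> \<real>" for q
    by (cases q) (simp add: of_rat_rat)
  then have "\<rat> \<subseteq> (\<real> :: complex set)" by (auto elim: Rats_cases)
  then show "qclosed \<rat>" "qclosed \<real>" "qclosed UNIV" by (auto simp: qclosed_def)
qed

lemma span_in_0: "0 \<in> span_in K X"
  unfolding span_in_def using lincomb_Nil by (auto intro!: exI[of _ "[]"])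

lemma span_in_Cons:
  assumes "v \<in> X" "c \<in> K" "\<phi> \<in> span_in K X" shows "sc c v + \<phi> \<in> span_in K X"
proof -
  obtain vs cs where "set vs \<subseteq> X" "length cs = length vs" "set cs \<subseteq> K" "\<phi> = lincomb cs vs"
    using assms(3) by (auto simp: span_in_def)
  then show ?thesis using assms(1,2) unfolding span_in_def
    by (intro CollectI exI[of _ "v # vs"] exI[of _ "c # cs"]) (simp add: lincomb_Cons)
qed

lemma span_in_induct [consumes 1, case_names zero step]:
  assumes "\<phi> \<in> span_in K X" "Q 0"
    and step: "\<And>c v \<psi>. c \<in> K \<Longrightarrow> v \<in> X \<Longrightarrow> \<psi> \<in> span_in K X \<Longrightarrow> Q \<psi> \<Longrightarrow> Q (sc c v + \<psi>)"
  shows "Q \<phi>"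
proof -
  obtain vs cs where vc: "set vs \<subseteq> X" "length cs = length vs" "set cs \<subseteq> K" "\<phi> = lincomb cs vs"
    using assms(1) by (auto simp: span_in_def)
  have "set vs \<subseteq> X \<Longrightarrow> set cs \<subseteq> K \<Longrightarrow> Q (lincomb cs vs) \<and> lincomb cs vs \<in> span_in K X"
    using vc(2)
  proof (induction cs vs rule: list_induct2)
    case Nil then show ?case using assms(2) span_in_0 by (simp add: lincomb_Nil)
  next
    case (Cons c cs v vs)
    then show ?case using step[of c v "lincomb cs vs"] span_in_Cons[of v X c K "lincomb cs vs"] by (simp add: lincomb_Cons)
  qed
  then show ?thesis using vc by simp
qed

lemma span_in_base: assumes "qclosed K" "v \<in> X" shows "v \<in> span_in K X"
  using span_in_Cons[OF assms(2) _ span_in_0, of 1 K] assms(1) by (auto simp: qclosed_def)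

lemma span_in_add: assumes "\<phi> \<in> span_in K X" "\<psi> \<in> span_in K X" shows "\<phi> + \<psi> \<in> span_in K X"
  using assms(1)
proof (induction rule: span_in_induct)
  case zero then show ?case using assms(2) by simp
next
  case (step c v \<chi>)
  then show ?case using span_in_Cons[of v X c K "\<chi> + \<psi>"] by (simp add: add.assoc)
qed

lemma span_in_sc: assumes "qclosed K" "\<phi> \<in> span_in K X" "c \<in> K" shows "sc c \<phi> \<in> span_in K X"
  using assms(2)
proof (induction rule: span_in_induct)
  case zero then show ?case using span_in_0 by simp
next
  case (step d v \<chi>)
  then have "c * d \<in> K" using assms(1,3) by (auto simp: qclosed_def)
  then show ?case using span_in_Cons[of v X "c * d" K "sc c \<chi>"] step by (simp add: sc.scale_right_distrib)
qed

lemma span_in_sum: "(\<And>i. i \<in> A \<Longrightarrow> f i \<in> span_in K X) \<Longrightarrow> (\<Sum>i\<in>A. f i) \<in> span_in K X"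
  by (induction A rule: infinite_finite_induct) (auto simp: span_in_0 span_in_add)

lemma span_in_minimal:
  assumes "0 \<in> Y" "\<And>\<phi> \<psi>. \<phi> \<in> Y \<Longrightarrow> \<psi> \<in> Y \<Longrightarrow> \<phi> + \<psi> \<in> Y" "\<And>c v. c \<in> K \<Longrightarrow> v \<in> X \<Longrightarrow> sc c v \<in> Y"
  shows "span_in K X \<subseteq> Y"
proof
  fix \<phi> assume "\<phi> \<in> span_in K X"
  then show "\<phi> \<in> Y" by (induction rule: span_in_induct) (auto intro: assms)
qed

lemma span_in_image:
  assumes "lin f" "qclosed K" "\<And>x. x \<in> X \<Longrightarrow> f x \<in> span_in K Y" "\<phi> \<in> span_in K X"
  shows "f \<phi> \<in> span_in K Y"
  using assms(4)
proof (induction rule: span_in_induct)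
  case zero then show ?case by (simp add: lin_0[OF assms(1)] span_in_0)
next
  case (step c v \<chi>)
  then show ?case
    by (simp add: lin_add[OF assms(1)] lin_sc[OF assms(1)] span_in_add span_in_sc assms)
qed

lemma span_in_mono: assumes "K \<subseteq> K'" "X \<subseteq> X'" shows "span_in K X \<subseteq> span_in K' X'"
  using assms unfolding span_in_def by blast

section \<open>Forms with prescribed coefficients and degrees\<close>

definition Kf :: "complex set \<Rightarrow> nat set \<Rightarrow> complex form set" where
  "Kf K D = {\<phi>. valid_form \<phi> \<and> (\<forall>S. \<phi> S \<in> K) \<and> (\<forall>S. \<phi> S \<noteq> 0 \<longrightarrow> card S \<in> D)}"

lemma HQ_Kf: "HQ k = Kf \<rat> {k}"
  by (auto simp: HQ_def Kf_def)

lemma Kf_0: "qclosed K \<Longrightarrow> 0 \<in> Kf K D"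
  by (auto simp: Kf_def qclosed_def fun_apply)

lemma Kf_add: "qclosed K \<Longrightarrow> \<phi> \<in> Kf K D \<Longrightarrow> \<psi> \<in> Kf K D \<Longrightarrow> \<phi> + \<psi> \<in> Kf K D"
  by (auto simp: Kf_def qclosed_def valid_form_add fun_apply) (metis add.right_neutral)

lemma Kf_sc: "qclosed K \<Longrightarrow> \<phi> \<in> Kf K D \<Longrightarrow> c \<in> K \<Longrightarrow> sc c \<phi> \<in> Kf K D"
  by (auto simp: Kf_def qclosed_def valid_form_sc sc_apply)

lemma Kf_sum: "qclosed K \<Longrightarrow> (\<And>i. i \<in> A \<Longrightarrow> f i \<in> Kf K D) \<Longrightarrow> (\<Sum>i\<in>A. f i) \<in> Kf K D"
  by (induction A rule: infinite_finite_induct) (auto simp: Kf_0 Kf_add)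

lemma Kf_mono: "K \<subseteq> K' \<Longrightarrow> D \<subseteq> D' \<Longrightarrow> Kf K D \<subseteq> Kf K' D'"
  by (auto simp: Kf_def)

lemma Kf_valid: "\<phi> \<in> Kf K D \<Longrightarrow> valid_form \<phi>"
  by (simp add: Kf_def)

lemma Kf_dl: "qclosed K \<Longrightarrow> S \<subseteq> idx \<Longrightarrow> dl S \<in> Kf K {card S}"
  using valid_dl[of S] by (auto simp: Kf_def qclosed_def dl_def)

lemma sg_Rats: "(sg i S :: complex) \<in> \<rat>"
  by (simp add: sg_def)

lemma Kf_cr0:
  assumes "qclosed K" "\<phi> \<in> Kf K D" shows "cr0 i \<phi> \<in> Kf K (Suc ` D)"
proof -
  have "card S \<in> Suc ` D" if "cr0 i \<phi> S \<noteq> 0" for S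
  proof -
    have "card (S - {i}) \<in> D" "i \<in> S" "finite S"
      using that assms finite_subset_idx[of S] by (auto simp: cr0_def Kf_def split: if_splits)
    then show ?thesis by (metis card.remove imageI)
  qed
  moreover have "sg i S * \<phi> T \<in> K" for S T
    using assms sg_Rats[of i S] by (auto simp: qclosed_def Kf_def)
  ultimately show ?thesis using assms valid_cr0[of i \<phi>] by (auto simp: Kf_def cr0_def qclosed_def)
qed

lemma Kf_an0:
  assumes "qclosed K" "\<phi> \<in> Kf K D" "i \<in> idx" shows "an0 i \<phi> \<in> Kf K {k. Suc k \<in> D}"
proof -
  have "Suc (card S) \<in> D" if "an0 i \<phi> S \<noteq> 0" for S
  proof -
    have "card (insert i S) \<in> D" "i \<notin> S" "finite S"
      using that assms finite_subset_idx[of S] by (auto simp: an0_def Kf_def split: if_splits)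
    then show ?thesis by simp
  qed
  moreover have "sg i S * \<phi> T \<in> K" for S T
    using assms sg_Rats[of i S] by (auto simp: qclosed_def Kf_def)
  ultimately show ?thesis using assms valid_an0[of i \<phi>] by (auto simp: Kf_def an0_def qclosed_def)
qed

text \<open>The derivation of the exterior algebra that extends composition \<xi> \<circ> X on
  covectors.\<close>

definition Der :: "'a::field mat \<Rightarrow> 'a form \<Rightarrow> 'a form" where
  "Der X \<phi> = (\<Sum>i\<in>idx. \<Sum>j\<in>idx. sc (X i j) (cr0 j (an0 i \<phi>)))"

lemma lin_Der: "lin (Der X)"
  unfolding Der_def by (intro lin_setsum lin_scale lin_comp[OF lin_cr0 lin_an0])

lemma Kf_cr0_an0:
  assumes "qclosed K" "\<phi> \<in> Kf K D" "i \<in> idx" shows "cr0 j (an0 i \<phi>) \<in> Kf K D"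
proof -
  have "Suc ` {k. Suc k \<in> D} \<subseteq> D" by auto
  then show ?thesis using Kf_cr0[OF assms(1) Kf_an0[OF assms], of j] Kf_mono[of K K] by blast
qed

lemma Kf_Der:
  assumes "qclosed K" "\<phi> \<in> Kf K D" "\<And>i j. i \<in> idx \<Longrightarrow> j \<in> idx \<Longrightarrow> X i j \<in> K"
  shows "Der X \<phi> \<in> Kf K D"
  unfolding Der_def by (intro Kf_sum Kf_sc Kf_cr0_an0 assms) auto

section \<open>The filtration W as degree over \<open>F\<close>\<close>

definition gens :: "int mat \<Rightarrow> nat set \<Rightarrow> complex form set" where
  "gens Pinv D = {thetaS Pinv S | S. S \<subseteq> idx \<and> dcirc S \<in> D}"

lemma Vgen_gens: "Vgen Pinv k = gens Pinv {k}"
  by (simp add: Vgen_def gens_def)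

lemma Wgen_gens: "Wgen Pinv k = gens Pinv {j. k \<le> j \<and> even (j - k)}"
  by (simp add: Wgen_def gens_def)

text \<open>Contracting with \<open>gamv P 1\<close> or \<open>gamv P 2\<close> and wedging with
  \<theta>^3 or \<theta>^4 are the creators of \<open>F\<close>. Each raises \<open>dcirc\<close> by
  one, so \<open>dcirc\<close> counts creators applied to \<theta>^1 \<and> \<theta>^2.\<close>

lemma dcirc_remove:
  assumes "b \<in> {1, 2}" "b \<in> S" shows "dcirc (S - {b}) = Suc (dcirc S)"
proof -
  have "(S - {b}) \<inter> {3, 4} = S \<inter> {3, 4}" "{1, 2} - (S - {b}) = insert b ({1, 2} - S)"
    using assms by auto
  then show ?thesis using assms by (simp add: dcirc_def)
qed

lemma dcirc_insert:
  assumes "b \<in> {3, 4}" "b \<notin> S" shows "dcirc (insert b S) = Suc (dcirc S)"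
proof -
  have "insert b S \<inter> {3, 4} = insert b (S \<inter> {3, 4})" "{1, 2} - insert b S = {1, 2} - S"
    using assms by auto
  then show ?thesis using assms by (simp add: dcirc_def)
qed

lemma cl_fl: "cl (fl P Pinv Hi i) \<phi> = (\<Sum>a\<in>idx. sc (of_rat (Hi i a)) (cl (fl0 P Pinv a) \<phi>))"
  by (simp add: fl_def cl_lc)

text \<open>Two frames act on one spinor space: the states of \<open>T\<close> are the monomials
  \<theta>^S that define the filtration, while the degree of states of \<open>F\<close> is the
  filtration degree.\<close>

locale hframe =
  fixes P Pinv :: "int mat" and H Hi :: "rat mat"
  assumes Pinv: "inv_mats Pinv P" and Hinv: "inv_mats Hi H"
begin

sublocale T: cframe "\<lambda>a. (0, thtv Pinv a)" "\<lambda>a. (gamv P a, 0)" "unit_form :: complex form"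
  by (rule cframe_theta[OF Pinv])

sublocale F: cframe "fl P Pinv Hi" "fm P Pinv H" "vac0 Pinv :: complex form"
  by (rule cframe_F[OF Pinv Hinv])

lemma thetaS_st: "thetaS Pinv S = T.st S"
proof -
  have "wedge_list (map (\<lambda>i. form1 (theta Pinv i)) xs) = foldr (\<lambda>i. cl (0, thtv Pinv i)) xs unit_form" for xs
  proof (induction xs)
    case (Cons x xs)
    have "theta Pinv x = thtv Pinv x" by (simp add: theta_def thtv_def)
    then show ?case using Cons wedge_form1[OF T.valid_foldr[of xs], of "thtv Pinv x"]
      by (simp add: cl_ext1[symmetric])
  qed simp
  then show ?thesis by (simp add: thetaS_def T.st_def)
qed

lemma cl_fl0_st:
  assumes "b \<in> idx" "S \<subseteq> idx"
  shows "cl (fl0 P Pinv b) (T.st S) = (if b \<in> {1, 2}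
     then if b \<in> S then sc (2 * sg b S) (T.st (S - {b})) else 0
     else if b \<in> S then 0 else sc (sg b S) (T.st (insert b S)))"
  using T.cr_st[OF assms] T.an_st[OF assms] by (simp add: fl0_def)

lemma cl_fl0_gens:
  assumes "b \<in> idx" "\<phi> \<in> span_in \<rat> (gens Pinv {k})"
  shows "cl (fl0 P Pinv b) \<phi> \<in> span_in \<rat> (gens Pinv {Suc k})"
proof (rule span_in_image[OF lin_cl qclosed_Rats _ assms(2)])
  fix x assume "x \<in> gens Pinv {k}"
  then obtain S where S: "S \<subseteq> idx" "dcirc S = k" "x = T.st S" by (auto simp: gens_def thetaS_st)
  have b34: "b \<in> {3, 4}" if "b \<notin> {1, 2}" using assms(1) that by (auto simp: idx_set)
  have *: "sc c (T.st U) \<in> span_in \<rat> (gens Pinv {Suc k})" if "c \<in> \<rat>" "U \<subseteq> idx" "dcirc U = Suc k" for c U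
    using that by (intro span_in_sc span_in_base qclosed_Rats) (auto simp: gens_def thetaS_st)
  have "cl (fl0 P Pinv b) x = 0 \<or> (\<exists>c U. cl (fl0 P Pinv b) x = sc c (T.st U) \<and> c \<in> \<rat> \<and> U \<subseteq> idx \<and> dcirc U = Suc k)"
  proof (cases "b \<in> {1, 2}")
    case True
    then show ?thesis using S assms(1) dcirc_remove[OF True, of S] sg_Rats[of b S]
      unfolding S(3) cl_fl0_st[OF assms(1) S(1)]
      by (cases "b \<in> S") (auto intro!: exI[of _ "2 * sg b S"] exI[of _ "S - {b}"] Rats_mult simp del: One_nat_def)
  next
    case False
    then show ?thesis using S assms(1) dcirc_insert[OF b34[OF False], of S] sg_Rats[of b S]
      unfolding S(3) cl_fl0_st[OF assms(1) S(1)]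
      by (cases "b \<in> S") (auto intro!: exI[of _ "sg b S"] exI[of _ "insert b S"] simp del: One_nat_def)
  qed
  then show "cl (fl0 P Pinv b) x \<in> span_in \<rat> (gens Pinv {Suc k})"
    using * span_in_0 by auto
qed

lemma vac0_thetaS: "vac0 Pinv = T.st {1, 2}"
  by (simp add: vac0_def T.st_def)

lemma st_gens:
  assumes "S \<subseteq> idx" shows "F.st S \<in> span_in \<rat> (gens Pinv {card S})"
  using finite_subset_idx[OF assms] assms
proof (induction S rule: finite_induct)
  case empty
  have "vac0 Pinv \<in> gens Pinv {0}"
    unfolding gens_def vac0_thetaS thetaS_st[symmetric] by (auto simp: dcirc_def idx_def)
  then show ?case by (simp add: F.st_empty span_in_base qclosed_Rats)
next
  case (insert a S)
  have "cl (fl P Pinv Hi a) (F.st S) \<in> span_in \<rat> (gens Pinv {Suc (card S)})"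
    unfolding cl_fl using insert
    by (intro span_in_sum span_in_sc qclosed_Rats cl_fl0_gens) auto
  then show ?case using insert F.st_insert[of a S] sg_Rats[of a S]
    by (simp add: span_in_sc qclosed_Rats)
qed

lemma cl_fl0_Psi:
  assumes "b \<in> idx" "\<phi> \<in> Kf \<rat> {k}"
  shows "\<exists>\<psi>\<in>Kf \<rat> {Suc k}. cl (fl0 P Pinv b) (F.Psi \<phi>) = F.Psi \<psi>"
proof -
  let ?\<psi> = "\<Sum>i\<in>idx. sc (of_rat (H b i)) (cr0 i \<phi>)"
  have "cl (fl0 P Pinv b) (F.Psi \<phi>) = F.Psi ?\<psi>"
    using assms(2) unfolding fl0_comb[OF Hinv assms(1)]
    by (simp add: lin_sum[OF F.lin_Psi] lin_sc[OF F.lin_Psi] F.Psi_cr0 Kf_valid)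
  moreover have "?\<psi> \<in> Kf \<rat> {Suc k}"
    using Kf_cr0[OF qclosed_Rats assms(2)] by (intro Kf_sum Kf_sc qclosed_Rats) auto
  ultimately show ?thesis by blast
qed

text \<open>Every \<theta>^S is reached from \<theta>^1 \<and> \<theta>^2 by removing some of 1, 2
  and inserting some of 3, 4. Each move is, up to a rational factor, one creator of
  \<open>F\<close>, hence one step of degree.\<close>

lemma thetaS_Psi:
  assumes "S \<subseteq> idx" shows "T.st S \<in> F.Psi ` Kf \<rat> {dcirc S}"
proof -
  define Q where "Q S \<longleftrightarrow> T.st S \<in> F.Psi ` Kf \<rat> {dcirc S}" for S
  have scale: "sc c \<phi> \<in> F.Psi ` Kf \<rat> {k}" if "\<phi> \<in> F.Psi ` Kf \<rat> {k}" "c \<in> \<rat>" for c \<phi> k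
    using that by (auto simp: lin_sc[OF F.lin_Psi, symmetric] intro!: imageI Kf_sc qclosed_Rats)
  have step: "cl (fl0 P Pinv b) \<phi> \<in> F.Psi ` Kf \<rat> {Suc k}" if "\<phi> \<in> F.Psi ` Kf \<rat> {k}" "b \<in> idx" for \<phi> k b
    using that cl_fl0_Psi[OF that(2)] by auto
  have rem: "Q (U - {b})" if "Q U" "b \<in> {1, 2}" "b \<in> U" "U \<subseteq> idx" for U b
  proof -
    have b: "b \<in> idx" using that by auto
    have "sg b U * (sg b U * x) = x" for x :: complex
      using sg_sq[of b U, where 'a=complex] by (simp flip: mult.assoc)
    then have "T.st (U - {b}) = sc (sg b U / 2) (cl (fl0 P Pinv b) (T.st U))"
      unfolding cl_fl0_st[OF b that(4)] using that by (auto simp: fun_eq_iff fun_apply)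
    moreover have "(sg b U / 2 :: complex) \<in> \<rat>" using sg_Rats[of b U] by auto
    ultimately show ?thesis using scale[OF step[OF _ b]] that unfolding Q_def by (simp add: dcirc_remove)
  qed
  have ins: "Q (insert b U)" if "Q U" "b \<in> {3, 4}" "b \<notin> U" "U \<subseteq> idx" for U b
  proof -
    have b: "b \<in> idx" "b \<notin> {1, 2}" using that by (auto simp: idx_def)
    have "T.st (insert b U) = sc (sg b U) (cl (fl0 P Pinv b) (T.st U))"
      unfolding cl_fl0_st[OF b(1) that(4)] using that b by (auto simp: sg_sq)
    then show ?thesis using scale[OF step[OF _ b(1)] sg_Rats] that unfolding Q_def by (simp add: dcirc_insert)
  qed
  have Q12: "Q {1, 2}"
  proof -
    have "T.st {1, 2} = F.Psi (dl {})"
      unfolding F.Psi_dl[OF empty_subsetI] F.st_empty by (rule vac0_thetaS[symmetric])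
    moreover have "dl {} \<in> Kf \<rat> {dcirc {1, 2}}"
      using Kf_dl[OF qclosed_Rats, of "{}"] by (simp add: dcirc_def)
    ultimately show ?thesis unfolding Q_def by blast
  qed
  have i12: "{1, 2} \<subseteq> idx" "{2} \<subseteq> idx" by (auto simp: idx_def)
  have e: "{1, 2} - {1} = {2::nat}" "{1, 2} - {2} = {1::nat}" "{2} - {2} = ({}::nat set)" by auto
  have Q2: "Q {2}" using rem[OF Q12, of 1] i12 unfolding e by simp
  have Q1: "Q {1}" using rem[OF Q12, of 2] i12 unfolding e by simp
  have Q0: "Q {}" using rem[OF Q2, of 2] i12 unfolding e by simp
  define R where "R = S \<inter> {1, 2}"
  have QR: "Q R" "R \<subseteq> idx"
  proof -
    have "R = {} \<or> R = {1} \<or> R = {2} \<or> R = {1, 2}" by (auto simp: R_def)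
    then show "Q R" using Q0 Q1 Q2 Q12 by auto
    show "R \<subseteq> idx" using assms by (auto simp: R_def)
  qed
  define R3 where "R3 = R \<union> (S \<inter> {3})"
  have R3: "Q R3" "R3 \<subseteq> idx"
  proof -
    have "3 \<notin> R" by (auto simp: R_def)
    moreover have "R3 = (if 3 \<in> S then insert 3 R else R)" by (auto simp: R3_def)
    ultimately show "Q R3" using ins[OF QR(1), of 3] QR by auto
    show "R3 \<subseteq> idx" using QR assms by (auto simp: R3_def)
  qed
  have "4 \<notin> R3" by (auto simp: R_def R3_def)
  moreover have "S = (if 4 \<in> S then insert 4 R3 else R3)"
    using assms by (auto simp: R3_def R_def idx_set)
  ultimately have "Q S" using ins[OF R3(1), of 4] R3 by (metis insertCI)
  then show ?thesis by (simp add: Q_def)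
qed

text \<open>The dictionary between the filtration and degree: over any of the coefficient fields,
  \<open>F.Psi\<close> carries forms of degrees D onto the span of the \<theta>^S with
  \<open>dcirc\<close> in D. Taking D = {k} gives \<open>VQ\<close>, and all degrees from k on in
  steps of two give W^k.\<close>

lemma span_gens:
  assumes "qclosed K" shows "span_in K (gens Pinv D) = F.Psi ` Kf K D"
proof
  have QK: "\<rat> \<subseteq> K" using assms by (simp add: qclosed_def)
  show "span_in K (gens Pinv D) \<subseteq> F.Psi ` Kf K D"
  proof (rule span_in_minimal)
    show "0 \<in> F.Psi ` Kf K D" using lin_0[OF F.lin_Psi] Kf_0[OF assms] by (metis imageI)
    show "\<phi> + \<psi> \<in> F.Psi ` Kf K D" if "\<phi> \<in> F.Psi ` Kf K D" "\<psi> \<in> F.Psi ` Kf K D" for \<phi> \<psi>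
      using that by (auto simp: lin_add[OF F.lin_Psi, symmetric] intro!: imageI Kf_add assms)
    fix c v assume c: "c \<in> K" and "v \<in> gens Pinv D"
    then obtain S where S: "S \<subseteq> idx" "dcirc S \<in> D" "v = T.st S" by (auto simp: gens_def thetaS_st)
    obtain \<phi> where "v = F.Psi \<phi>" "\<phi> \<in> Kf \<rat> {dcirc S}" using thetaS_Psi[OF S(1)] S(3) by auto
    moreover have "Kf \<rat> {dcirc S} \<subseteq> Kf K D" using QK S(2) by (intro Kf_mono) auto
    ultimately show "sc c v \<in> F.Psi ` Kf K D"
      using c by (auto simp: lin_sc[OF F.lin_Psi, symmetric] intro!: imageI Kf_sc assms)
  qed
  show "F.Psi ` Kf K D \<subseteq> span_in K (gens Pinv D)"
  proof
    fix x assume "x \<in> F.Psi ` Kf K D"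
    then obtain \<phi> where \<phi>: "\<phi> \<in> Kf K D" "x = F.Psi \<phi>" by auto
    have "sc (\<phi> S) (F.st S) \<in> span_in K (gens Pinv D)" if "S \<in> Pow idx" for S
    proof (cases "\<phi> S = 0")
      case True then show ?thesis by (simp add: span_in_0)
    next
      case False
      then have "card S \<in> D" using \<phi>(1) by (simp add: Kf_def)
      then have "gens Pinv {card S} \<subseteq> gens Pinv D" by (auto simp: gens_def)
      then have "F.st S \<in> span_in K (gens Pinv D)"
        using st_gens[of S] that span_in_mono[OF QK] by blast
      then show ?thesis using \<phi>(1) by (intro span_in_sc assms) (auto simp: Kf_def)
    qed
    then show "x \<in> span_in K (gens Pinv D)" unfolding \<phi>(2) F.Psi_def by (rule span_in_sum)
  qed
qed

lemma cr0_gens: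
  assumes "i \<in> idx" "\<phi> \<in> span_in \<rat> (gens Pinv UNIV)" shows "cr0 i \<phi> \<in> span_in \<rat> (gens Pinv UNIV)"
proof -
  have "cr0 i \<phi> = (\<Sum>a\<in>idx. sc (gamv P a i) (cl (0, thtv Pinv a) \<phi>))"
    using T.cl_comp[of "(0, bv i)" \<phi>] assms(1) by (simp add: cl_cr0 qf_bil zero_fun_apply)
  moreover have "cl (0, thtv Pinv a) \<phi> \<in> span_in \<rat> (gens Pinv UNIV)" if a: "a \<in> idx" for a
  proof (rule span_in_image[OF lin_cl qclosed_Rats _ assms(2)])
    fix x assume "x \<in> gens Pinv UNIV"
    then obtain S where S: "S \<subseteq> idx" "x = T.st S" by (auto simp: gens_def thetaS_st)
    then have "T.st (insert a S) \<in> gens Pinv UNIV" using a by (auto simp: gens_def thetaS_st)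
    then show "cl (0, thtv Pinv a) x \<in> span_in \<rat> (gens Pinv UNIV)"
      using T.cr_st[OF a S(1)] S(2) span_in_sc[OF qclosed_Rats span_in_base[OF qclosed_Rats] sg_Rats] by (auto simp: span_in_0)
  qed
  ultimately show ?thesis
    by (auto intro!: span_in_sum span_in_sc qclosed_Rats simp: gamv_def)
qed

text \<open>Surjectivity over the rationals is what makes the inverse of \<open>F.Psi\<close> a
  rational operator, as a morphism of rational Hodge structures must be.\<close>

lemma Psi_surj: assumes "S \<subseteq> idx" shows "\<exists>\<phi>\<in>Kf \<rat> UNIV. F.Psi \<phi> = dl S"
proof -
  have "dl S \<in> span_in \<rat> (gens Pinv UNIV)"
    using finite_subset_idx[OF assms] assms
  proof (induction S rule: finite_induct)
    case empty
    have "T.st {} \<in> gens Pinv UNIV" unfolding gens_def thetaS_st by blast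
    then show ?case using span_in_base[OF qclosed_Rats] unfolding T.st_empty by (simp add: unit_form_dl)
  next
    case (insert a S)
    then have "dl (insert a S) = sc (sg a S) (cr0 a (dl S :: complex form))" by (simp add: cr0_dl sg_sq)
    then show ?case using insert cr0_gens[of a "dl S"] by (simp add: span_in_sc qclosed_Rats sg_Rats)
  qed
  then show ?thesis using span_gens[OF qclosed_Rats] by auto
qed

lemma Psi_rational: assumes "\<phi> \<in> Kf \<rat> UNIV" shows "F.Psi \<phi> \<in> Kf \<rat> UNIV"
proof -
  have tk: "T.st S \<in> Kf \<rat> UNIV" if "S \<subseteq> idx" for S
    using finite_subset_idx[OF that] that
  proof (induction S rule: finite_induct)
    case empty
    have "T.st {} = dl {}" using T.st_empty unit_form_dl by (rule trans)
    show ?case unfolding \<open>T.st {} = dl {}\<close>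
      by (rule subsetD[OF Kf_mono[OF subset_refl subset_UNIV] Kf_dl[OF qclosed_Rats empty_subsetI]])
  next
    case (insert a S)
    have "cr0 i (T.st S) \<in> Kf \<rat> UNIV" for i
      by (rule subsetD[OF Kf_mono[OF subset_refl subset_UNIV] Kf_cr0[OF qclosed_Rats insert.IH]])
        (use insert.prems in auto)
    then have "cl (0, thtv Pinv a) (T.st S) \<in> Kf \<rat> UNIV"
      unfolding cl_ext1 ext1_def by (intro Kf_sum Kf_sc qclosed_Rats) (auto simp: thtv_def)
    then show ?case using insert T.st_insert[of a S] by (simp add: Kf_sc qclosed_Rats sg_Rats)
  qed
  have "span_in \<rat> (gens Pinv UNIV) \<subseteq> Kf \<rat> UNIV"
    by (rule span_in_minimal) (use tk in \<open>auto simp: gens_def thetaS_st Kf_0 Kf_add Kf_sc qclosed_Rats\<close>)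
  then show ?thesis using span_gens[OF qclosed_Rats, of UNIV] assms by blast
qed

end

text \<open>The bridge to the encoding of morphisms by rational matrices: a linear operator with
  rational values on basis forms agrees with some \<open>qfapp M\<close> on valid forms.\<close>

lemma qfapp_exists:
  assumes "lin f" "\<And>\<phi>. valid_form (f \<phi>)" "\<And>T. T \<subseteq> idx \<Longrightarrow> f (dl T) \<in> Kf \<rat> UNIV"
  shows "\<exists>M. \<forall>\<phi>. valid_form \<phi> \<longrightarrow> qfapp M \<phi> = f \<phi>"
proof -
  define M where "M S T = (SOME r. opmat f S T = of_rat r)" for S T
  have "opmat f S T \<in> \<rat>" for S T
    using assms(3)[of T] by (auto simp: opmat_def Kf_def)
  then have "\<exists>r. opmat f S T = of_rat r" for S T by (metis Rats_cases)
  then have "of_rat (M S T) = opmat f S T" for S T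
    unfolding M_def by (metis (mono_tags, lifting) someI_ex)
  then have "qfapp M \<phi> = f \<phi>" if "valid_form \<phi>" for \<phi>
    using opmat_sum[OF assms(1,2) that] by (simp add: qfapp_def fapp_def)
  then show ?thesis by blast
qed

context hframe begin

text \<open>The inverse of \<open>F.Psi\<close>, obtained by choosing one rational preimage for each
  basis form and extending linearly.\<close>

definition Om :: "complex form \<Rightarrow> complex form" where
  "Om \<phi> = (\<Sum>T\<in>Pow idx. sc (\<phi> T) (SOME \<psi>. \<psi> \<in> Kf \<rat> UNIV \<and> F.Psi \<psi> = dl T))"

lemma Om_dl_ex: "T \<subseteq> idx \<Longrightarrow> (SOME \<psi>. \<psi> \<in> Kf \<rat> UNIV \<and> F.Psi \<psi> = dl T) \<in> Kf \<rat> UNIV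
    \<and> F.Psi (SOME \<psi>. \<psi> \<in> Kf \<rat> UNIV \<and> F.Psi \<psi> = dl T) = dl T"
  using someI_ex[of "\<lambda>\<psi>. \<psi> \<in> Kf \<rat> UNIV \<and> F.Psi \<psi> = dl T"] Psi_surj[of T] by blast

lemma lin_Om: "lin Om"
  by (simp add: lin_def Om_def sc.scale_left_distrib sum.distrib sc.scale_sum_right fun_apply)

lemma Om_Kf: assumes "qclosed K" "\<phi> \<in> Kf K UNIV" shows "Om \<phi> \<in> Kf K UNIV"
proof -
  have "Kf \<rat> UNIV \<subseteq> Kf K UNIV" using assms(1) by (intro Kf_mono) (auto simp: qclosed_def)
  then show ?thesis unfolding Om_def using assms Om_dl_ex by (intro Kf_sum Kf_sc) (auto simp: Kf_def)
qed

lemma valid_Om: "valid_form (Om \<phi>)"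
  unfolding Om_def by (intro valid_form_sum valid_form_sc) (use Om_dl_ex Kf_valid in blast)

lemma Psi_Om: assumes "valid_form \<phi>" shows "F.Psi (Om \<phi>) = \<phi>"
proof -
  have "F.Psi (Om \<phi>) = (\<Sum>T\<in>Pow idx. sc (\<phi> T) (dl T))"
    unfolding Om_def lin_sum[OF F.lin_Psi] lin_sc[OF F.lin_Psi]
    by (intro sum.cong refl) (use Om_dl_ex in auto)
  then show ?thesis using form_decomp[OF assms] by simp
qed

lemma Om_Psi: assumes "valid_form \<phi>" shows "Om (F.Psi \<phi>) = \<phi>"
  by (rule F.Psi_inj[OF valid_Om assms]) (rule Psi_Om[OF F.valid_Psi])

end

section \<open>The vertical action in the adapted frame\<close>

lemma of_real_of_rat: "complex_of_real (of_rat q) = of_rat q"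
  by (cases q) (simp add: of_rat_rat)

section \<open>Complexification of the real spin action\<close>

definition cxd :: "lam \<Rightarrow> complex dvec" where
  "cxd x = (\<lambda>i. complex_of_real (fst x i), \<lambda>i. complex_of_real (snd x i))"

definition cxf :: "real form \<Rightarrow> complex form" where
  "cxf \<phi> = (\<lambda>S. complex_of_real (\<phi> S))"

lemma of_real_sg: "complex_of_real (sg i S) = sg i S"
  by (simp add: sg_def)

lemma cl_cx: "cl (cxd x) (cxf \<phi>) = cxf (cl x \<phi>)"
proof
  fix U
  have "an0 i (cxf \<phi>) U = complex_of_real (an0 i \<phi> U)" "cr0 i (cxf \<phi>) U = complex_of_real (cr0 i \<phi> U)" for i
    by (simp_all add: an0_def cr0_def cxf_def of_real_sg)
  then show "cl (cxd x) (cxf \<phi>) U = cxf (cl x \<phi>) U"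
    by (simp add: cl_def cxd_def cxf_def sum_fun_apply fun_apply)
qed

lemma cxf_add: "cxf (\<phi> + \<psi>) = cxf \<phi> + cxf \<psi>"
  and cxf_sc: "cxf (sc c \<phi>) = sc (of_real c) (cxf \<phi>)"
  and cxf_sum: "cxf (\<Sum>i\<in>A. f i) = (\<Sum>i\<in>A. cxf (f i))"
  and cxf_dl: "cxf (dl T) = dl T"
  by (auto simp: cxf_def fun_eq_iff fun_apply sum_fun_apply dl_def)

lemma quadop_cx:
  "quadop (\<lambda>i. cxd (l i)) (\<lambda>i. cxd (m i)) (cmat J) (cmat K) (cxf \<phi>) = cxf (quadop l m J K \<phi>)"
  by (simp add: quadop_def cxf_sum cxf_add cxf_sc cl_cx cmat_def)

lemma capp_quadop:
  assumes "valid_form \<phi>"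
  shows "capp (opmat (quadop l m J K)) \<phi> = quadop (\<lambda>i. cxd (l i)) (\<lambda>i. cxd (m i)) (cmat J) (cmat K) \<phi>"
proof -
  let ?f = "quadop (\<lambda>i. cxd (l i)) (\<lambda>i. cxd (m i)) (cmat J) (cmat K)"
  have "complex_of_real (opmat (quadop l m J K) S T) = opmat ?f S T" for S T
    using quadop_cx[of l m J K "dl T"] by (simp add: opmat_def cxf_dl) (simp add: cxf_def)
  then show ?thesis
    using opmat_sum[OF lin_quadop valid_quadop assms] by (simp add: capp_def fapp_def)
qed

lemma cxd_fl: "cxd (fl P Pinv Hi i) = fl P Pinv Hi i" and cxd_fm: "cxd (fm P Pinv H i) = fm P Pinv H i"
  by (auto simp: cxd_def fl_def fm_def lc_def fl0_def fm0_def fun_eq_iff sum_fun_apply fun_apply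
      of_real_of_rat gamv_def thtv_def intro!: sum.cong)

text \<open>The second summand raises the degree by two and so is invisible on the graded pieces.\<close>

definition hop :: "real mat \<Rightarrow> real mat \<Rightarrow> complex form \<Rightarrow> complex form" where
  "hop Icx K \<phi> = sc (-1) (Der (cmat Icx) \<phi>) + (\<Sum>i\<in>idx. \<Sum>j\<in>idx. sc (complex_of_real (K j i)) (cr0 j (cr0 i \<phi>)))"

text \<open>Pulled back along \<open>Psi\<close>, the quadratic element becomes a polynomial in
  \<open>cr0\<close> and \<open>an0\<close>; the 2 from the annihilators cancels the 1/2 at
  J.\<close>

lemma (in frame) quadop_Psi:
  assumes "valid_form \<phi>"
  shows "quadop l m J K (Psi \<phi>) = Psi (\<Sum>i\<in>idx. \<Sum>j\<in>idx. sc (J j i) (cr0 j (an0 i \<phi>)) + sc (K j i / 4) (cr0 j (cr0 i \<phi>)))"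
proof -
  have "cl (l j) (cl (m i) (Psi \<phi>)) = sc 2 (Psi (cr0 j (an0 i \<phi>)))" if "i \<in> idx" "j \<in> idx" for i j
    using that assms by (simp add: Psi_an0[symmetric] lin_sc[OF lin_cl] Psi_cr0 valid_an0)
  moreover have "cl (l j) (cl (l i) (Psi \<phi>)) = Psi (cr0 j (cr0 i \<phi>))" if "i \<in> idx" "j \<in> idx" for i j
    using that assms by (simp add: Psi_cr0 valid_cr0)
  ultimately show ?thesis
    unfolding quadop_def lin_sum[OF lin_Psi] lin_add[OF lin_Psi] lin_sc[OF lin_Psi]
    by (intro sum.cong refl) simp
qed

context torus begin

lemma inF_fl: "inF (fl P Pinv Hi i)"
proof -
  interpret F0: cframe "fl0 P Pinv" "fm0 P Pinv" "vac0 Pinv :: real form"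
    by (rule cframe_F0[OF P_inv])
  have "fst (fl P Pinv Hi i) = fib (of_rat (Hi i 1)) (of_rat (Hi i 2))"
    by (simp add: fl_def lc_def idx_set fl0_def fib_def)
  moreover have "(\<Sum>K\<in>idx. snd (fl P Pinv Hi i :: lam) K * gamv P a K) = 0" if "a \<in> {1, 2}" for a
  proof -
    have "a \<in> idx" using that by (auto simp: idx_def)
    then have "qf (fl P Pinv Hi i) (fl0 P Pinv a) = (0 :: real)"
      unfolding fl_def qf_lc by (intro sum.neutral ballI) (simp add: F0.ll)
    then show ?thesis using that by (simp add: qf_bil fl0_def fun_apply)
  qed
  ultimately show ?thesis unfolding inF_def by blast
qed

text \<open>\<open>H\<close> is the matrix of \<open>g\<^sub>s\<close> from the basis of
  \<open>F\<close> to the coordinate covectors. The lattice basis, G, B and s are rational, so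
  \<open>H\<close> can be taken over \<open>rat\<close> and its inverse is rational without further
  argument.\<close>

lemma H_exists:
  assumes s: "s = 1 \<or> s = -1"
  obtains H Hi :: "rat mat" where "inv_mats Hi H"
    "\<And>a K. a \<in> idx \<Longrightarrow> K \<in> idx \<Longrightarrow> real_of_rat (H a K) = qf (fl0 P Pinv a) (nn s K)"
proof -
  interpret F0: cframe "fl0 P Pinv" "fm0 P Pinv" "vac0 Pinv :: real form"
    by (rule cframe_F0[OF P_inv])
  define H where "H a K = (SOME r. real_of_rat r = qf (fl0 P Pinv a) (nn s K))" for a K
  have H: "real_of_rat (H a K) = qf (fl0 P Pinv a) (nn s K)" if "a \<in> idx" "K \<in> idx" for a K
  proof -
    have "snd (fl0 P Pinv a :: lam) i \<in> \<rat>" "fst (fl0 P Pinv a :: lam) i \<in> \<rat>" for i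
      by (auto simp: fl0_def thtv_def gamv_def zero_fun_apply)
    moreover have "(bv K i :: real) \<in> \<rat>" for i by (simp add: bv_def)
    moreover have "s \<in> \<rat>" using s by auto
    ultimately have "qf (fl0 P Pinv a) (nn s K) \<in> \<rat>"
      using G_rat B_rat that unfolding qf_bil nn_def by (auto intro!: Rats_add Rats_sum Rats_mult)
    then have "\<exists>r. real_of_rat r = qf (fl0 P Pinv a) (nn s K)" by (metis Rats_cases)
    then show ?thesis unfolding H_def by (rule someI_ex)
  qed
  have "\<exists>N. inv_mats N H"
  proof (rule inv_mats_exists, intro allI impI ballI)
    fix c :: "rat vec" and a
    assume c: "\<forall>K\<in>idx. (\<Sum>a\<in>idx. c a * H a K) = 0" and a: "a \<in> idx"
    define x where "x = lc (\<lambda>a. real_of_rat (c a)) (fl0 P Pinv)"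
    have x_nn: "qf x (nn s K) = 0" if "K \<in> idx" for K
    proof -
      have "qf x (nn s K) = (\<Sum>a\<in>idx. real_of_rat (c a) * real_of_rat (H a K))"
        unfolding x_def qf_lc by (intro sum.cong refl) (simp add: H that)
      also have "\<dots> = real_of_rat (\<Sum>a\<in>idx. c a * H a K)" by (simp add: of_rat_sum of_rat_mult)
      finally show ?thesis using c that by simp
    qed
    have "qf x (fl0 P Pinv b) = 0" if "b \<in> idx" for b
      unfolding x_def qf_lc using that by (intro sum.neutral ballI) (simp add: F0.ll)
    then have "qf (fl0 P Pinv b) x = 0" if "b \<in> idx" for b using that by (simp add: qf_sym)
    \<comment> \<open>A combination of the \<open>fl0\<close> is isotropic; with x = (v, \<xi>) this
      says \<xi>(v) = 0.\<close>
    then have "qf x x = 0" by (subst x_def, subst qf_lc) simp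
    then have sx: "(\<Sum>i\<in>idx. snd x i * fst x i) = 0" by (simp add: qf_bil)
    have vx: "valid_vec (fst x)"
    proof -
      have "fst (fl0 P Pinv b :: lam) i = 0" if "i \<notin> idx" for b i
        using that by (simp add: fl0_def gamv_def fun_apply)
      then show ?thesis by (simp add: x_def lc_def valid_vec_def sum_fun_apply fun_apply)
    qed
    \<comment> \<open>\<open>g\<^sub>s\<close> x is evaluated on the vector part v of x. Isotropy
      removes \<xi>(v) and antisymmetry removes B(v, v), so s G(v, v) remains and definiteness
      forces v = 0.\<close>
    have "(\<Sum>K\<in>idx. qf x (nn s K) * fst x K) = 0" by (simp add: x_nn)
    also have "(\<Sum>K\<in>idx. qf x (nn s K) * fst x K)
        = (\<Sum>i\<in>idx. snd x i * fst x i) + bil Bm (fst x) (fst x) + s * bil G (fst x) (fst x)"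
    proof -
      have "qf x (nn s K) = snd x K + iota2 (fst x) Bm K + s * iota2 (fst x) G K" if "K \<in> idx" for K
        using that by (simp add: qf_nn iota2_def)
      then show ?thesis
        by (simp add: bil_iota2 sum_distrib_left sum.distrib[symmetric] algebra_simps)
    qed
    finally have "bil G (fst x) (fst x) = 0" using sx bil_B_anti[of "fst x" "fst x"] s by auto
    then have f0: "fst x = 0" using G_definite vx by blast
    have s0: "snd x K = 0" if "K \<in> idx" for K
      using x_nn[OF that] that by (simp add: qf_nn f0 iota2_def fun_apply)
    \<comment> \<open>With x zero on \<open>idx\<close>, pairing with the dual vector
      \<open>fm0 P Pinv a\<close> recovers its a-th coefficient.\<close>
    have "real_of_rat (c a) = (\<Sum>b\<in>idx. real_of_rat (c b) * qf (fl0 P Pinv b) (fm0 P Pinv a))"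
      using a by (subst sum.cong[OF refl, of _ _ "\<lambda>b. real_of_rat (c b) * (if b = a then 1 else 0)"])
        (simp_all add: F0.lm sum_delta_idx)
    also have "\<dots> = qf x (fm0 P Pinv a)" by (simp add: x_def qf_lc)
    also have "\<dots> = 0" by (simp add: qf_bil f0 s0 fun_apply)
    finally show "c a = 0" by simp
  qed
  then show ?thesis using that H by blast
qed

lemma dJ_sign: "\<exists>s. (s = 1 \<or> s = -1) \<and> dJ G Icx Bm = (\<lambda>S T. s * dspin JJ S T)"
proof -
  have "dJ G Icx Bm = dspin JJ \<or> dJ G Icx Bm = (\<lambda>S T. - dspin JJ S T)"
    by (simp add: dJ_def Let_def)
  then show ?thesis
  proof
    assume "dJ G Icx Bm = dspin JJ" then show ?thesis by (intro exI[of _ 1]) simp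
  next
    assume "dJ G Icx Bm = (\<lambda>S T. - dspin JJ S T)" then show ?thesis by (intro exI[of _ "-1"]) simp
  qed
qed

text \<open>The basis \<open>fl\<close> of \<open>F\<close> is q-dual to the vectors
  \<open>nn s\<close>, so the intertwining rule makes the block of \<open>J\<^sub>B\<close> along
  \<open>F\<close> equal to -s I. The sign s of \<open>dJ\<close> multiplies it once more, and s s =
  1 leaves -\<open>Der\<close> of I for either sign.\<close>

lemma dJ_frame:
  "\<exists>H Hi K. hframe P Pinv H Hi \<and> (\<forall>\<phi>. valid_form \<phi> \<longrightarrow>
      capp (dJ G Icx Bm) (frame.Psi (fl P Pinv Hi) (vac0 Pinv) \<phi>) = frame.Psi (fl P Pinv Hi) (vac0 Pinv) (hop Icx K \<phi>))"
proof -
  obtain s where s: "s = 1 \<or> s = -1" and dJ: "dJ G Icx Bm = (\<lambda>S T. s * dspin JJ S T)"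
    using dJ_sign by blast
  have ss: "s * s = 1" using s by auto
  obtain H Hi :: "rat mat" where Hinv: "inv_mats Hi H"
    and H: "\<And>a K. a \<in> idx \<Longrightarrow> K \<in> idx \<Longrightarrow> real_of_rat (H a K) = qf (fl0 P Pinv a) (nn s K)"
    using H_exists[OF s] by metis
  interpret hframe P Pinv H Hi by unfold_locales (rule P_inv Hinv)+
  have R: "cframe (fl P Pinv Hi) (fm P Pinv H) (vac0 Pinv :: real form)"
    by (rule cframe_F[OF P_inv Hinv])
  interpret R: cframe "fl P Pinv Hi" "fm P Pinv H" "vac0 Pinv :: real form" by (rule R)
  define K where "K j i = qf (JJ (fm P Pinv H i)) (fm P Pinv H j)" for j i
  have fn: "qf (fl P Pinv Hi i) (nn s L) = (if i = L then 1 else 0)" if "i \<in> idx" "L \<in> idx" for i L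
  proof -
    have "qf (fl P Pinv Hi i) (nn s L) = (\<Sum>a\<in>idx. real_of_rat (Hi i a) * real_of_rat (H a L))"
      unfolding fl_def qf_lc by (intro sum.cong refl) (simp add: H that)
    then show ?thesis using inv_matsD(1)[OF inv_mats_of_rat[OF Hinv] that] by simp
  qed
  have inv: "qf (JJ (fl P Pinv Hi i)) (fl P Pinv Hi j) = 0" for i j
    by (rule JJ_inF[OF inF_fl inF_fl])
  have J: "- s * Icx i j = qf (JJ (fl P Pinv Hi i)) (fm P Pinv H j)" if ij: "i \<in> idx" "j \<in> idx" for i j
  proof -
    have v: "valid_vec (fst (fl P Pinv Hi i :: lam))" using inF_fl[of Hi i] valid_fib by (auto simp: inF_def)
    have "qf (JJ (fl P Pinv Hi i)) (nn s j) = - s * (\<Sum>L\<in>idx. qf (fl P Pinv Hi i) (nn s L) * Icx L j)"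
      by (rule JJ_nn[OF ss ij(2) v])
    also have "(\<Sum>L\<in>idx. qf (fl P Pinv Hi i) (nn s L) * Icx L j) = (\<Sum>L\<in>idx. Icx L j * (if i = L then 1 else 0))"
      by (intro sum.cong refl) (simp add: fn ij)
    also have "\<dots> = Icx i j" using ij by (simp only: sum_delta_idx)
    finally have 1: "qf (JJ (fl P Pinv Hi i)) (nn s j) = - s * Icx i j" .
    \<comment> \<open>Expansion in the frame: the image of \<open>F\<close> pairs to zero with
      \<open>F\<close>, so against it \<open>nn s j\<close> acts like
      \<open>fm P Pinv H j\<close>.\<close>
    have "qf (JJ (fl P Pinv Hi i)) (nn s j) = (\<Sum>k\<in>idx. qf (JJ (fl P Pinv Hi i)) (fm P Pinv H k) * qf (fl P Pinv Hi k) (nn s j)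
        + qf (JJ (fl P Pinv Hi i)) (fl P Pinv Hi k) * qf (fm P Pinv H k) (nn s j))"
      by (rule R.qcomp)
    also have "\<dots> = (\<Sum>k\<in>idx. qf (JJ (fl P Pinv Hi i)) (fm P Pinv H k) * (if k = j then 1 else 0))"
      by (intro sum.cong refl) (simp add: fn ij inv)
    also have "\<dots> = qf (JJ (fl P Pinv Hi i)) (fm P Pinv H j)" using ij by (simp only: sum_delta_idx)
    finally show ?thesis using 1 by simp
  qed
  have tr: "(\<Sum>i\<in>idx. - s * Icx i i) = 0"
    using trace_I by (simp add: sum_distrib_left[symmetric] sum_negf)
  have dsp: "dspin JJ = opmat (quadop (fl P Pinv Hi) (fm P Pinv H) (\<lambda>j i. - s * Icx i j) K)"
    by (rule spin_mat_quadop[OF R JJ_skew inv J]) (simp_all only: K_def tr)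
  have "capp (dJ G Icx Bm) (F.Psi \<phi>) = F.Psi (hop Icx (\<lambda>j i. s * K j i / 4) \<phi>)" if v: "valid_form \<phi>" for \<phi>
  proof -
    have "capp (dJ G Icx Bm) (F.Psi \<phi>) = sc (of_real s) (capp (dspin JJ) (F.Psi \<phi>))"
      unfolding dJ by (auto simp: capp_def fapp_def fun_eq_iff fun_apply sum_distrib_left mult.assoc)
    also have "capp (dspin JJ) (F.Psi \<phi>) = quadop (fl P Pinv Hi) (fm P Pinv H) (cmat (\<lambda>j i. - s * Icx i j)) (cmat K) (F.Psi \<phi>)"
      unfolding dsp capp_quadop[OF F.valid_Psi] cxd_fl cxd_fm ..
    also have "\<dots> = F.Psi (\<Sum>i\<in>idx. \<Sum>j\<in>idx. sc (cmat (\<lambda>j i. - s * Icx i j) j i) (cr0 j (an0 i \<phi>)) + sc (cmat K j i / 4) (cr0 j (cr0 i \<phi>)))"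
      by (rule F.quadop_Psi[OF v])
    finally have 1: "capp (dJ G Icx Bm) (F.Psi \<phi>) = F.Psi (sc (of_real s)
       (\<Sum>i\<in>idx. \<Sum>j\<in>idx. sc (cmat (\<lambda>j i. - s * Icx i j) j i) (cr0 j (an0 i \<phi>)) + sc (cmat K j i / 4) (cr0 j (cr0 i \<phi>))))"
      by (simp only: lin_sc[OF F.lin_Psi])
    have ssc: "complex_of_real s * complex_of_real s = 1" using s by auto
    have co: "of_real s * cmat (\<lambda>j i. - s * Icx i j) j i = - cmat Icx i j" "of_real s * (cmat K j i / 4) = of_real (s * K j i / 4)" for i j
      using ssc by (simp_all add: cmat_def flip: mult.assoc)
    have "sc (of_real s) (\<Sum>i\<in>idx. \<Sum>j\<in>idx. sc (cmat (\<lambda>j i. - s * Icx i j) j i) (cr0 j (an0 i \<phi>)) + sc (cmat K j i / 4) (cr0 j (cr0 i \<phi>)))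
       = (\<Sum>i\<in>idx. \<Sum>j\<in>idx. sc (- cmat Icx i j) (cr0 j (an0 i \<phi>)) + sc (of_real (s * K j i / 4)) (cr0 j (cr0 i \<phi>)))"
      by (simp only: sc.scale_sum_right sc.scale_right_distrib sc.scale_scale co)
    also have "\<dots> = hop Icx (\<lambda>j i. s * K j i / 4) \<phi>"
      unfolding hop_def Der_def by (simp only: sum.distrib sc.scale_sum_right sc.scale_scale mult_minus1)
    finally show ?thesis using 1 by simp
  qed
  then show ?thesis using hframe_axioms by blast
qed

end

section \<open>The exponential series of an operator on forms\<close>

definition expser :: "(complex form \<Rightarrow> complex form) \<Rightarrow> real \<Rightarrow> complex form \<Rightarrow> complex form" where
  "expser f \<alpha> \<phi> = (\<lambda>S. \<Sum>n. (of_real \<alpha>) ^ n / of_nat (fact n) * ((f ^^ n) \<phi>) S)"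

lemma rho_expser: "rho G Icx Bm \<alpha> = expser (capp (dJ G Icx Bm)) \<alpha>"
  by (simp add: fun_eq_iff rho_def expser_def)

locale vop =
  fixes f :: "complex form \<Rightarrow> complex form"
  assumes lin: "lin f" and valid: "\<And>\<phi>. valid_form \<phi> \<Longrightarrow> valid_form (f \<phi>)"
begin

lemma valid_pow: "valid_form \<phi> \<Longrightarrow> valid_form ((f ^^ n) \<phi>)"
  by (induction n) (auto simp: valid)

text \<open>C is the sum of the norms of all matrix entries, a crude bound for the operator norm in
  the sup norm; the powers then grow at most geometrically and the series is dominated by a real
  exponential series.\<close>

lemma pow_bound:
  assumes v: "valid_form \<phi>"
  obtains C B where "C \<ge> 0" "B \<ge> 0" "\<And>n S. norm ((f ^^ n) \<phi> S) \<le> C ^ n * B"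
proof -
  define C where "C = (\<Sum>S\<in>Pow idx. \<Sum>T\<in>Pow idx. norm (f (dl T) S))"
  define B where "B = (\<Sum>T\<in>Pow idx. norm (\<phi> T))"
  have C0: "C \<ge> 0" and B0: "B \<ge> 0" by (auto simp: C_def B_def intro!: sum_nonneg)
  have "norm ((f ^^ n) \<phi> S) \<le> C ^ n * B" for n S
  proof (induction n arbitrary: S)
    case 0
    show ?case
    proof (cases "S \<subseteq> idx")
      case True
      then have "norm (\<phi> S) \<le> B" unfolding B_def by (intro member_le_sum) auto
      then show ?thesis by simp
    next
      case False
      then have "\<phi> S = 0" using v by (simp add: valid_form_def)
      then show ?thesis using B0 by simp
    qed
  next
    case (Suc n)
    let ?\<psi> = "(f ^^ n) \<phi>"
    have v': "valid_form ?\<psi>" by (rule valid_pow[OF v])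
    show ?case
    proof (cases "S \<subseteq> idx")
      case True
      have "(f ^^ Suc n) \<phi> S = (\<Sum>T\<in>Pow idx. ?\<psi> T * f (dl T) S)"
        using lin_decomp[OF lin v'] by (simp add: sum_fun_apply sc_apply)
      then have "norm ((f ^^ Suc n) \<phi> S) \<le> (\<Sum>T\<in>Pow idx. norm (?\<psi> T) * norm (f (dl T) S))"
        by (metis (no_types, lifting) norm_mult norm_sum sum.cong)
      also have "\<dots> \<le> (\<Sum>T\<in>Pow idx. C ^ n * B * norm (f (dl T) S))"
        by (intro sum_mono mult_right_mono Suc.IH) auto
      also have "\<dots> = C ^ n * B * (\<Sum>T\<in>Pow idx. norm (f (dl T) S))" by (simp add: sum_distrib_left)
      also have "\<dots> \<le> C ^ n * B * C"
      proof (rule mult_left_mono)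
        show "(\<Sum>T\<in>Pow idx. norm (f (dl T) S)) \<le> C"
          unfolding C_def using True by (intro member_le_sum[of S "Pow idx" "\<lambda>S. \<Sum>T\<in>Pow idx. norm (f (dl T) S)"]) (auto intro: sum_nonneg)
      qed (use C0 B0 in simp)
      finally show ?thesis by (simp add: mult.commute mult.left_commute)
    next
      case False
      then have "(f ^^ Suc n) \<phi> S = 0" using valid_pow[OF v, of "Suc n"] by (simp add: valid_form_def)
      then show ?thesis using C0 B0 by simp
    qed
  qed
  with C0 B0 show ?thesis by (rule that)
qed

lemma summable_expser:
  assumes v: "valid_form \<phi>"
  shows "summable (\<lambda>n. (of_real \<alpha>) ^ n / of_nat (fact n) * ((f ^^ n) \<phi>) S)"
proof -
  obtain C B where CB: "C \<ge> 0" "B \<ge> 0" "\<And>n S. norm ((f ^^ n) \<phi> S) \<le> C ^ n * B"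
    using pow_bound[OF v] by metis
  have "summable (\<lambda>n. inverse (fact n) * (\<bar>\<alpha>\<bar> * C) ^ n * B)"
    by (intro summable_mult2 summable_exp)
  then show ?thesis
  proof (rule summable_comparison_test'[where N = 0])
    fix n :: nat
    have nf: "cmod (of_nat (fact n)) = fact n" by (subst norm_of_nat) (rule of_nat_fact)
    have "norm ((of_real \<alpha>) ^ n / of_nat (fact n) * ((f ^^ n) \<phi>) S) = inverse (fact n) * \<bar>\<alpha>\<bar> ^ n * norm ((f ^^ n) \<phi> S)"
      by (simp only: norm_mult norm_divide norm_power norm_inverse nf norm_of_real divide_inverse real_norm_def mult.commute)
    also have "\<dots> \<le> inverse (fact n) * \<bar>\<alpha>\<bar> ^ n * (C ^ n * B)"
      using CB(3) by (intro mult_left_mono) auto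
    finally show "norm ((of_real \<alpha>) ^ n / of_nat (fact n) * ((f ^^ n) \<phi>) S) \<le> inverse (fact n) * (\<bar>\<alpha>\<bar> * C) ^ n * B"
      by (simp add: power_mult_distrib mult.assoc)
  qed
qed

lemma valid_expser: "valid_form \<phi> \<Longrightarrow> valid_form (expser f \<alpha> \<phi>)"
  using valid_pow[of \<phi>] by (simp add: valid_form_def expser_def)

text \<open>Every term of the series is real and taking imaginary parts is bounded linear, so it
  passes through the sum. Coefficients in other degrees vanish termwise.\<close>

lemma expser_Kf_Reals:
  assumes "\<phi> \<in> Kf \<real> D" "\<And>\<psi>. \<psi> \<in> Kf \<real> D \<Longrightarrow> f \<psi> \<in> Kf \<real> D"
  shows "expser f \<alpha> \<phi> \<in> Kf \<real> D"
proof -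
  have p: "(f ^^ n) \<phi> \<in> Kf \<real> D" for n by (induction n) (auto simp: assms)
  have v: "valid_form \<phi>" using assms(1) by (rule Kf_valid)
  have "expser f \<alpha> \<phi> S \<in> \<real>" for S
  proof -
    have "Im ((of_real \<alpha>) ^ n / of_nat (fact n) * ((f ^^ n) \<phi>) S) = 0" for n
    proof -
      have "((f ^^ n) \<phi>) S \<in> \<real>" using p[of n] by (simp add: Kf_def)
      then have "(of_real \<alpha>) ^ n / of_nat (fact n) * ((f ^^ n) \<phi>) S \<in> \<real>"
        by (intro Reals_mult Reals_divide Reals_power Reals_of_real Reals_of_nat)
      then show ?thesis by (simp add: complex_is_Real_iff)
    qed
    then have "Im (expser f \<alpha> \<phi> S) = 0"
      using bounded_linear.suminf[OF bounded_linear_Im summable_expser[OF v, of \<alpha> S]]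
      by (simp add: expser_def)
    then show ?thesis by (simp add: complex_is_Real_iff)
  qed
  moreover have "expser f \<alpha> \<phi> S = 0" if "card S \<notin> D" for S
  proof -
    have "((f ^^ n) \<phi>) S = 0" for n using p[of n] that by (auto simp: Kf_def)
    then show ?thesis by (simp add: expser_def)
  qed
  ultimately show ?thesis using valid_expser[OF v] by (auto simp: Kf_def)
qed

end

text \<open>Conjugation passes to each power. It passes to the infinite sum because every
  coefficient of \<open>Psi\<close> is a finite combination of coefficients of its argument.\<close>

lemma expser_frame:
  fixes vac :: "complex form"
  assumes "frame l m vac" "vop g"
    and fg: "\<And>\<phi>. valid_form \<phi> \<Longrightarrow> f (frame.Psi l vac \<phi>) = frame.Psi l vac (g \<phi>)"
    and v: "valid_form \<phi>"
  shows "expser f \<alpha> (frame.Psi l vac \<phi>) = frame.Psi l vac (expser g \<alpha> \<phi>)"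
proof
  interpret frame l m vac by fact
  interpret vop g by fact
  fix S
  let ?c = "\<lambda>n. (of_real \<alpha>) ^ n / of_nat (fact n) :: complex"
  have pow: "(f ^^ n) (Psi \<phi>) = Psi ((g ^^ n) \<phi>)" for n
    by (induction n) (simp_all add: fg valid_pow[OF v])
  have P: "Psi \<psi> S = (\<Sum>T\<in>Pow idx. \<psi> T * st T S)" for \<psi>
    by (simp add: Psi_def sum_fun_apply sc_apply)
  have "(\<lambda>n. \<Sum>T\<in>Pow idx. (?c n * (g ^^ n) \<phi> T) * st T S) sums (\<Sum>T\<in>Pow idx. expser g \<alpha> \<phi> T * st T S)"
    unfolding expser_def by (intro sums_sum sums_mult2 summable_sums summable_expser v)
  then have "(\<lambda>n. ?c n * (f ^^ n) (Psi \<phi>) S) sums Psi (expser g \<alpha> \<phi>) S"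
    by (simp only: pow P sum_distrib_left mult.assoc)
  then show "expser f \<alpha> (Psi \<phi>) S = Psi (expser g \<alpha> \<phi>) S"
    unfolding expser_def by (rule sums_unique[symmetric])
qed

section \<open>A rational operator with simple spectrum\<close>

lemma mvec_add: "mvec M (u + v) = mvec M u + mvec M v"
  and mvec_sc: "mvec M (sc c u) = sc c (mvec M (u :: 'a::field vec))"
  by (auto simp: mvec_def fun_eq_iff fun_apply algebra_simps sum.distrib sum_distrib_left)

lemma inv_mats_one_sided:
  fixes X Y :: "'a::field mat"
  assumes XY: "\<And>i j. i \<in> idx \<Longrightarrow> j \<in> idx \<Longrightarrow> (\<Sum>k\<in>idx. X i k * Y k j) = (if i = j then 1 else 0)"
  shows "inv_mats X Y"
proof -
  have "\<exists>N. inv_mats N X"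
  proof (rule inv_mats_exists, intro allI impI ballI)
    fix c j assume c: "\<forall>K\<in>idx. (\<Sum>a\<in>idx. c a * X a K) = 0" and j: "j \<in> idx"
    have "c j = (\<Sum>a\<in>idx. c a * (\<Sum>k\<in>idx. X a k * Y k j))"
      using j by (subst sum.cong[OF refl, of _ _ "\<lambda>a. c a * (if a = j then 1 else 0)"]) (simp_all add: XY sum_delta_idx)
    also have "\<dots> = (\<Sum>k\<in>idx. (\<Sum>a\<in>idx. c a * X a k) * Y k j)"
      unfolding sum_distrib_left sum_distrib_right by (subst sum.swap) (simp add: mult.assoc)
    also have "\<dots> = 0" using c by simp
    finally show "c j = 0" .
  qed
  then obtain N where N: "inv_mats N X" ..
  have YN: "Y i j = N i j" if ij: "i \<in> idx" "j \<in> idx" for i j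
  proof -
    have "N i j = (\<Sum>a\<in>idx. N i a * (\<Sum>k\<in>idx. X a k * Y k j))"
      using ij by (subst sum.cong[OF refl, of _ _ "\<lambda>a. N i a * (if a = j then 1 else 0)"]) (simp_all add: XY sum_delta_idx)
    also have "\<dots> = (\<Sum>k\<in>idx. (\<Sum>a\<in>idx. N i a * X a k) * Y k j)"
      unfolding sum_distrib_left sum_distrib_right by (subst sum.swap) (simp add: mult.assoc)
    also have "\<dots> = (\<Sum>k\<in>idx. Y k j * (if i = k then 1 else 0))"
      by (intro sum.cong refl) (simp add: inv_matsD(1)[OF N] ij)
    also have "\<dots> = Y i j" using ij by (simp only: sum_delta_idx)
    finally show ?thesis by simp
  qed
  have "(\<Sum>k\<in>idx. Y i k * X k j) = (if i = j then 1 else 0)" if "i \<in> idx" "j \<in> idx" for i j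
    using inv_matsD(1)[OF N that] that by (simp add: YN)
  then show ?thesis using XY by (simp add: inv_mats_def)
qed

lemma valid_vec_eq_sum:
  assumes "valid_vec (w :: 'a::field vec)" shows "w = (\<Sum>a\<in>idx. sc (w a) (bv a))"
  using assms by (auto simp: sum_sc_bv_idx fun_eq_iff valid_vec_def)

lemma bil_sum_right: "bil M u (\<Sum>a\<in>A. sc (c a) (f a)) = (\<Sum>a\<in>A. c a * bil M u (f a))"
proof (induction A rule: infinite_finite_induct)
  case (insert x F)
  then show ?case by (simp add: bil_add_right bil_sc_right)
qed (simp_all add: bil_def fun_apply)

context metric begin

abbreviation "g \<equiv> bil G"
abbreviation "II \<equiv> mvec Icx"

lemma g_I_self: "valid_vec u \<Longrightarrow> g u (II u) = 0"
  using G_skew[of u u] bil_G_sym[of "II u" u] by simp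

text \<open>Four nonzero orthogonal vectors form a basis, so w is orthogonal to all vectors and in
  particular to itself.\<close>

lemma orth_complete:
  assumes b: "\<And>a. a \<in> idx \<Longrightarrow> valid_vec (b a)" "\<And>a. a \<in> idx \<Longrightarrow> b a \<noteq> 0"
    and orth: "\<And>a c. a \<in> idx \<Longrightarrow> c \<in> idx \<Longrightarrow> a \<noteq> c \<Longrightarrow> g (b a) (b c) = 0"
    and w: "valid_vec w" "\<And>a. a \<in> idx \<Longrightarrow> g w (b a) = 0"
  shows "w = 0"
proof -
  have "\<exists>N. inv_mats N (\<lambda>a K. b a K)"
  proof (rule inv_mats_exists, intro allI impI ballI)
    fix c j assume c: "\<forall>K\<in>idx. (\<Sum>a\<in>idx. c a * b a K) = 0" and j: "j \<in> idx"
    have "(\<Sum>a\<in>idx. sc (c a) (b a)) = 0"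
    proof
      fix K
      show "(\<Sum>a\<in>idx. sc (c a) (b a)) K = 0 K"
        using c b(1) by (cases "K \<in> idx") (auto simp: sum_fun_apply fun_apply valid_vec_def)
    qed
    then have "0 = g (b j) (\<Sum>a\<in>idx. sc (c a) (b a))" by (simp add: bil_def fun_apply)
    also have "\<dots> = (\<Sum>a\<in>idx. c a * g (b j) (b a))" by (rule bil_sum_right)
    also have "\<dots> = (\<Sum>a\<in>idx. (c a * g (b j) (b j)) * (if a = j then 1 else 0))"
      using orth j by (intro sum.cong refl) auto
    also have "\<dots> = c j * g (b j) (b j)" using j by (simp only: sum_delta_idx)
    finally show "c j = 0" using G_definite b j by auto
  qed
  then obtain N where N: "inv_mats N (\<lambda>a K. b a K)" ..
  have bvN: "bv K = (\<Sum>a\<in>idx. sc (N K a) (b a))" if K: "K \<in> idx" for K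
  proof
    fix L
    show "bv K L = (\<Sum>a\<in>idx. sc (N K a) (b a)) L"
    proof (cases "L \<in> idx")
      case True
      then show ?thesis using inv_matsD(1)[OF N K True] by (auto simp: sum_fun_apply fun_apply bv_def)
    next
      case False
      then have "b a L = 0" if "a \<in> idx" for a using b(1)[OF that] by (simp add: valid_vec_def)
      then show ?thesis using False K by (auto simp: sum_fun_apply fun_apply bv_def)
    qed
  qed
  have "g w (bv K) = 0" if "K \<in> idx" for K
    unfolding bvN[OF that] bil_sum_right using w(2) by simp
  then have "g w (\<Sum>a\<in>idx. sc (w a) (bv a)) = 0" unfolding bil_sum_right by simp
  then have "g w w = 0" using valid_vec_eq_sum[OF w(1)] by simp
  then show ?thesis using G_definite w(1) by blast
qed

text \<open>I is a skew isometry, so if b is orthogonal to a and a to I b, the vectors a, I a, b, I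
  b are mutually orthogonal and fill the space.\<close>

lemma orth_complete2:
  assumes v: "valid_vec a" "valid_vec b" "a \<noteq> 0" "b \<noteq> 0" and o: "g a b = 0" "g a (II b) = 0"
    and w: "valid_vec w" "g w a = 0" "g w (II a) = 0" "g w b = 0" "g w (II b) = 0"
  shows "w = 0"
proof (rule orth_complete[where b = "\<lambda>i. if i = 1 then a else if i = 2 then II a else if i = 3 then b else II b"])
  have nz: "II x \<noteq> 0" if "valid_vec x" "x \<noteq> 0" for x
  proof
    assume "II x = 0"
    moreover have "g (II x) (II x) = g x x" using compat that(1) by blast
    ultimately have "g x x = 0" by (simp add: bil_def fun_apply)
    then show False using G_definite that by blast
  qed
  have o': "g b a = 0" "g (II b) a = 0" "g (II a) b = 0" "g b (II a) = 0" "g (II a) (II b) = 0" "g (II b) (II a) = 0"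
  proof -
    show 1: "g b a = 0" using o(1) bil_G_sym[of b a] by simp
    show 2: "g (II a) b = 0" using o(2) G_skew[OF v(1,2)] by simp
    show 3: "g b (II a) = 0" using 2 bil_G_sym[of b "II a"] by simp
    show 4: "g (II b) a = 0" using 3 G_skew[OF v(2,1)] by simp
    have "g (II a) (II b) = g a b" using compat v(1,2) by blast
    then show 5: "g (II a) (II b) = 0" using o(1) by simp
    show 6: "g (II b) (II a) = 0" using 5 bil_G_sym[of "II b" "II a"] by simp
  qed
  fix i :: nat assume "i \<in> idx"
  then show "valid_vec (if i = 1 then a else if i = 2 then II a else if i = 3 then b else II b)"
    "(if i = 1 then a else if i = 2 then II a else if i = 3 then b else II b) \<noteq> 0"
    "g w (if i = 1 then a else if i = 2 then II a else if i = 3 then b else II b) = 0"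
    using v nz w by (auto simp: valid_vec_mvec)
  fix j :: nat assume "j \<in> idx" "i \<noteq> j"
  then show "g (if i = 1 then a else if i = 2 then II a else if i = 3 then b else II b)
     (if j = 1 then a else if j = 2 then II a else if j = 3 then b else II b) = 0"
    using \<open>i \<in> idx\<close> o o' g_I_self[OF v(1)] g_I_self[OF v(2)] bil_G_sym[of "II a" a] bil_G_sym[of "II b" b]
    by (auto simp: idx_set)
qed (rule w)

end

text \<open>\<open>psi_inv\<close> is the (1,1) condition on the polarization, restated as
  invariance of the real bilinear form under I.\<close>

locale polarized = metric +
  fixes psi :: "int mat"
  assumes G_rat': "\<forall>I\<in>idx. \<forall>J\<in>idx. G I J \<in> \<rat>"
    and psi_anti: "\<forall>I\<in>idx. \<forall>J\<in>idx. psi I J = - psi J I"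
    and psi_inv: "\<And>u v. valid_vec u \<Longrightarrow> valid_vec v \<Longrightarrow>
       bil (\<lambda>I J. real_of_int (psi I J)) (mvec Icx u) (mvec Icx v) = bil (\<lambda>I J. real_of_int (psi I J)) u v"
    and psi_pos: "\<forall>u. valid_vec u \<and> u \<noteq> (\<lambda>_. 0) \<longrightarrow> bil (\<lambda>I J. real_of_int (psi I J)) (mvec Icx u) u > 0"
begin

abbreviation "ps \<equiv> bil (\<lambda>I J. real_of_int (psi I J))"

lemma ps_anti: "ps u v = - ps v u"
proof -
  have "ps u v = (- 1) * ps v u"
  proof (rule bil_transpose)
    fix I J assume "I \<in> idx" "J \<in> idx"
    then have "psi I J = - psi J I" using psi_anti by blast
    then have "real_of_int (psi I J) = real_of_int (- psi J I)" by (rule arg_cong)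
    then show "real_of_int (psi I J) = (- 1) * real_of_int (psi J I)" by simp
  qed
  then show ?thesis by simp
qed

lemma A_exists: "\<exists>A :: rat mat. \<forall>u v. g u (mvec (\<lambda>I J. real_of_rat (A I J)) v) = ps u v"
proof -
  define Gq where "Gq I J = (SOME r. real_of_rat r = G I J)" for I J
  have Gq: "real_of_rat (Gq I J) = G I J" if "I \<in> idx" "J \<in> idx" for I J
  proof -
    have "\<exists>r. real_of_rat r = G I J" using G_rat' that by (metis Rats_cases)
    then show ?thesis unfolding Gq_def by (rule someI_ex)
  qed
  have "\<exists>N. inv_mats N Gq"
  proof (rule inv_mats_exists, intro allI impI ballI)
    fix c a assume c: "\<forall>K\<in>idx. (\<Sum>a\<in>idx. c a * Gq a K) = 0" and a: "a \<in> idx"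
    let ?v = "\<lambda>a. if a \<in> idx then real_of_rat (c a) else 0"
    have "iota2 ?v G K = 0" if "K \<in> idx" for K
    proof -
      have "iota2 ?v G K = (\<Sum>a\<in>idx. real_of_rat (c a) * real_of_rat (Gq a K))"
        using that by (simp add: iota2_def Gq)
      also have "\<dots> = real_of_rat (\<Sum>a\<in>idx. c a * Gq a K)" by (simp add: of_rat_sum of_rat_mult)
      finally show ?thesis using c that by simp
    qed
    then have "g ?v ?v = 0" unfolding bil_iota2 by simp
    then have "?v = 0" by (intro G_definite) (auto simp: valid_vec_def)
    from fun_cong[OF this, of a] a show "c a = 0" by (simp add: fun_apply)
  qed
  then obtain N where N: "inv_mats N Gq" ..
  define A where "A I J = (\<Sum>L\<in>idx. N I L * of_int (psi L J))" for I J
  have GA: "(\<Sum>J\<in>idx. G I J * real_of_rat (A J K)) = real_of_int (psi I K)" if "I \<in> idx" "K \<in> idx" for I K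
  proof -
    have "(\<Sum>J\<in>idx. Gq I J * A J K) = (\<Sum>L\<in>idx. (\<Sum>J\<in>idx. Gq I J * N J L) * of_int (psi L K))"
      unfolding A_def sum_distrib_left sum_distrib_right by (subst sum.swap) (simp add: mult.assoc)
    also have "\<dots> = (\<Sum>L\<in>idx. of_int (psi L K) * (if I = L then 1 else 0))"
      by (intro sum.cong refl) (simp add: inv_matsD(2)[OF N] that)
    also have "\<dots> = of_int (psi I K)" using that by (simp only: sum_delta_idx)
    finally have "real_of_rat (\<Sum>J\<in>idx. Gq I J * A J K) = real_of_int (psi I K)" by simp
    then show ?thesis using that by (simp add: of_rat_sum of_rat_mult Gq)
  qed
  have "g u (mvec (\<lambda>I J. real_of_rat (A I J)) v) = ps u v" for u v
  proof -
    have "(\<Sum>J\<in>idx. G I J * mvec (\<lambda>I J. real_of_rat (A I J)) v J) = (\<Sum>K\<in>idx. real_of_int (psi I K) * v K)" if I: "I \<in> idx" for I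
    proof -
      have "(\<Sum>J\<in>idx. G I J * mvec (\<lambda>I J. real_of_rat (A I J)) v J) = (\<Sum>J\<in>idx. \<Sum>K\<in>idx. G I J * real_of_rat (A J K) * v K)"
        by (intro sum.cong refl) (simp add: mvec_def sum_distrib_left mult.assoc)
      also have "\<dots> = (\<Sum>K\<in>idx. (\<Sum>J\<in>idx. G I J * real_of_rat (A J K)) * v K)"
        unfolding sum_distrib_right by (rule sum.swap)
      also have "\<dots> = (\<Sum>K\<in>idx. real_of_int (psi I K) * v K)"
        by (intro sum.cong refl) (simp add: GA I)
      finally show ?thesis .
    qed
    then show ?thesis by (simp add: bil_right)
  qed
  then show ?thesis by blast
qed

end

abbreviation rmat :: "rat mat \<Rightarrow> real mat" where
  "rmat T \<equiv> \<lambda>I J. real_of_rat (T I J)"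

context polarized begin

lemma psi_skew: assumes "valid_vec u" "valid_vec v" shows "ps u (II v) = - ps (II u) v"
proof -
  have "ps (II u) (II (II v)) = ps u (II v)" by (rule psi_inv[OF assms(1) valid_vec_mvec])
  then show ?thesis by (simp add: I_I assms(2) bil_sc_right del: sc.scale_minus_left sc.scale_one)
qed

lemma g_cancel:
  assumes "valid_vec x" "valid_vec y" "\<And>w. valid_vec w \<Longrightarrow> g w x = g w y" shows "x = y"
proof -
  let ?w = "x + sc (-1) y"
  have v: "valid_vec ?w" by (intro valid_vec_add valid_vec_sc assms)
  have "g ?w ?w = g ?w x + (-1) * g ?w y" by (simp only: bil_add_right bil_sc_right)
  then have "g ?w ?w = 0" using assms(3)[OF v] by simp
  then have "?w = 0" using G_definite v by blast
  from fun_cong[OF this] show ?thesis by (simp add: fun_eq_iff fun_apply)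
qed

text \<open>\<open>T\<close> acts as m I and n I on the orthogonal complex lines spanned by a and b,
  written over the reals. Its complex eigenvalues are therefore i m, -i m, i n, -i n.\<close>

definition eigenpair :: "rat mat \<Rightarrow> real vec \<Rightarrow> real vec \<Rightarrow> real \<Rightarrow> real \<Rightarrow> bool" where
  "eigenpair T a b m n \<longleftrightarrow> valid_vec a \<and> valid_vec b \<and> a \<noteq> 0 \<and> b \<noteq> 0 \<and> g a b = 0 \<and> g a (II b) = 0
     \<and> mvec (rmat T) a = sc m (II a) \<and> mvec (rmat T) (II a) = sc (- m) a
     \<and> mvec (rmat T) b = sc n (II b) \<and> mvec (rmat T) (II b) = sc (- n) b"

text \<open>S = - I A is symmetric for G, commutes with I, and is positive because the polarization
  is; and A = I S. An eigenvector of S with eigenvalue l thus spans a complex line on which A is l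
  I. If some u is not an eigenvector of S, two different eigenvalues arise in the real plane of u
  and S u. Otherwise every vector is an eigenvector, and the rational vector e_1 may be
  chosen.\<close>

lemma eigenpair_exists: "\<exists>T a b m n. eigenpair T a b m n \<and> m \<noteq> n \<and> m > 0 \<and> n > 0"
proof -
  obtain T :: "rat mat" where T: "\<And>u v. g u (mvec (rmat T) v) = ps u v" using A_exists by blast
  define A where "A = mvec (rmat T)"
  have gA: "g u (A v) = ps u v" for u v by (simp add: A_def T)
  have vA: "valid_vec (A u)" for u by (simp add: A_def valid_vec_mvec)
  note vI = valid_vec_mvec[of Icx]
  have A_add: "A (u + v) = A u + A v" and A_sc: "A (sc c u) = sc c (A u)" for u v c
    by (simp_all add: A_def mvec_add mvec_sc)
  have A_skew: "g (A u) v = - g u (A v)" for u v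
    using bil_G_sym[of "A u" v] ps_anti[of v u] by (simp add: gA)
  have AI: "A (II v) = II (A v)" if v: "valid_vec v" for v
  proof (rule g_cancel[OF vA vI])
    fix w :: "real vec" assume w: "valid_vec w"
    have "g w (A (II v)) = - g (II w) (A v)" using psi_skew[OF w v] by (simp add: gA)
    also have "\<dots> = g w (II (A v))" using G_skew[OF w vA] by simp
    finally show "g w (A (II v)) = g w (II (A v))" .
  qed
  define S where "S u = sc (-1) (II (A u))" for u
  have vS: "valid_vec (S u)" for u unfolding S_def by (intro valid_vec_sc vI)
  have S_add: "S (u + v) = S u + S v" and S_sc: "S (sc c u) = sc c (S u)" for u v c
    unfolding S_def A_add A_sc mvec_add mvec_sc by (simp_all only: sc.scale_right_distrib sc.scale_left_commute)
  have A_S: "A u = II (S u)" for u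
  proof -
    have "II (S u) = sc (-1) (sc (-1) (A u))" unfolding S_def mvec_sc I_I[OF vA] ..
    then show ?thesis by simp
  qed
  have SI: "S (II v) = II (S v)" if "valid_vec v" for v
    unfolding S_def AI[OF that] mvec_sc ..
  have S_sym: "g (S u) v = g u (S v)" if u: "valid_vec u" and v: "valid_vec v" for u v
  proof -
    have "g (S u) v = - g (II (A u)) v" by (simp only: S_def bil_sc_left)
    also have "\<dots> = g (A u) (II v)" using G_skew[OF vA v] by simp
    also have "\<dots> = - g u (A (II v))" by (rule A_skew)
    also have "\<dots> = g u (S v)" unfolding AI[OF v] S_def bil_sc_right by simp
    finally show ?thesis .
  qed
  have S_pos: "g (S u) u > 0" if u: "valid_vec u" "u \<noteq> 0" for u
  proof -
    have "g (S u) u = - g (II (A u)) u" by (simp only: S_def bil_sc_left)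
    also have "\<dots> = g (A u) (II u)" using G_skew[OF vA u(1)] by simp
    also have "\<dots> = ps (II u) u" using bil_G_sym[of "A u"] by (simp add: gA)
    finally show ?thesis using psi_pos u by (simp add: zero_fun_def)
  qed
  have SI0: "g (S u) (II u) = 0" if u: "valid_vec u" for u
  proof -
    have "g (S u) (II u) = g u (II (S u))" using S_sym[OF u vI] SI[OF u] by simp
    also have "\<dots> = - g (II u) (S u)" using G_skew[OF u vS] by simp
    also have "\<dots> = - g (S u) (II u)" using bil_G_sym by simp
    finally show ?thesis by simp
  qed
  have gpos: "g u u > 0" if "valid_vec u" "u \<noteq> 0" for u using G_pos that by (simp add: zero_fun_def)
  have ev_pos: "l > 0" if "S a = sc l a" "valid_vec a" "a \<noteq> 0" for l a
    using S_pos[OF that(2,3)] gpos[OF that(2,3)] unfolding that(1) bil_sc_left by (simp add: zero_less_mult_iff)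
  have pairA: "eigenpair T a b l1 l2"
    if ab: "valid_vec a" "valid_vec b" "a \<noteq> 0" "b \<noteq> 0" "g a b = 0" "g a (II b) = 0"
      and S: "S a = sc l1 a" "S b = sc l2 b" for a b l1 l2
  proof -
    have "A a = sc l1 (II a)" "A b = sc l2 (II b)" unfolding A_S S mvec_sc by simp_all
    moreover have "A (II a) = sc (- l1) a" "A (II b) = sc (- l2) b"
      unfolding A_S SI[OF ab(1)] SI[OF ab(2)] S mvec_sc I_I[OF ab(1)] I_I[OF ab(2)] by simp_all
    ultimately show ?thesis using ab by (simp add: eigenpair_def A_def)
  qed
  show ?thesis
  proof (cases "\<exists>u. valid_vec u \<and> (\<forall>c. S u \<noteq> sc c u)")
    case True
    then obtain u where u: "valid_vec u" "\<And>c. S u \<noteq> sc c u" by blast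
    have u0: "u \<noteq> 0" using u(2)[of 0] S_sc[of 0 u] by auto
    define n where "n = g u u"
    have n: "n > 0" using gpos[OF u(1) u0] by (simp add: n_def)
    define q where "q = g (S u) u / n"
    \<comment> \<open>The part of S u orthogonal to u; it is also orthogonal to I u, because both S
      u and u are.\<close>
    define b where "b = S u + sc (- q) u"
    have vb: "valid_vec b" unfolding b_def by (intro valid_vec_add valid_vec_sc vS u)
    have Su: "S u = sc q u + b" by (simp add: b_def)
    have b0: "b \<noteq> 0" using u(2)[of q] Su by auto
    have bu: "g b u = 0" using n by (simp add: b_def bil_add_left bil_sc_left q_def n_def[symmetric] del: sc.scale_minus_left)
    have bIu: "g b (II u) = 0"
      by (simp add: b_def bil_add_left bil_sc_left SI0[OF u(1)] g_I_self[OF u(1)] del: sc.scale_minus_left)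
    have uIb: "g u (II b) = 0"
      using G_skew[OF u(1) vb] bil_G_sym[of "II u" b] bIu by simp
    define N where "N = g b b"
    have N: "N > 0" using gpos[OF vb b0] by (simp add: N_def)
    define h where "h = N / n"
    have h: "h > 0" using n N by (simp add: h_def)
    define r where "r = g (S b) b / N"
    \<comment> \<open>The plane of u and b is S-invariant: S b minus its components is orthogonal to
      u, I u, b and I b. By symmetry of S the component along u is h = G(b, b) / G(u, u), which is
      positive.\<close>
    have Sb: "S b = sc r b + sc h u"
    proof -
      let ?w = "S b + (sc (- r) b + sc (- h) u)"
      have "?w = 0"
      proof (rule orth_complete2[OF u(1) vb u0 b0])
        show "valid_vec ?w" by (intro valid_vec_add valid_vec_sc vS vb u)
        show "g u b = 0" using bu bil_G_sym[of u b] by simp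
        show "g u (II b) = 0" by (rule uIb)
        have "g (S b) u = N" unfolding S_sym[OF vb u(1)] Su bil_add_right bil_sc_right by (simp add: bu N_def)
        then show "g ?w u = 0" unfolding bil_add_left bil_sc_left using n by (simp add: bu h_def n_def[symmetric])
        have "g (S b) (II u) = 0"
          unfolding S_sym[OF vb vI] SI[OF u(1)] Su mvec_add mvec_sc bil_add_right bil_sc_right
          by (simp add: bIu g_I_self[OF vb])
        then show "g ?w (II u) = 0" unfolding bil_add_left bil_sc_left by (simp add: bIu g_I_self[OF u(1)])
        show "g ?w b = 0" unfolding bil_add_left bil_sc_left using N bil_G_sym[of u b] by (simp add: bu r_def N_def[symmetric])
        show "g ?w (II b) = 0" unfolding bil_add_left bil_sc_left by (simp add: SI0[OF vb] g_I_self[OF vb] uIb)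
      qed
      then have "S b = - (sc (- r) b + sc (- h) u)" by (rule eq_neg_iff_add_eq_0[THEN iffD2])
      then show ?thesis by simp
    qed
    \<comment> \<open>The square root of the discriminant of the characteristic equation (l - q)(l -
      r) = h of S on this plane; h > 0 makes it positive, so the two roots differ.\<close>
    define D where "D = sqrt ((q - r)\<^sup>2 + 4 * h)"
    have D2: "D\<^sup>2 = (q - r)\<^sup>2 + 4 * h" unfolding D_def using h by (intro real_sqrt_pow2) (simp add: add_nonneg_nonneg)
    have D0: "D > 0" unfolding D_def using h by (intro real_sqrt_gt_zero) (simp add: add_nonneg_pos)
    \<comment> \<open>An eigenvector for the root l, solved from the coefficient of u; the
      coefficient of b is the characteristic equation.\<close>
    define e where "e l = sc h u + sc (l - q) b" for l
    have ve: "valid_vec (e l)" for l unfolding e_def by (intro valid_vec_add valid_vec_sc u vb)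
    have e0: "e l \<noteq> 0" for l
    proof
      assume "e l = 0"
      then have "g (e l) u = 0" by (simp add: bil_def fun_apply)
      moreover have "g (e l) u = h * n" unfolding e_def bil_add_left bil_sc_left by (simp add: bu n_def)
      ultimately show False using h n by simp
    qed
    have Se: "S (e l) = sc l (e l)" if l: "(l - q) * (l - r) = h" for l
    proof
      fix K
      have "h * (q * x + y) + (l - q) * (r * y + h * x) = l * (h * x + (l - q) * y)" for x y
      proof -
        have "h * (q * x + y) + (l - q) * (r * y + h * x) - l * (h * x + (l - q) * y) = (h - (l - q) * (l - r)) * y"
          by (simp add: algebra_simps)
        then show ?thesis using l by simp
      qed
      then show "S (e l) K = sc l (e l) K"
        unfolding e_def S_add S_sc Su Sb by (simp add: fun_apply)
    qed
    define l1 l2 where "l1 = (q + r + D) / 2" and "l2 = (q + r - D) / 2"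
    have "(l1 - q) * (l1 - r) = h" "(l2 - q) * (l2 - r) = h"
    proof -
      have "4 * ((l1 - q) * (l1 - r)) = D\<^sup>2 - (q - r)\<^sup>2" "4 * ((l2 - q) * (l2 - r)) = D\<^sup>2 - (q - r)\<^sup>2"
        by (simp_all add: l1_def l2_def power2_eq_square field_simps)
      then show "(l1 - q) * (l1 - r) = h" "(l2 - q) * (l2 - r) = h" using D2 by simp_all
    qed
    then have S1: "S (e l1) = sc l1 (e l1)" and S2: "S (e l2) = sc l2 (e l2)" using Se by blast+
    have ne: "l1 \<noteq> l2" using D0 by (simp add: l1_def l2_def)
    have "l1 * g (e l1) (e l2) = l2 * g (e l1) (e l2)"
      using S_sym[OF ve ve, of l1 l2] unfolding S1 S2 bil_sc_left bil_sc_right .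
    then have o1: "g (e l1) (e l2) = 0" using ne by simp
    have "l1 * g (e l1) (II (e l2)) = l2 * g (e l1) (II (e l2))"
      using S_sym[OF ve vI, of l1 "e l2"] unfolding SI[OF ve] S1 S2 mvec_sc bil_sc_left bil_sc_right .
    then have o2: "g (e l1) (II (e l2)) = 0" using ne by simp
    have "eigenpair T (e l1) (e l2) l1 l2" by (rule pairA[OF ve ve e0 e0 o1 o2 S1 S2])
    then show ?thesis using ne ev_pos[OF S1 ve e0] ev_pos[OF S2 ve e0] by blast
  next
    case False
    then have ex: "\<exists>c. S u = sc c u" if "valid_vec u" for u using that by blast
    define a where "a = (bv 1 :: real vec)"
    have i: "1 \<in> idx" "2 \<in> idx" "3 \<in> idx" by (auto simp: idx_def)
    have va: "valid_vec a" by (simp add: a_def valid_vec_bv idx_def)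
    have a0: "a \<noteq> 0"
    proof
      assume "a = 0" from fun_cong[OF this, of 1] show False by (simp add: a_def bv_def fun_apply)
    qed
    define n where "n = g a a"
    have n: "n > 0" using gpos[OF va a0] by (simp add: n_def)
    \<comment> \<open>Orthogonal projection away from the complex line of a.\<close>
    define pr where "pr y = y + (sc (- (g y a / n)) a + sc (- (g y (II a) / n)) (II a))" for y
    have gII: "g (II a) (II a) = n" using compat va by (simp add: n_def)
    have "\<exists>y. valid_vec y \<and> pr y \<noteq> 0"
    proof (rule ccontr)
      assume no: "\<not> (\<exists>y. valid_vec y \<and> pr y \<noteq> 0)"
      have "\<exists>s t. \<forall>K. bv j K = s * a K + t * II a K" if "j \<in> idx" for j
      proof -
        have "pr (bv j) = 0" using no valid_vec_bv[OF that] by blast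
        then have "pr (bv j) K = 0" for K by (simp add: fun_apply)
        then have "bv j K = (g (bv j) a / n) * a K + (g (bv j) (II a) / n) * II a K" for K
          by (simp add: pr_def fun_apply algebra_simps)
        then show ?thesis by blast
      qed
      then obtain s2 t2 s3 t3 where
        2: "\<And>K. bv 2 K = s2 * a K + t2 * II a K" and 3: "\<And>K. bv 3 K = s3 * a K + t3 * II a K"
        using i by metis
      \<comment> \<open>If all projections vanished, e_2 and e_3 would be combinations of a = e_1
        and I a. In the coordinates 2 and 3 only I a contributes, so the 2 by 2 identity matrix
        would have rank one.\<close>
      have "1 = t2 * II a 2" "0 = t2 * II a 3" "0 = t3 * II a 2" "1 = t3 * II a 3"
        using 2[of 2] 2[of 3] 3[of 2] 3[of 3] by (simp_all add: a_def bv_def)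
      then show False by (metis mult_eq_0_iff zero_neq_one)
    qed
    then obtain y where y: "valid_vec y" "pr y \<noteq> 0" by blast
    define b where "b = pr y"
    have vb: "valid_vec b" unfolding b_def pr_def by (intro valid_vec_add valid_vec_sc y va vI)
    have b0: "b \<noteq> 0" using y by (simp add: b_def)
    have ba: "g b a = 0"
      unfolding b_def pr_def bil_add_left bil_sc_left
      using n g_I_self[OF va] bil_G_sym[of "II a" a] by (simp add: n_def[symmetric])
    have bIa: "g b (II a) = 0"
      unfolding b_def pr_def bil_add_left bil_sc_left using n g_I_self[OF va] by (simp add: gII)
    have ab: "g a b = 0" using ba bil_G_sym[of a b] by simp
    have aIb: "g a (II b) = 0" using bIa G_skew[OF va vb] bil_G_sym[of "II a" b] by simp
    obtain l1 l2 where S1: "S a = sc l1 a" and S2: "S b = sc l2 b" using ex va vb by blast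
    have p1: "l1 > 0" and p2: "l2 > 0" using ev_pos[OF S1 va a0] ev_pos[OF S2 vb b0] by auto
    have pa: "eigenpair T a b l1 l2" by (rule pairA[OF va vb a0 b0 ab aIb S1 S2])
    show ?thesis
    proof (cases "l1 = l2")
      case False
      then show ?thesis using pa p1 p2 by blast
    next
      case True
      define l where "l = l1"
      have Aa: "A a = sc l (II a)" "A (II a) = sc (- l) a" "A b = sc l (II b)" "A (II b) = sc (- l) b"
        using pa True by (simp_all add: eigenpair_def A_def l_def)
      \<comment> \<open>A plus the skew operator of rank two sending x to (G(a, x) A a - G(A a, x)
        a) / n. It is rational since a = e_1, doubles A on the line of a, and leaves A unchanged on
        the orthogonal line, so l and l become 2 l and l.\<close>
      define R :: "real mat" where "R K L = real_of_rat (T K L) + (G 1 L * A a K - a K * (\<Sum>M\<in>idx. A a M * G M L)) / n" for K L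
      have Rx: "mvec R x = A x + (sc (g a x / n) (A a) + sc (- (g (A a) x / n)) a)" for x
      proof
        fix K
        show "mvec R x K = (A x + (sc (g a x / n) (A a) + sc (- (g (A a) x / n)) a)) K"
        proof (cases "K \<in> idx")
          case True
          have 1: "(\<Sum>J\<in>idx. G 1 J * x J) = g a x"
            using i(1) by (simp add: a_def bil_right)
          have 2: "(\<Sum>J\<in>idx. (\<Sum>M\<in>idx. A a M * G M J) * x J) = g (A a) x"
            unfolding bil_iota2 by (intro sum.cong refl) (simp add: iota2_def)
          have "mvec R x K = (\<Sum>J\<in>idx. real_of_rat (T K J) * x J) + (A a K / n) * (\<Sum>J\<in>idx. G 1 J * x J)
              - (a K / n) * (\<Sum>J\<in>idx. (\<Sum>M\<in>idx. A a M * G M J) * x J)"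
            using True n unfolding mvec_def R_def sum_distrib_left sum.distrib[symmetric] sum_subtractf[symmetric]
            by (auto intro!: sum.cong simp: field_simps sum_distrib_left)
          then show ?thesis unfolding 1 2 using True by (simp add: A_def mvec_def fun_apply mult.commute)
        next
          case False
          then show ?thesis using vA[of a] vA[of x] va by (simp add: mvec_def fun_apply valid_vec_def)
        qed
      qed
      have AaIa: "g (A a) (II a) = l * n" and Aaa: "g (A a) a = 0" and Aab: "g (A a) b = 0" and AaIb: "g (A a) (II b) = 0"
      proof -
        show "g (A a) (II a) = l * n" unfolding Aa bil_sc_left gII ..
        show "g (A a) a = 0" unfolding Aa bil_sc_left using g_I_self[OF va] bil_G_sym[of "II a" a] by simp
        show "g (A a) b = 0" unfolding Aa bil_sc_left using bIa bil_G_sym[of "II a" b] by simp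
        have "g (II a) (II b) = g a b" using compat va vb by blast
        then show "g (A a) (II b) = 0" unfolding Aa bil_sc_left using ab by simp
      qed
      have Ra: "mvec R a = sc (2 * l) (II a)"
        unfolding Rx Aaa using n by (simp add: n_def[symmetric] Aa fun_eq_iff fun_apply)
      have RIa: "mvec R (II a) = sc (- (2 * l)) a"
        unfolding Rx AaIa g_I_self[OF va] using n by (simp add: Aa(2) fun_eq_iff fun_apply)
      have Rb: "mvec R b = sc l (II b)" unfolding Rx Aab ab using Aa by simp
      have RIb: "mvec R (II b) = sc (- l) b" unfolding Rx AaIb aIb using Aa by simp
      define T' where "T' K L = (SOME x. real_of_rat x = R K L)" for K L
      have T': "real_of_rat (T' K L) = R K L" if "K \<in> idx" "L \<in> idx" for K L
      proof -
        have Aar: "A a M \<in> \<rat>" if "M \<in> idx" for M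
          using that i(1) by (simp add: A_def mvec_def a_def)
        have "n = G 1 1" using i(1) by (simp add: n_def a_def bil_bv)
        then have "n \<in> \<rat>" using G_rat' i(1) by blast
        moreover have "a K \<in> \<rat>" by (simp add: a_def bv_def)
        ultimately have "R K L \<in> \<rat>" unfolding R_def using Aar that G_rat' i(1)
          by (intro Rats_add Rats_divide Rats_diff Rats_mult Rats_sum) auto
        then have "\<exists>x. real_of_rat x = R K L" by (metis Rats_cases)
        then show ?thesis unfolding T'_def by (rule someI_ex)
      qed
      have "mvec (rmat T') x = mvec R x" for x
        by (auto simp: mvec_def fun_eq_iff T')
      then have "eigenpair T' a b (2 * l) l"
        using va vb a0 b0 ab aIb Ra RIa Rb RIb by (simp add: eigenpair_def)
      moreover have "2 * l \<noteq> l" "2 * l > 0" "l > 0" using p1 by (simp_all add: l_def)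
      ultimately show ?thesis by blast
    qed
  qed
qed

end

section \<open>Hodge decomposition by eigenvectors\<close>

text \<open>The eigenvalue of I belonging to an index: the indices 1, 2 carry the (1,0) part, 3 and
  4 the (0,1) part. Hence intersection with \<open>{1, 2}\<close> counts p in a Hodge type.\<close>

definition eps :: "nat \<Rightarrow> complex" where
  "eps i = (if i \<in> {1, 2} then \<i> else - \<i>)"

text \<open>Common eigenvectors \<open>z i\<close> of I and of the rational operator
  \<open>T1\<close>, with the dual covectors \<open>zt i\<close>. Distinctness of the eigenvalues
  \<open>t i\<close> is the simple spectrum from which complex multiplication is built.\<close>

locale eigenframe =
  fixes Icx :: "real mat" and T1 :: "rat mat" and z zt :: "nat \<Rightarrow> complex vec" and t :: "nat \<Rightarrow> complex"
  assumes z_valid: "\<And>i. valid_vec (z i)" and zt_valid: "\<And>i. valid_vec (zt i)"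
    and z_inv: "inv_mats (\<lambda>i K. zt i K) (\<lambda>K i. z i K)"
    and T1_z: "\<And>i K. i \<in> idx \<Longrightarrow> K \<in> idx \<Longrightarrow> (\<Sum>L\<in>idx. of_rat (T1 K L) * z i L) = t i * z i K"
    and I_z: "\<And>i K. i \<in> idx \<Longrightarrow> K \<in> idx \<Longrightarrow> (\<Sum>L\<in>idx. of_real (Icx K L) * z i L) = eps i * z i K"
    and t_inj: "inj_on t idx"

lemma (in polarized) eigenframe_exists: "\<exists>T1 z zt t. eigenframe Icx T1 z zt t"
proof -
  obtain T a b m n where E: "eigenpair T a b m n" and mn: "m \<noteq> n" "m > 0" "n > 0"
    using eigenpair_exists by blast
  have v: "valid_vec a" "valid_vec b" and nz: "a \<noteq> 0" "b \<noteq> 0" and o: "g a b = 0" "g a (II b) = 0"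
    and Ta: "mvec (rmat T) a = sc m (II a)" "mvec (rmat T) (II a) = sc (- m) a"
    and Tb: "mvec (rmat T) b = sc n (II b)" "mvec (rmat T) (II b) = sc (- n) b"
    using E by (auto simp: eigenpair_def)
  \<comment> \<open>Odd indices use the line of a, even ones the line of b. With \<open>sg'\<close>
    negative on 1 and 2, \<open>z i\<close> is x - i I x there and x + i I x on 3 and 4.\<close>
  define x where "x i = (if odd i then a else b)" for i :: nat
  define sg' where "sg' i = (if i \<in> {1, 2} then -1 else 1 :: real)" for i :: nat
  define y where "y i = sc (sg' i) (II (x i))" for i
  define mu where "mu i = (if odd i then m else n)" for i :: nat
  define N where "N i = g (x i) (x i)" for i
  define z where "z i = (\<lambda>K. complex_of_real (x i K) + \<i> * complex_of_real (y i K))" for i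
  \<comment> \<open>The G-dual of the complex conjugate of \<open>z i\<close>, divided by its
    Hermitian norm 2 \<open>N i\<close>.\<close>
  define zt where "zt i = (\<lambda>K. if K \<in> idx then (complex_of_real (\<Sum>L\<in>idx. G K L * x i L)
      - \<i> * complex_of_real (\<Sum>L\<in>idx. G K L * y i L)) / (2 * complex_of_real (N i)) else 0)" for i
  define t where "t i = - complex_of_real (sg' i) * \<i> * complex_of_real (mu i)" for i
  have vx: "valid_vec (x i)" for i using v by (simp add: x_def)
  have vy: "valid_vec (y i)" for i unfolding y_def by (intro valid_vec_sc valid_vec_mvec)
  have sg2: "sg' i * sg' i = 1" for i by (simp add: sg'_def)
  have sgc: "complex_of_real (sg' i) * (complex_of_real (sg' i) * w) = w" for i w
    using sg2[of i] by (simp flip: mult.assoc of_real_mult)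
  have Tx: "mvec (rmat T) (x i) = sc (mu i) (II (x i))" "mvec (rmat T) (II (x i)) = sc (- mu i) (x i)" for i
    using Ta Tb by (auto simp: x_def mu_def)
  have mz: "(\<Sum>L\<in>idx. complex_of_real (M K L) * z i L)
      = complex_of_real (mvec M (x i) K) + \<i> * complex_of_real (sg' i * mvec M (II (x i)) K)" if "K \<in> idx" for M K i
    using that by (simp add: z_def y_def mvec_def fun_apply distrib_left sum.distrib sum_distrib_left mult.left_commute)
  have gx: "g (x i) (II (x j)) = 0" for i j
  proof -
    have "g b (II a) = 0" using o(2) G_skew[OF v] bil_G_sym[of b "II a"] by simp
    then show ?thesis using o g_I_self v by (simp add: x_def)
  qed
  have gxx: "g (x i) (x j) = (if odd i = odd j then N i else 0)" for i j
    using o(1) bil_G_sym[of b a] by (auto simp: x_def N_def)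
  have Npos: "N i > 0" for i using G_pos v nz by (auto simp: N_def x_def zero_fun_def)
  have pair: "(\<Sum>K\<in>idx. zt i K * z j K) = (if i = j then 1 else 0)" if ij: "i \<in> idx" "j \<in> idx" for i j
  proof -
    have gyy: "g (y j) (y i) = sg' i * sg' j * g (x j) (x i)"
      using compat vx by (simp add: y_def bil_sc_left bil_sc_right)
    have gxy: "g (x j) (y i) = 0" "g (y j) (x i) = 0"
      using gx bil_G_sym[of "II (x j)" "x i"] by (simp_all add: y_def bil_sc_left bil_sc_right)
    have "(\<Sum>K\<in>idx. zt i K * z j K) = (\<Sum>K\<in>idx.
        (complex_of_real (x j K * (\<Sum>L\<in>idx. G K L * x i L)) + complex_of_real (y j K * (\<Sum>L\<in>idx. G K L * y i L))
         + \<i> * (complex_of_real (y j K * (\<Sum>L\<in>idx. G K L * x i L)) - complex_of_real (x j K * (\<Sum>L\<in>idx. G K L * y i L))))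
        / (2 * complex_of_real (N i)))"
      by (intro sum.cong refl) (simp add: zt_def z_def algebra_simps add_divide_distrib diff_divide_distrib del: of_real_sum)
    also have "\<dots> = (complex_of_real (g (x j) (x i)) + complex_of_real (g (y j) (y i))
         + \<i> * (complex_of_real (g (y j) (x i)) - complex_of_real (g (x j) (y i)))) / (2 * complex_of_real (N i))"
      unfolding bil_right of_real_sum sum_divide_distrib[symmetric]
      by (simp add: sum.distrib sum_subtractf sum_distrib_left[symmetric] del: of_real_sum)
    also have "\<dots> = complex_of_real (g (x j) (x i) * (1 + sg' i * sg' j) / (2 * N i))"
      by (simp add: gyy gxy algebra_simps)
    also have "g (x j) (x i) * (1 + sg' i * sg' j) / (2 * N i) = (if i = j then 1 else 0)"
    proof -
      have "g (x j) (x i) = (if odd i = odd j then N i else 0)" using gxx[of i j] bil_G_sym[of "x j" "x i"] by simp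
      then show ?thesis using ij Npos[of i] unfolding sg'_def idx_set by (elim insertE emptyE) simp_all
    qed
    finally show ?thesis by simp
  qed
  have "eigenframe Icx T z zt t"
  proof
    show "valid_vec (z i)" "valid_vec (zt i)" for i
      using vx[of i] vy[of i] by (simp_all add: z_def zt_def valid_vec_def)
    show "inv_mats (\<lambda>i K. zt i K) (\<lambda>K i. z i K)" by (rule inv_mats_one_sided) (rule pair)
    show "(\<Sum>L\<in>idx. of_rat (T K L) * z i L) = t i * z i K" if "i \<in> idx" "K \<in> idx" for i K
      using mz[OF that(2), of "rmat T" i] unfolding Tx
      by (simp add: of_real_of_rat t_def z_def y_def fun_apply algebra_simps sgc)
    show "(\<Sum>L\<in>idx. of_real (Icx K L) * z i L) = eps i * z i K" if "i \<in> idx" "K \<in> idx" for i K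
    proof -
      have e: "eps i = - complex_of_real (sg' i) * \<i>" by (simp add: eps_def sg'_def)
      show ?thesis using mz[OF that(2), of Icx i] unfolding I_I[OF vx] e
        by (simp add: z_def y_def fun_apply algebra_simps sgc)
    qed
    have "t 1 = \<i> * m" "t 2 = \<i> * n" "t 3 = - \<i> * m" "t 4 = - \<i> * n"
      by (simp_all add: t_def sg'_def mu_def)
    then show "inj_on t idx" using mn
      by (auto simp: inj_on_def idx_set complex_eq_iff)
  qed
  then show ?thesis by blast
qed

section \<open>Derivations and wedge products of eigencovectors\<close>

lemma Der_cr0:
  assumes "valid_form \<phi>" "k \<in> idx"
  shows "Der X (cr0 k \<phi>) = (\<Sum>j\<in>idx. sc (X k j) (cr0 j \<phi>)) + cr0 k (Der X \<phi>)"
proof -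
  have "cr0 j (an0 i (cr0 k \<phi>)) = sc (bv k i) (cr0 j \<phi>) + cr0 k (cr0 j (an0 i \<phi>))" if ij: "i \<in> idx" "j \<in> idx" for i j
  proof -
    have "an0 i (cr0 k \<phi>) = sc (bv k i) \<phi> - cr0 k (an0 i \<phi>)"
      using an0_cr0[OF assms(1) ij(1) assms(2)] by (auto simp: bv_def eq_diff_eq)
    moreover have "cr0 j (cr0 k (an0 i \<phi>)) = - cr0 k (cr0 j (an0 i \<phi>))"
      using cr0_cr0[of j k "an0 i \<phi>"] by (simp add: eq_neg_iff_add_eq_0)
    ultimately show ?thesis by (simp add: lin_diff[OF lin_cr0] lin_sc[OF lin_cr0])
  qed
  then have "Der X (cr0 k \<phi>) = (\<Sum>i\<in>idx. \<Sum>j\<in>idx. sc (X i j * bv k i) (cr0 j \<phi>)) + (\<Sum>i\<in>idx. \<Sum>j\<in>idx. sc (X i j) (cr0 k (cr0 j (an0 i \<phi>))))"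
    unfolding Der_def sum.distrib[symmetric] by (intro sum.cong refl) (simp add: sc.scale_right_distrib)
  also have "(\<Sum>i\<in>idx. \<Sum>j\<in>idx. sc (X i j * bv k i) (cr0 j \<phi>)) = (\<Sum>j\<in>idx. sc (\<Sum>i\<in>idx. X i j * bv k i) (cr0 j \<phi>))"
    unfolding sc.scale_sum_left by (rule sum.swap)
  also have "\<dots> = (\<Sum>j\<in>idx. sc (X k j) (cr0 j \<phi>))" using assms(2) by simp
  also have "(\<Sum>i\<in>idx. \<Sum>j\<in>idx. sc (X i j) (cr0 k (cr0 j (an0 i \<phi>)))) = cr0 k (Der X \<phi>)"
    by (simp add: Der_def lin_sum[OF lin_cr0] lin_sc[OF lin_cr0])
  finally show ?thesis .
qed

lemma Der_ext1:
  assumes "valid_form \<phi>" "\<And>L. L \<in> idx \<Longrightarrow> (\<Sum>K\<in>idx. \<xi> K * X K L) = e * \<xi> L"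
  shows "Der X (ext1 \<xi> \<phi>) = sc e (ext1 \<xi> \<phi>) + ext1 \<xi> (Der X \<phi>)"
proof -
  have "Der X (ext1 \<xi> \<phi>) = (\<Sum>k\<in>idx. \<Sum>j\<in>idx. sc (\<xi> k * X k j) (cr0 j \<phi>)) + (\<Sum>k\<in>idx. sc (\<xi> k) (cr0 k (Der X \<phi>)))"
    unfolding ext1_def lin_sum[OF lin_Der] lin_sc[OF lin_Der] sum.distrib[symmetric]
    by (intro sum.cong refl) (simp add: Der_cr0 assms(1) sc.scale_right_distrib sc.scale_sum_right)
  also have "(\<Sum>k\<in>idx. \<Sum>j\<in>idx. sc (\<xi> k * X k j) (cr0 j \<phi>)) = (\<Sum>j\<in>idx. sc (\<Sum>k\<in>idx. \<xi> k * X k j) (cr0 j \<phi>))"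
    unfolding sc.scale_sum_left by (rule sum.swap)
  also have "\<dots> = sc e (ext1 \<xi> \<phi>)"
    by (simp add: assms(2) ext1_def sc.scale_sum_right)
  finally show ?thesis by (simp add: ext1_def)
qed

lemma Der_unit: "Der X unit_form = 0"
  unfolding Der_def unit_form_dl by (intro sum.neutral ballI) (simp add: an0_dl lin_0[OF lin_cr0])

lemma valid_ext1: "valid_form (ext1 \<xi> \<phi>)"
  using valid_cl[of "(0, \<xi>)"] by (simp add: cl_ext1)

lemma lin_ext1: "lin (ext1 \<xi>)"
  using lin_cl[of "(0, \<xi>)"] by (simp add: cl_ext1)

lemma Kf_ext1:
  assumes "\<phi> \<in> Kf UNIV {k}" shows "ext1 \<xi> \<phi> \<in> Kf UNIV {Suc k}"
  using Kf_cr0[OF qclosed_UNIV assms] unfolding ext1_def by (intro Kf_sum Kf_sc qclosed_UNIV) auto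

context eigenframe begin

text \<open>X is the sum of e j times the rank-one operator of \<open>z j\<close> and
  \<open>zt j\<close>, so the dual basis consists of left eigenvectors for the same
  eigenvalues.\<close>

lemma eigen_dual:
  assumes X: "\<And>i K. i \<in> idx \<Longrightarrow> K \<in> idx \<Longrightarrow> (\<Sum>L\<in>idx. X K L * z i L) = e i * z i K"
    and iL: "i \<in> idx" "L \<in> idx"
  shows "(\<Sum>K\<in>idx. zt i K * X K L) = e i * zt i L"
proof -
  have d: "X K L = (\<Sum>j\<in>idx. e j * z j K * zt j L)" if K: "K \<in> idx" for K
  proof -
    have "(\<Sum>j\<in>idx. e j * z j K * zt j L) = (\<Sum>j\<in>idx. \<Sum>M\<in>idx. X K M * (z j M * zt j L))"
      by (intro sum.cong refl) (simp add: X[symmetric] K sum_distrib_right mult.assoc)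
    also have "\<dots> = (\<Sum>M\<in>idx. X K M * (\<Sum>j\<in>idx. z j M * zt j L))"
      unfolding sum_distrib_left by (rule sum.swap)
    also have "\<dots> = (\<Sum>M\<in>idx. X K M * (if M = L then 1 else 0))"
      by (intro sum.cong refl) (simp add: inv_matsD(2)[OF z_inv] iL)
    also have "\<dots> = X K L" using iL by (simp only: sum_delta_idx)
    finally show ?thesis by simp
  qed
  have "(\<Sum>K\<in>idx. zt i K * X K L) = (\<Sum>K\<in>idx. \<Sum>j\<in>idx. e j * zt j L * (zt i K * z j K))"
    by (intro sum.cong refl) (simp add: d sum_distrib_left algebra_simps)
  also have "\<dots> = (\<Sum>j\<in>idx. e j * zt j L * (\<Sum>K\<in>idx. zt i K * z j K))"
    unfolding sum_distrib_left by (rule sum.swap)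
  also have "\<dots> = (\<Sum>j\<in>idx. e j * zt j L * (if i = j then 1 else 0))"
    by (intro sum.cong refl) (simp add: inv_matsD(1)[OF z_inv] iL)
  also have "\<dots> = e i * zt i L" using iL by (simp only: sum_delta_idx)
  finally show ?thesis .
qed

lemma cframe_Z: "cframe (\<lambda>i. (0, zt i)) (\<lambda>i. (z i, 0)) (unit_form :: complex form)"
proof -
  have "lc (zt i) (\<lambda>i. (0, bv i)) = (0, zt i)" "lc (\<lambda>a. z i a) (\<lambda>i. (bv i, 0)) = (z i, 0)" for i
    using z_valid[of i] zt_valid[of i] by (auto simp: lc_def sum_sc_bv_idx valid_vec_def fun_eq_iff)
  with cframe_change'[OF cframe_std z_inv] show ?thesis by simp
qed

sublocale Z: cframe "\<lambda>i. (0, zt i)" "\<lambda>i. (z i, 0)" "unit_form :: complex form"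
  by (rule cframe_Z)

lemma Z_st_insert:
  "a \<in> idx \<Longrightarrow> S \<subseteq> idx \<Longrightarrow> a \<notin> S \<Longrightarrow> Z.st (insert a S) = sc (sg a S) (ext1 (zt a) (Z.st S))"
  using Z.st_insert[of a S] by (simp add: cl_ext1)

lemma Z_st_Kf: assumes "S \<subseteq> idx" shows "Z.st S \<in> Kf UNIV {card S}"
  using finite_subset_idx[OF assms] assms
proof (induction S rule: finite_induct)
  case empty
  have "Z.st {} = dl {}" using Z.st_empty unit_form_dl by (rule trans)
  then show ?case using Kf_dl[OF qclosed_UNIV, of "{}"] by simp
next
  case (insert a S)
  then have "ext1 (zt a) (Z.st S) \<in> Kf UNIV {Suc (card S)}" by (intro Kf_ext1) auto
  then show ?case using insert by (simp add: Z_st_insert Kf_sc qclosed_UNIV)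
qed

lemma Z_Psi_Kf: assumes "\<psi> \<in> Kf UNIV D" shows "Z.Psi \<psi> \<in> Kf UNIV D"
  unfolding Z.Psi_def
proof (rule Kf_sum[OF qclosed_UNIV])
  fix S assume S: "S \<in> Pow idx"
  show "sc (\<psi> S) (Z.st S) \<in> Kf UNIV D"
  proof (cases "\<psi> S = 0")
    case True then show ?thesis by (simp add: Kf_0 qclosed_UNIV)
  next
    case False
    then have "Kf UNIV {card S} \<subseteq> Kf UNIV D" using assms by (intro Kf_mono) (auto simp: Kf_def)
    then show ?thesis using Z_st_Kf[of S] S by (intro Kf_sc qclosed_UNIV) auto
  qed
qed

text \<open>dX^a is the combination of the \<open>zt b\<close> with coefficients
  \<open>z b a\<close>, so creating dX^a is a combination of creations of eigencovectors and raises
  the degree by one.\<close>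

lemma Z_Psi_surj: assumes "\<phi> \<in> Kf UNIV D" shows "\<exists>\<psi>\<in>Kf UNIV D. \<phi> = Z.Psi \<psi>"
proof -
  have dls: "\<exists>\<psi>\<in>Kf UNIV {card S}. dl S = Z.Psi \<psi>" if "S \<subseteq> idx" for S
    using finite_subset_idx[OF that] that
  proof (induction S rule: finite_induct)
    case empty
    have "Z.Psi (dl {}) = dl {}"
      unfolding Z.Psi_dl[OF empty_subsetI] Z.st_empty by (rule unit_form_dl)
    then show ?case using Kf_dl[OF qclosed_UNIV, of "{}"] by (metis empty_subsetI)
  next
    case (insert a S)
    then obtain \<psi> where \<psi>: "\<psi> \<in> Kf UNIV {card S}" "dl S = Z.Psi \<psi>" by auto
    let ?\<psi> = "sc (sg a S) (\<Sum>b\<in>idx. sc (z b a) (cr0 b \<psi>))"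
    have "cr0 a (Z.Psi \<psi>) = (\<Sum>b\<in>idx. sc (z b a) (cl (0, zt b) (Z.Psi \<psi>)))"
      using Z.cl_comp[of "(0, bv a)" "Z.Psi \<psi>"] insert.prems by (simp add: cl_cr0 qf_bil zero_fun_apply)
    also have "\<dots> = Z.Psi (\<Sum>b\<in>idx. sc (z b a) (cr0 b \<psi>))"
      using \<psi>(1) by (simp add: lin_sum[OF Z.lin_Psi] lin_sc[OF Z.lin_Psi] Z.Psi_cr0 Kf_valid)
    finally have c: "cr0 a (Z.Psi \<psi>) = Z.Psi (\<Sum>b\<in>idx. sc (z b a) (cr0 b \<psi>))" .
    have "dl (insert a S) = sc (sg a S) (cr0 a (dl S :: complex form))"
      using insert by (simp add: cr0_dl sg_sq)
    also have "\<dots> = Z.Psi ?\<psi>" unfolding \<psi>(2) c lin_sc[OF Z.lin_Psi] ..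
    finally have "dl (insert a S) = Z.Psi ?\<psi>" .
    moreover have "?\<psi> \<in> Kf UNIV {card (insert a S)}"
      using insert Kf_cr0[OF qclosed_UNIV \<psi>(1)] by (intro Kf_sc Kf_sum qclosed_UNIV) auto
    ultimately show ?case by blast
  qed
  then obtain h where h: "\<And>S. S \<subseteq> idx \<Longrightarrow> h S \<in> Kf UNIV {card S} \<and> dl S = Z.Psi (h S)" by metis
  let ?\<psi> = "\<Sum>S\<in>Pow idx. sc (\<phi> S) (h S)"
  have "\<phi> = (\<Sum>S\<in>Pow idx. sc (\<phi> S) (dl S))" using assms by (intro form_decomp Kf_valid)
  also have "\<dots> = (\<Sum>S\<in>Pow idx. sc (\<phi> S) (Z.Psi (h S)))" by (intro sum.cong refl) (use h in auto)
  also have "\<dots> = Z.Psi ?\<psi>" by (simp add: lin_sum[OF Z.lin_Psi] lin_sc[OF Z.lin_Psi])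
  finally have "\<phi> = Z.Psi ?\<psi>" .
  moreover have "?\<psi> \<in> Kf UNIV D"
  proof (rule Kf_sum[OF qclosed_UNIV])
    fix S assume S: "S \<in> Pow idx"
    show "sc (\<phi> S) (h S) \<in> Kf UNIV D"
    proof (cases "\<phi> S = 0")
      case True then show ?thesis by (simp add: Kf_0 qclosed_UNIV)
    next
      case False
      then have "Kf UNIV {card S} \<subseteq> Kf UNIV D" using assms by (intro Kf_mono) (auto simp: Kf_def)
      then show ?thesis using h[of S] S by (intro Kf_sc qclosed_UNIV) auto
    qed
  qed
  ultimately show ?thesis by blast
qed

lemma Der_Z_st:
  assumes X: "\<And>i L. i \<in> idx \<Longrightarrow> L \<in> idx \<Longrightarrow> (\<Sum>K\<in>idx. zt i K * X K L) = e i * zt i L" and "S \<subseteq> idx"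
  shows "Der X (Z.st S) = sc (\<Sum>i\<in>S. e i) (Z.st S)"
  using finite_subset_idx[OF assms(2)] assms(2)
proof (induction S rule: finite_induct)
  case empty
  show ?case unfolding Z.st_empty Der_unit by simp
next
  case (insert a S)
  have "Der X (ext1 (zt a) (Z.st S)) = sc (e a) (ext1 (zt a) (Z.st S)) + ext1 (zt a) (Der X (Z.st S))"
    using insert.prems X by (intro Der_ext1 Z.valid_st) auto
  also have "\<dots> = sc (e a + (\<Sum>i\<in>S. e i)) (ext1 (zt a) (Z.st S))"
    using insert by (simp add: lin_sc[OF lin_ext1] sc.scale_left_distrib)
  finally show ?case
    using insert by (simp add: Z_st_insert lin_sc[OF lin_Der] sc.scale_left_commute)
qed

lemma Der_Z_Psi:
  assumes X: "\<And>i L. i \<in> idx \<Longrightarrow> L \<in> idx \<Longrightarrow> (\<Sum>K\<in>idx. zt i K * X K L) = e i * zt i L"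
  shows "Der X (Z.Psi \<psi>) = Z.Psi (\<lambda>S. (\<Sum>i\<in>S. e i) * \<psi> S)"
  unfolding Z.Psi_def lin_sum[OF lin_Der] lin_sc[OF lin_Der]
  by (intro sum.cong refl) (simp add: Der_Z_st[OF X] mult.commute)

lemma zt_I: "i \<in> idx \<Longrightarrow> L \<in> idx \<Longrightarrow> (\<Sum>K\<in>idx. zt i K * cmat Icx K L) = eps i * zt i L"
  by (rule eigen_dual) (auto simp: cmat_def I_z)

lemma Der_I_Psi: "Der (cmat Icx) (Z.Psi \<psi>) = Z.Psi (\<lambda>S. (\<Sum>i\<in>S. eps i) * \<psi> S)"
  by (rule Der_Z_Psi) (rule zt_I)

text \<open>The eigencoordinates of the (p, k - p) part of H^k: only products with exactly p factors
  of type (1,0) occur.\<close>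

definition HK :: "nat \<Rightarrow> nat \<Rightarrow> complex form set" where
  "HK k p = {\<psi> \<in> Kf UNIV {k}. \<forall>S. \<psi> S \<noteq> 0 \<longrightarrow> card (S \<inter> {1, 2}) = p}"

lemma sum_eps:
  assumes "S \<subseteq> idx" shows "(\<Sum>i\<in>S. eps i) = \<i> * (2 * of_nat (card (S \<inter> {1, 2})) - of_nat (card S))"
proof -
  have fin: "finite S" by (rule finite_subset_idx[OF assms])
  have "(\<Sum>i\<in>S. eps i) = (\<Sum>i\<in>S \<inter> {1, 2}. \<i>) + (\<Sum>i\<in>S - {1, 2}. - \<i>)"
    using fin by (subst sum.Int_Diff[of S _ "{1, 2}"]) (auto simp: eps_def intro!: arg_cong2[of _ _ _ _ "(+)"] sum.cong)
  moreover have "card S = card (S \<inter> {1, 2}) + card (S - {1, 2})"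
    using fin by (metis Int_Diff_disjoint Int_Diff_Un card_Un_disjoint finite_Diff finite_Int)
  ultimately show ?thesis by (simp add: algebra_simps)
qed

text \<open>The derivation of I separates the types: a product of p covectors of type (1,0) and k -
  p of type (0,1) has eigenvalue i (2 p - k), which determines p once the degree is k. Comparing
  eigencoordinates gives one inclusion; for the other, each admissible \<open>Z.st S\<close> is
  itself such a product.\<close>

lemma Hpq_eigen:
  assumes "p \<le> k" shows "Hpq Icx p (k - p) = Z.Psi ` HK k p"
proof
  have wl: "wedge_list (map form1 xs) = foldr ext1 xs unit_form \<and> valid_form (foldr ext1 xs (unit_form :: complex form))" for xs
  proof (induction xs)
    case Nil then show ?case by (simp add: unit_form_dl valid_dl)
  next
    case (Cons a xs) then show ?case by (simp add: wedge_form1 valid_ext1)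
  qed
  have closed: "0 \<in> Z.Psi ` HK k p" "\<And>\<phi> \<psi>. \<phi> \<in> Z.Psi ` HK k p \<Longrightarrow> \<psi> \<in> Z.Psi ` HK k p \<Longrightarrow> \<phi> + \<psi> \<in> Z.Psi ` HK k p"
    "\<And>c \<phi>. \<phi> \<in> Z.Psi ` HK k p \<Longrightarrow> sc c \<phi> \<in> Z.Psi ` HK k p"
  proof -
    have "0 \<in> HK k p" by (simp add: HK_def Kf_0 qclosed_UNIV fun_apply)
    then show "0 \<in> Z.Psi ` HK k p" using lin_0[OF Z.lin_Psi] by (metis imageI)
    have "\<phi> + \<psi> \<in> HK k p" if "\<phi> \<in> HK k p" "\<psi> \<in> HK k p" for \<phi> \<psi>
      using that by (auto simp: HK_def Kf_add qclosed_UNIV fun_apply simp del: One_nat_def) (metis add.right_neutral)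
    then show "\<phi> + \<psi> \<in> Z.Psi ` HK k p" if "\<phi> \<in> Z.Psi ` HK k p" "\<psi> \<in> Z.Psi ` HK k p" for \<phi> \<psi>
      using that by (auto simp: lin_add[OF Z.lin_Psi, symmetric])
    have "sc c \<phi> \<in> HK k p" if "\<phi> \<in> HK k p" for c \<phi>
      using that by (auto simp: HK_def Kf_sc qclosed_UNIV fun_apply)
    then show "sc c \<phi> \<in> Z.Psi ` HK k p" if "\<phi> \<in> Z.Psi ` HK k p" for c \<phi>
      using that by (auto simp: lin_sc[OF Z.lin_Psi, symmetric])
  qed
  show "Hpq Icx p (k - p) \<subseteq> Z.Psi ` HK k p"
    unfolding Hpq_def
  proof (rule span_in_minimal[OF closed(1,2)])
    fix c v
    assume "v \<in> {wedge_list (map form1 (xs @ ys)) |xs ys. length xs = p \<and> set xs \<subseteq> H10 Icx \<and> length ys = k - p \<and> set ys \<subseteq> H01 Icx}"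
    then obtain xs ys where xy: "length xs = p" "set xs \<subseteq> H10 Icx" "length ys = k - p" "set ys \<subseteq> H01 Icx"
      and v0: "v = wedge_list (map form1 (xs @ ys))" by blast
    have v: "v = foldr ext1 (xs @ ys) unit_form" unfolding v0 using wl[of "xs @ ys"] by (rule conjunct1)
    have F: "foldr ext1 zs unit_form \<in> Kf UNIV {length zs}" for zs
    proof (induction zs)
      case Nil
      then show ?case using Kf_dl[OF qclosed_UNIV, of "{}"] by (simp add: unit_form_dl)
    next
      case (Cons a zs)
      then show ?case by (simp add: Kf_ext1)
    qed
    have D1: "Der (cmat Icx) (foldr ext1 ys unit_form) = sc (- \<i> * of_nat (length ys)) (foldr ext1 ys unit_form)"
      if "set ys \<subseteq> H01 Icx" for ys
      using that
    proof (induction ys)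
      case Nil then show ?case by (simp add: Der_unit)
    next
      case (Cons a ys)
      have "(\<Sum>K\<in>idx. a K * cmat Icx K L) = - \<i> * a L" if "L \<in> idx" for L
        using Cons.prems that by (simp add: H01_def cmat_def)
      from Der_ext1[OF _ this, of "foldr ext1 ys unit_form"] wl[of ys]
      have "Der (cmat Icx) (ext1 a (foldr ext1 ys unit_form)) = sc (- \<i>) (ext1 a (foldr ext1 ys unit_form)) + ext1 a (Der (cmat Icx) (foldr ext1 ys unit_form))"
        by blast
      also have "\<dots> = sc (- \<i> + - \<i> * of_nat (length ys)) (ext1 a (foldr ext1 ys unit_form))"
        using Cons by (simp only: lin_sc[OF lin_ext1] sc.scale_left_distrib set_simps insert_subset)
      finally show ?case by (simp add: algebra_simps)
    qed
    have "Der (cmat Icx) (foldr ext1 (xs @ ys) unit_form) = sc (\<i> * of_nat (length xs) - \<i> * of_nat (length ys)) (foldr ext1 (xs @ ys) unit_form)"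
      using xy(2)
    proof (induction xs)
      case Nil then show ?case using D1[OF xy(4)] by simp
    next
      case (Cons a xs)
      have "(\<Sum>K\<in>idx. a K * cmat Icx K L) = \<i> * a L" if "L \<in> idx" for L
        using Cons.prems that by (simp add: H10_def cmat_def)
      from Der_ext1[OF _ this, of "foldr ext1 (xs @ ys) unit_form"] wl[of "xs @ ys"]
      have "Der (cmat Icx) (ext1 a (foldr ext1 (xs @ ys) unit_form)) = sc \<i> (ext1 a (foldr ext1 (xs @ ys) unit_form)) + ext1 a (Der (cmat Icx) (foldr ext1 (xs @ ys) unit_form))"
        by blast
      also have "\<dots> = sc (\<i> + (\<i> * of_nat (length xs) - \<i> * of_nat (length ys))) (ext1 a (foldr ext1 (xs @ ys) unit_form))"
        using Cons by (simp only: lin_sc[OF lin_ext1] sc.scale_left_distrib set_simps insert_subset)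
      finally show ?case by (simp add: algebra_simps)
    qed
    then have Dv: "Der (cmat Icx) v = sc (\<i> * (2 * of_nat p - of_nat k)) v"
      using xy assms by (simp add: v of_nat_diff algebra_simps)
    have "v \<in> Kf UNIV {k}" using F[of "xs @ ys"] xy assms v by simp
    then obtain \<psi> where \<psi>: "\<psi> \<in> Kf UNIV {k}" "v = Z.Psi \<psi>" using Z_Psi_surj by blast
    have "Z.Psi (\<lambda>S. (\<Sum>i\<in>S. eps i) * \<psi> S) = Z.Psi (sc (\<i> * (2 * of_nat p - of_nat k)) \<psi>)"
      using Dv unfolding \<psi>(2) Der_I_Psi lin_sc[OF Z.lin_Psi] .
    then have "(\<lambda>S. (\<Sum>i\<in>S. eps i) * \<psi> S) = sc (\<i> * (2 * of_nat p - of_nat k)) \<psi>"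
      by (rule Z.Psi_inj[rotated 2]) (use \<psi>(1) in \<open>auto simp: Kf_def valid_form_def fun_apply\<close>)
    then have eq: "(\<Sum>i\<in>S. eps i) * \<psi> S = \<i> * (2 * of_nat p - of_nat k) * \<psi> S" for S
      by (drule_tac fun_cong[of _ _ S]) (simp add: sc_apply)
    have "card (S \<inter> {1, 2}) = p" if "\<psi> S \<noteq> 0" for S
    proof -
      have S: "S \<subseteq> idx" "card S = k" using \<psi>(1) that by (auto simp: Kf_def valid_form_def)
      have "complex_of_nat (card (S \<inter> {1, 2})) = of_nat p"
        using eq[of S] that unfolding sum_eps[OF S(1)] S(2) by simp
      then show ?thesis by simp
    qed
    then have "\<psi> \<in> HK k p" using \<psi>(1) by (simp add: HK_def)
    then show "sc c v \<in> Z.Psi ` HK k p" using \<psi>(2) closed(3) by blast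
  qed
  show "Z.Psi ` HK k p \<subseteq> Hpq Icx p (k - p)"
  proof
    fix v assume "v \<in> Z.Psi ` HK k p"
    then obtain \<psi> where \<psi>: "\<psi> \<in> HK k p" "v = Z.Psi \<psi>" by auto
    have "sc (\<psi> S) (Z.st S) \<in> Hpq Icx p (k - p)" if S: "S \<in> Pow idx" for S
    proof (cases "\<psi> S = 0")
      case True then show ?thesis by (simp add: Hpq_def span_in_0)
    next
      case False
      then have c: "card (S \<inter> {1, 2}) = p" "card S = k" using \<psi>(1) by (auto simp: HK_def Kf_def)
      have fin: "finite S" using S finite_subset_idx by auto
      let ?a = "sorted_list_of_set (S \<inter> {1, 2})" and ?b = "sorted_list_of_set (S - {1, 2})"
      \<comment> \<open>In increasing order the indices 1 and 2 stand first, so the (1,0) factors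
        already precede the (0,1) factors and no sign occurs.\<close>
      have ab: "sorted_list_of_set S = ?a @ ?b"
      proof (rule sorted_distinct_set_unique)
        show "sorted (?a @ ?b)" using fin S by (auto simp: sorted_append idx_set)
        show "distinct (?a @ ?b)" using fin by auto
        show "set (sorted_list_of_set S) = set (?a @ ?b)" using fin by auto
      qed (use fin in auto)
      have "card (S - {1, 2}) = k - p"
        using c fin by (metis Diff_Int2 Int_commute card_Diff_subset_Int finite_Int Int_Diff Int_absorb)
      then have l: "length ?a = p" "length ?b = k - p" using c by simp_all
      have st: "Z.st S = wedge_list (map form1 (map zt ?a @ map zt ?b))"
        unfolding Z.st_def ab using wl[of "map zt ?a @ map zt ?b"] by (simp add: foldr_map cl_ext1 comp_def)
      have 10: "zt i \<in> H10 Icx" if "i \<in> idx" "i \<in> {1, 2}" for i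
        using zt_I[OF that(1)] that(2) zt_valid by (auto simp: H10_def cmat_def eps_def)
      have 01: "zt i \<in> H01 Icx" if "i \<in> idx" "i \<notin> {1, 2}" for i
        using zt_I[OF that(1)] that(2) zt_valid by (auto simp: H01_def cmat_def eps_def)
      have "Z.st S \<in> Hpq Icx p (k - p)" unfolding Hpq_def
      proof (rule span_in_base[OF qclosed_UNIV], intro CollectI exI conjI)
        show "Z.st S = wedge_list (map form1 (map zt ?a @ map zt ?b))" by (rule st)
        show "set (map zt ?a) \<subseteq> H10 Icx" "set (map zt ?b) \<subseteq> H01 Icx" using S fin 10 01 by auto
      qed (use l in auto)
      then show ?thesis unfolding Hpq_def by (intro span_in_sc qclosed_UNIV) auto
    qed
    then show "v \<in> Hpq Icx p (k - p)" unfolding \<psi>(2) Z.Psi_def Hpq_def by (rule span_in_sum)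
  qed
qed

end

section \<open>The vertical Hodge structure\<close>

lemma Kf_hop:
  assumes "qclosed L" "\<real> \<subseteq> L" "\<phi> \<in> Kf L D" "\<And>j. j \<in> D \<Longrightarrow> j + 2 \<in> D"
  shows "hop Icx K \<phi> \<in> Kf L D"
proof -
  have "Suc ` Suc ` D \<subseteq> D" using assms(4) by auto
  then have "cr0 j (cr0 i \<phi>) \<in> Kf L D" for i j
    using Kf_cr0[OF assms(1) Kf_cr0[OF assms(1,3)], of j i] Kf_mono[of L L "Suc ` Suc ` D" D] by auto
  moreover have "Der (cmat Icx) \<phi> \<in> Kf L D"
    using assms by (intro Kf_Der) (auto simp: cmat_def)
  moreover have "(-1 :: complex) \<in> L" using assms(2) by auto
  ultimately show ?thesis unfolding hop_def using assms(1,2)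
    by (intro Kf_add Kf_sc Kf_sum) auto
qed

lemma lin_hop: "lin (hop Icx K)"
  unfolding hop_def by (intro lin_plus lin_scale lin_setsum lin_Der lin_comp[OF lin_cr0 lin_cr0])

lemma vop_hop: "vop (hop Icx K)"
proof
  fix \<phi> :: "complex form" assume "valid_form \<phi>"
  then have "\<phi> \<in> Kf UNIV UNIV" by (simp add: Kf_def)
  then have "hop Icx K \<phi> \<in> Kf UNIV UNIV" by (intro Kf_hop qclosed_UNIV) auto
  then show "valid_form (hop Icx K \<phi>)" by (rule Kf_valid)
qed (rule lin_hop)

lemma (in vop) expser_Kf:
  assumes "\<phi> \<in> Kf UNIV D" "\<And>\<psi>. \<psi> \<in> Kf UNIV D \<Longrightarrow> f \<psi> \<in> Kf UNIV D"
  shows "expser f \<alpha> \<phi> \<in> Kf UNIV D"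
proof -
  have p: "(f ^^ n) \<phi> \<in> Kf UNIV D" for n by (induction n) (auto simp: assms)
  have "expser f \<alpha> \<phi> S = 0" if "card S \<notin> D" for S
  proof -
    have "((f ^^ n) \<phi>) S = 0" for n using p[of n] that by (auto simp: Kf_def)
    then show ?thesis by (simp add: expser_def)
  qed
  then show ?thesis using valid_expser[OF Kf_valid[OF assms(1)]] by (auto simp: Kf_def)
qed

definition degs :: "nat \<Rightarrow> nat set" where
  "degs k = {j. k \<le> j \<and> even (j - k)}"

lemma degs_step: "j \<in> degs k \<Longrightarrow> j + 2 \<in> degs k"
  by (auto simp: degs_def)

lemma degs_minus: "degs k - {k} = degs (k + 2)"
proof -
  have "(k \<le> j \<and> even (j - k) \<and> j \<noteq> k) = (k + 2 \<le> j \<and> even (j - (k + 2)))" for j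
    by presburger
  then show ?thesis by (auto simp: degs_def)
qed

lemma self_degs: "k \<in> degs k" by (simp add: degs_def)

text \<open>In degree k, the lowest one present, powers of \<open>hop\<close> and of its derivation
  part agree: the other summand raises the degree by two, and what it produces never comes back
  down.\<close>

lemma hop_pow:
  fixes Icx K :: "real mat"
  assumes "\<phi> \<in> Kf UNIV {k}"
  defines "\<Delta> \<equiv> \<lambda>\<phi>. sc (-1) (Der (cmat Icx) \<phi>)"
  shows "(hop Icx K ^^ n) \<phi> \<in> Kf UNIV (degs k)" "(\<Delta> ^^ n) \<phi> \<in> Kf UNIV {k}"
    "card U = k \<Longrightarrow> (hop Icx K ^^ n) \<phi> U = (\<Delta> ^^ n) \<phi> U"
proof -
  have Dl: "\<Delta> \<psi> \<in> Kf UNIV D" if "\<psi> \<in> Kf UNIV D" for \<psi> D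
    unfolding \<Delta>_def using that by (intro Kf_sc Kf_Der qclosed_UNIV) auto
  have "(hop Icx K ^^ n) \<phi> \<in> Kf UNIV (degs k) \<and> (\<Delta> ^^ n) \<phi> \<in> Kf UNIV {k} \<and>
     (\<forall>U. card U = k \<longrightarrow> (hop Icx K ^^ n) \<phi> U = (\<Delta> ^^ n) \<phi> U)"
  proof (induction n)
    case 0
    have "Kf UNIV {k} \<subseteq> Kf UNIV (degs k)" by (rule Kf_mono) (auto simp: self_degs)
    then show ?case using assms by auto
  next
    case (Suc n)
    let ?h = "(hop Icx K ^^ n) \<phi>" and ?d = "(\<Delta> ^^ n) \<phi>"
    have h: "?h \<in> Kf UNIV (degs k)" and d: "?d \<in> Kf UNIV {k}" and hd: "\<And>U. card U = k \<Longrightarrow> ?h U = ?d U"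
      using Suc by auto
    \<comment> \<open>The discrepancy accumulated so far lives in degrees from k + 2 on, and the
      derivation keeps it there.\<close>
    have rest: "?h - ?d \<in> Kf UNIV (degs (k + 2))"
      unfolding degs_minus[symmetric]
    proof -
      have "card S \<in> degs k - {k}" if nz: "(?h - ?d) S \<noteq> 0" for S
      proof -
        have "card S \<noteq> k" using nz hd by (auto simp: fun_apply)
        then have "?d S = 0" using d by (auto simp: Kf_def)
        then have "?h S \<noteq> 0" using nz by (simp add: fun_apply)
        then show ?thesis using h \<open>card S \<noteq> k\<close> by (auto simp: Kf_def)
      qed
      then show "?h - ?d \<in> Kf UNIV (degs k - {k})"
        using h d by (auto simp: Kf_def valid_form_def fun_apply)
    qed
    have "\<Delta> ?h = \<Delta> ?d + \<Delta> (?h - ?d)"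
      unfolding \<Delta>_def by (simp add: lin_diff[OF lin_Der] sc.scale_right_diff_distrib)
    moreover have "\<Delta> (?h - ?d) U = 0" if "card U = k" for U
      using Dl[OF rest] that by (auto simp: Kf_def degs_def)
    ultimately have e1: "\<Delta> ?h U = \<Delta> ?d U" if "card U = k" for U using that by (simp add: fun_apply)
    have "cr0 j (cr0 i ?h) U = 0" if "card U = k" for i j U
      using Kf_cr0[OF qclosed_UNIV Kf_cr0[OF qclosed_UNIV h], of j i] that by (auto simp: Kf_def degs_def)
    then have e2: "hop Icx K ?h U = \<Delta> ?h U" if "card U = k" for U
      using that by (simp add: hop_def \<Delta>_def fun_apply sum_fun_apply)
    have "hop Icx K ?h \<in> Kf UNIV (degs k)" using h degs_step by (intro Kf_hop qclosed_UNIV) auto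
    then show ?case using e1 e2 Dl[OF d] by simp
  qed
  then show "(hop Icx K ^^ n) \<phi> \<in> Kf UNIV (degs k)" "(\<Delta> ^^ n) \<phi> \<in> Kf UNIV {k}"
    "card U = k \<Longrightarrow> (hop Icx K ^^ n) \<phi> U = (\<Delta> ^^ n) \<phi> U" by auto
qed

lemma exp_I_eq_all:
  assumes "\<forall>\<alpha>::real. exp (- (\<i> * of_real \<alpha> * of_real x)) = exp (- (\<i> * of_real \<alpha> * of_real y))"
  shows "x = (y :: real)"
proof (rule ccontr)
  assume ne: "x \<noteq> y"
  \<comment> \<open>At this parameter the two exponentials differ by the factor exp(i \<pi>) =
    -1.\<close>
  define a where "a = pi / (y - x)"
  have a: "a * (y - x) = pi" using ne by (simp add: a_def)
  have "exp (\<i> * of_real a * of_real y) * exp (- (\<i> * of_real a * of_real x)) = (1 :: complex)"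
    using assms[rule_format, of a] by (simp flip: exp_add)
  then have "exp (\<i> * of_real (a * (y - x))) = (1 :: complex)"
    by (simp add: algebra_simps flip: exp_add)
  then show False unfolding a by (simp add: mult.commute)
qed

text \<open>\<open>F.Psi\<close> carries ordinary forms to the vertical side, \<open>Z.Psi\<close>
  diagonalises I on ordinary forms. The assumption \<open>dJ\<close> ties them together, so both
  Hodge structures are read off in the same eigencoordinates.\<close>

locale mirror = hframe P Pinv H Hi + eigenframe Icx T1 z zt t
  for P Pinv :: "int mat" and H Hi :: "rat mat" and Icx :: "real mat" and T1 :: "rat mat" and z zt t +
  fixes G Bm K :: "real mat"
  assumes dJ: "\<And>\<phi>. valid_form \<phi> \<Longrightarrow> capp (dJ G Icx Bm) (F.Psi \<phi>) = F.Psi (hop Icx K \<phi>)"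
begin

lemma frame_F: "frame (fl P Pinv Hi) (fm P Pinv H) (vac0 Pinv :: complex form)"
  by unfold_locales

lemma rho_Psi: "valid_form \<phi> \<Longrightarrow> rho G Icx Bm \<alpha> (F.Psi \<phi>) = F.Psi (expser (hop Icx K) \<alpha> \<phi>)"
  unfolding rho_expser by (rule expser_frame[OF frame_F vop_hop dJ])

lemma WR_eq: "WR Pinv k = F.Psi ` Kf \<real> (degs k)"
  unfolding WR_def Wgen_gens degs_def by (rule span_gens[OF qclosed_Reals])

lemma VQ_eq: "VQ Pinv k = F.Psi ` Kf \<rat> {k}"
  unfolding VQ_def Vgen_gens by (rule span_gens[OF qclosed_Rats])

lemma WC_eq: "span_in UNIV (Wgen Pinv k) = F.Psi ` Kf UNIV (degs k)"
  unfolding Wgen_gens degs_def by (rule span_gens[OF qclosed_UNIV])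

lemma VC_eq: "span_in UNIV (VQ Pinv k) = F.Psi ` Kf UNIV {k}"
proof -
  have "span_in UNIV (VQ Pinv k) = span_in UNIV (Vgen Pinv k)"
  proof
    show "span_in UNIV (VQ Pinv k) \<subseteq> span_in UNIV (Vgen Pinv k)"
    proof (rule span_in_minimal[OF span_in_0 span_in_add])
      fix c v assume "v \<in> VQ Pinv k"
      then have "v \<in> span_in UNIV (Vgen Pinv k)" unfolding VQ_def using span_in_mono[of \<rat> UNIV] by blast
      then show "sc c v \<in> span_in UNIV (Vgen Pinv k)" by (intro span_in_sc qclosed_UNIV) auto
    qed
    show "span_in UNIV (Vgen Pinv k) \<subseteq> span_in UNIV (VQ Pinv k)"
      unfolding VQ_def by (intro span_in_mono) (auto intro: span_in_base[OF qclosed_Rats])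
  qed
  then show ?thesis unfolding Vgen_gens by (simp only: span_gens[OF qclosed_UNIV])
qed

lemma WR_invariant: assumes "\<phi> \<in> WR Pinv k" shows "rho G Icx Bm \<alpha> \<phi> \<in> WR Pinv k"
proof -
  interpret h: vop "hop Icx K" by (rule vop_hop)
  obtain \<psi> where \<psi>: "\<psi> \<in> Kf \<real> (degs k)" "\<phi> = F.Psi \<psi>" using assms WR_eq by auto
  have "expser (hop Icx K) \<alpha> \<psi> \<in> Kf \<real> (degs k)"
    by (rule h.expser_Kf_Reals[OF \<psi>(1)]) (auto intro: Kf_hop[OF qclosed_Reals] degs_step)
  then show ?thesis unfolding WR_eq \<psi>(2) rho_Psi[OF Kf_valid[OF \<psi>(1)]] by (rule imageI)
qed

text \<open>On the component of degree k the generator is the diagonal operator -\<open>Der\<close>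
  of I, so the series multiplies each eigencoordinate by an ordinary exponential.\<close>

lemma expser_top:
  assumes \<psi>: "\<psi> \<in> Kf UNIV {k}" and U: "card U = k"
  shows "expser (hop Icx K) \<alpha> (Z.Psi \<psi>) U = Z.Psi (\<lambda>S. exp (of_real \<alpha> * (- (\<Sum>i\<in>S. eps i))) * \<psi> S) U"
proof -
  define d where "d S = - (\<Sum>i\<in>S. eps i)" for S
  let ?\<Delta> = "\<lambda>\<phi>. sc (-1) (Der (cmat Icx) \<phi>)"
  have D: "?\<Delta> (Z.Psi \<chi>) = Z.Psi (\<lambda>S. d S * \<chi> S)" for \<chi>
  proof -
    have "(\<lambda>S. d S * \<chi> S) = sc (-1) (\<lambda>S. (\<Sum>i\<in>S. eps i) * \<chi> S)" by (simp add: d_def fun_eq_iff fun_apply)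
    then show ?thesis unfolding Der_I_Psi by (simp only: lin_sc[OF Z.lin_Psi])
  qed
  have Dn: "(?\<Delta> ^^ n) (Z.Psi \<psi>) = Z.Psi (\<lambda>S. d S ^ n * \<psi> S)" for n
  proof (induction n)
    case (Suc n)
    have "(?\<Delta> ^^ Suc n) (Z.Psi \<psi>) = ?\<Delta> ((?\<Delta> ^^ n) (Z.Psi \<psi>))" by (simp only: funpow.simps comp_def)
    also have "\<dots> = Z.Psi (\<lambda>S. d S * (d S ^ n * \<psi> S))" unfolding Suc by (rule D)
    finally show ?case by (simp add: mult.assoc)
  qed simp
  have hU: "(hop Icx K ^^ n) (Z.Psi \<psi>) U = Z.Psi (\<lambda>S. d S ^ n * \<psi> S) U" for n
    using hop_pow(3)[OF Z_Psi_Kf[OF \<psi>] U, where Icx = Icx and K = K and n = n] unfolding Dn .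
  have P: "Z.Psi \<chi> U = (\<Sum>T\<in>Pow idx. \<chi> T * Z.st T U)" for \<chi>
    by (simp add: Z.Psi_def sum_fun_apply sc_apply)
  have "(\<lambda>n. \<Sum>T\<in>Pow idx. (of_real \<alpha> * d T) ^ n /\<^sub>R fact n * (\<psi> T * Z.st T U)) sums
      (\<Sum>T\<in>Pow idx. exp (of_real \<alpha> * d T) * (\<psi> T * Z.st T U))"
    by (intro sums_sum sums_mult2 exp_converges)
  then have "(\<lambda>n. (of_real \<alpha>) ^ n / of_nat (fact n) * (hop Icx K ^^ n) (Z.Psi \<psi>) U) sums
      Z.Psi (\<lambda>S. exp (of_real \<alpha> * d S) * \<psi> S) U"
    unfolding hU P
    by (simp add: sum_distrib_left scaleR_conv_of_real power_mult_distrib divide_inverse mult.assoc mult.left_commute)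
  then show ?thesis unfolding expser_def d_def by (rule sums_unique[symmetric])
qed

text \<open>Membership of the difference in W^{k+2} means vanishing of its degree k component, which
  is diagonal in the eigencoordinates. Vanishing for all \<alpha> forces the exponents to agree.
  Since the generator is minus the derivation of I and charge \<Delta> means exp(-i \<alpha>
  \<Delta>), types are preserved and not conjugated.\<close>

lemma hpV_eq: assumes "p \<le> k" shows "hpV G Icx Bm Pinv k p = F.Psi ` Z.Psi ` HK k p"
proof -
  interpret h: vop "hop Icx K" by (rule vop_hop)
  define c where "c \<alpha> = exp (- (\<i> * of_real \<alpha> * of_int (int p - int (k - p))))" for \<alpha> :: real
  have key: "(\<forall>\<alpha>. (\<lambda>S. rho G Icx Bm \<alpha> (F.Psi (Z.Psi \<psi>)) S - c \<alpha> * F.Psi (Z.Psi \<psi>) S) \<in> span_in UNIV (Wgen Pinv (k + 2)))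
      \<longleftrightarrow> \<psi> \<in> HK k p" if \<psi>: "\<psi> \<in> Kf UNIV {k}" for \<psi>
  proof -
    have Zk: "Z.Psi \<psi> \<in> Kf UNIV {k}" by (rule Z_Psi_Kf[OF \<psi>])
    have Zv: "valid_form (Z.Psi \<psi>)" by (rule Z.valid_Psi)
    define E where "E \<alpha> = expser (hop Icx K) \<alpha> (Z.Psi \<psi>) - sc (c \<alpha>) (Z.Psi \<psi>)" for \<alpha>
    have D: "Kf UNIV {k} \<subseteq> Kf UNIV (degs k)" by (rule Kf_mono) (auto simp: self_degs)
    have exD: "expser (hop Icx K) \<alpha> (Z.Psi \<psi>) \<in> Kf UNIV (degs k)" for \<alpha>
      by (rule h.expser_Kf) (use Zk D degs_step in \<open>auto intro: Kf_hop[OF qclosed_UNIV]\<close>)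
    have E: "E \<alpha> \<in> Kf UNIV (degs k)" for \<alpha>
    proof -
      have "E \<alpha> = expser (hop Icx K) \<alpha> (Z.Psi \<psi>) + sc (- c \<alpha>) (Z.Psi \<psi>)" by (simp add: E_def)
      moreover have "expser (hop Icx K) \<alpha> (Z.Psi \<psi>) + sc (- c \<alpha>) (Z.Psi \<psi>) \<in> Kf UNIV (degs k)"
        by (intro Kf_add Kf_sc qclosed_UNIV exD subsetD[OF D Zk] UNIV_I)
      ultimately show ?thesis by (simp only:)
    qed
    have 1: "(\<lambda>S. rho G Icx Bm \<alpha> (F.Psi (Z.Psi \<psi>)) S - c \<alpha> * F.Psi (Z.Psi \<psi>) S) = F.Psi (E \<alpha>)" for \<alpha>
      unfolding rho_Psi[OF Zv] E_def lin_diff[OF F.lin_Psi] lin_sc[OF F.lin_Psi] by (simp add: fun_eq_iff fun_apply)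
    have 2: "F.Psi (E \<alpha>) \<in> F.Psi ` Kf UNIV (degs (k + 2)) \<longleftrightarrow> E \<alpha> \<in> Kf UNIV (degs (k + 2))" for \<alpha>
      using F.Psi_inj Kf_valid E by blast
    have 3: "E \<alpha> \<in> Kf UNIV (degs (k + 2)) \<longleftrightarrow> (\<forall>U. card U = k \<longrightarrow> E \<alpha> U = 0)" for \<alpha>
      unfolding degs_minus[symmetric] using E[of \<alpha>] by (auto simp: Kf_def)
    \<comment> \<open>The eigencoordinates of the degree k component of the difference
      \<open>E \<alpha>\<close>.\<close>
    define W where "W \<alpha> = (\<lambda>S. (exp (of_real \<alpha> * (- (\<Sum>i\<in>S. eps i))) - c \<alpha>) * \<psi> S)" for \<alpha>
    have Wk: "W \<alpha> \<in> Kf UNIV {k}" for \<alpha> using \<psi> by (auto simp: W_def Kf_def valid_form_def)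
    have EW: "E \<alpha> U = Z.Psi (W \<alpha>) U" if "card U = k" for U \<alpha>
    proof -
      have "W \<alpha> = (\<lambda>S. exp (of_real \<alpha> * (- (\<Sum>i\<in>S. eps i))) * \<psi> S) - sc (c \<alpha>) \<psi>"
        by (simp add: W_def fun_eq_iff fun_apply left_diff_distrib)
      then show ?thesis
        using expser_top[OF \<psi> that, of \<alpha>] by (simp add: E_def lin_diff[OF Z.lin_Psi] lin_sc[OF Z.lin_Psi] fun_apply)
    qed
    have 4: "(\<forall>U. card U = k \<longrightarrow> E \<alpha> U = 0) \<longleftrightarrow> W \<alpha> = 0" for \<alpha>
    proof
      assume a: "\<forall>U. card U = k \<longrightarrow> E \<alpha> U = 0"
      have "Z.Psi (W \<alpha>) U = 0" for U
        using Z_Psi_Kf[OF Wk, of \<alpha>] a EW[of U \<alpha>] by (cases "card U = k") (auto simp: Kf_def)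
      then have "Z.Psi (W \<alpha>) = 0" by (simp add: fun_eq_iff fun_apply)
      then show "W \<alpha> = 0" using Z.Psi_inj_0 Kf_valid[OF Wk] by blast
    next
      assume "W \<alpha> = 0"
      then show "\<forall>U. card U = k \<longrightarrow> E \<alpha> U = 0" using EW by (simp add: lin_0[OF Z.lin_Psi] fun_apply)
    qed
    have 5: "exp (of_real \<alpha> * (- (\<Sum>i\<in>S. eps i))) = exp (- (\<i> * of_real \<alpha> * of_real (2 * real (card (S \<inter> {1, 2})) - real k)))"
      if "S \<subseteq> idx" "card S = k" for S and \<alpha> :: real
      unfolding sum_eps[OF that(1)] that(2) by (simp add: algebra_simps)
    \<comment> \<open>\<open>p \<le> k\<close> makes the natural subtraction k - p exact, so the
      charge is 2 p - k, as in the eigenvalues of the derivation.\<close>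
    have 6: "c \<alpha> = exp (- (\<i> * of_real \<alpha> * of_real (2 * real p - real k)))" for \<alpha>
      unfolding c_def using assms by (simp add: of_nat_diff algebra_simps)
    have "(\<forall>\<alpha>. W \<alpha> = 0) \<longleftrightarrow> \<psi> \<in> HK k p"
    proof
      assume W0: "\<forall>\<alpha>. W \<alpha> = 0"
      have "card (S \<inter> {1, 2}) = p" if nz: "\<psi> S \<noteq> 0" for S
      proof -
        have S: "S \<subseteq> idx" "card S = k" using \<psi> nz by (auto simp: Kf_def valid_form_def)
        have "exp (of_real \<alpha> * (- (\<Sum>i\<in>S. eps i))) = c \<alpha>" for \<alpha>
          using W0[rule_format, of \<alpha>, THEN fun_cong, of S] nz by (simp add: W_def fun_apply)
        then have "\<forall>\<alpha>::real. exp (- (\<i> * of_real \<alpha> * of_real (2 * real (card (S \<inter> {1, 2})) - real k)))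
            = exp (- (\<i> * of_real \<alpha> * of_real (2 * real p - real k)))"
          unfolding 5[OF S] 6 by blast
        from exp_I_eq_all[OF this] show ?thesis by simp
      qed
      then show "\<psi> \<in> HK k p" using \<psi> by (simp add: HK_def)
    next
      assume hk: "\<psi> \<in> HK k p"
      show "\<forall>\<alpha>. W \<alpha> = 0"
      proof (intro allI ext)
        fix \<alpha> S
        show "W \<alpha> S = 0 S"
        proof (cases "\<psi> S = 0")
          case False
          then have "S \<subseteq> idx" "card S = k" "card (S \<inter> {1, 2}) = p"
            using \<psi> hk by (auto simp: Kf_def valid_form_def HK_def)
          then show ?thesis unfolding W_def 6 using 5[of S \<alpha>] by (simp only: fun_apply) simp
        qed (simp add: W_def fun_apply)
      qed
    qed
    then show ?thesis unfolding 1 WC_eq 2 3 4 .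
  qed
  show ?thesis
  proof (intro set_eqI iffI)
    fix \<phi> assume "\<phi> \<in> hpV G Icx Bm Pinv k p"
    then have a: "\<phi> \<in> F.Psi ` Kf UNIV {k}"
      and b: "\<forall>\<alpha>. (\<lambda>S. rho G Icx Bm \<alpha> \<phi> S - c \<alpha> * \<phi> S) \<in> span_in UNIV (Wgen Pinv (k + 2))"
      unfolding hpV_def VC_eq c_def by auto
    from a obtain \<psi> where "\<psi> \<in> Kf UNIV {k}" "\<phi> = F.Psi (Z.Psi \<psi>)" using Z_Psi_surj by blast
    then show "\<phi> \<in> F.Psi ` Z.Psi ` HK k p" using key[of \<psi>] b by auto
  next
    fix \<phi> assume "\<phi> \<in> F.Psi ` Z.Psi ` HK k p"
    then obtain \<psi> where \<psi>: "\<psi> \<in> HK k p" "\<phi> = F.Psi (Z.Psi \<psi>)" by auto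
    then have k: "\<psi> \<in> Kf UNIV {k}" by (simp add: HK_def)
    have "\<phi> \<in> F.Psi ` Kf UNIV {k}" using \<psi>(2) Z_Psi_Kf[OF k] by blast
    then show "\<phi> \<in> hpV G Icx Bm Pinv k p"
      using key[OF k] \<psi> unfolding hpV_def VC_eq c_def by auto
  qed
qed

lemma Om_matrix: "\<exists>M. \<forall>\<phi>. valid_form \<phi> \<longrightarrow> qfapp M \<phi> = Om \<phi>"
proof (rule qfapp_exists[OF lin_Om valid_Om])
  fix T assume "T \<subseteq> idx"
  then have "dl T \<in> Kf \<rat> UNIV" using Kf_dl[OF qclosed_Rats] Kf_mono[of \<rat> \<rat> "{card T}" UNIV] by auto
  then show "Om (dl T) \<in> Kf \<rat> UNIV" by (rule Om_Kf[OF qclosed_Rats])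
qed

text \<open>The rational inverse \<open>Om\<close> of \<open>F.Psi\<close> serves for all p at once,
  since the (p, k - p) parts on both sides have the eigencoordinates \<open>HK k p\<close>.\<close>

lemma hs_iso_mirror: "hs_iso (VQ Pinv k) (hpV G Icx Bm Pinv k) (HQ k) (hpH Icx k) k"
proof -
  obtain M where M: "\<And>\<phi>. valid_form \<phi> \<Longrightarrow> qfapp M \<phi> = Om \<phi>" using Om_matrix by blast
  have MP: "qfapp M (F.Psi \<phi>) = \<phi>" if "valid_form \<phi>" for \<phi>
    using M[OF F.valid_Psi] Om_Psi[OF that] by simp
  have im: "qfapp M ` F.Psi ` A = A" if "\<And>\<phi>. \<phi> \<in> A \<Longrightarrow> valid_form \<phi>" for A
    using MP[OF that] by (force simp: image_image)
  have "inj_on (qfapp M) (VQ Pinv k)"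
    unfolding VQ_eq by (rule inj_onI) (use MP Kf_valid in force)
  moreover have "qfapp M ` VQ Pinv k = HQ k"
    unfolding VQ_eq HQ_Kf by (rule im) (rule Kf_valid)
  moreover have "qfapp M ` hpV G Icx Bm Pinv k p = hpH Icx k p" if "p \<le> k" for p
    unfolding hpV_eq[OF that] hpH_def Hpq_eigen[OF that] by (rule im) (auto simp: Z.valid_Psi)
  ultimately show ?thesis unfolding hs_iso_def by blast
qed

end

section \<open>Complex multiplication\<close>

text \<open>Rational scalars as a field of their own, so that exchange and dimension arguments apply
  to rational spans of complex-valued functions.\<close>

definition qsc :: "rat \<Rightarrow> ('x \<Rightarrow> complex) \<Rightarrow> 'x \<Rightarrow> complex" where
  "qsc q f = sc (of_rat q) f"

interpretation qv: vector_space "qsc :: rat \<Rightarrow> ('x \<Rightarrow> complex) \<Rightarrow> 'x \<Rightarrow> complex"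
  by unfold_locales (simp_all add: qsc_def sc.scale_right_distrib sc.scale_left_distrib of_rat_add of_rat_mult)

lemma span_in_Rats: "span_in \<rat> X = qv.span X"
proof
  show "span_in \<rat> X \<subseteq> qv.span X"
  proof (rule span_in_minimal[OF qv.span_zero qv.span_add])
    fix c :: complex and v assume "c \<in> \<rat>" "v \<in> X"
    then obtain q where "c = of_rat q" by (auto elim: Rats_cases)
    then show "sc c v \<in> qv.span X" using \<open>v \<in> X\<close> qv.span_scale[OF qv.span_base, of v X q] by (simp add: qsc_def)
  qed
  show "qv.span X \<subseteq> span_in \<rat> X"
  proof (rule qv.span_minimal)
    show "X \<subseteq> span_in \<rat> X" using span_in_base[OF qclosed_Rats] by blast
    show "qv.subspace (span_in \<rat> X)"
      by (auto simp: qv.subspace_def span_in_0 span_in_add qsc_def intro!: span_in_sc qclosed_Rats)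
  qed
qed

lemma has_qdim_basis:
  assumes "finite B" "qv.independent B" "X = qv.span B" shows "has_qdim X (card B)"
proof -
  obtain vs where vs: "set vs = B" "distinct vs" using finite_distinct_list[OF assms(1)] by blast
  have len: "length vs = card B" using vs distinct_card by metis
  have "qindep vs" unfolding qindep_def
  proof (intro allI impI)
    fix cs assume a: "length cs = length vs \<and> set cs \<subseteq> \<rat> \<and> lincomb cs vs = (\<lambda>x. 0)"
    have "\<forall>i<length vs. \<exists>q. cs ! i = of_rat q" using a by (metis Rats_cases nth_mem subsetD)
    then obtain q where q: "\<And>i. i < length vs \<Longrightarrow> cs ! i = of_rat (q i)" by metis
    define u where "u v = q (the_inv_into {..<length vs} ((!) vs) v)" for v
    have bij: "bij_betw ((!) vs) {..<length vs} (set vs)" by (rule bij_betw_nth[OF vs(2) refl refl])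
    have u: "u (vs ! i) = q i" if "i < length vs" for i
      using the_inv_into_f_f[OF bij_betw_imp_inj_on[OF bij], of i] that by (simp add: u_def)
    have "(\<Sum>v\<in>set vs. qsc (u v) v) = (\<Sum>i<length vs. qsc (u (vs ! i)) (vs ! i))"
      by (rule sum.reindex_bij_betw[OF bij, symmetric])
    also have "\<dots> = lincomb cs vs"
      by (rule ext) (simp add: lincomb_def sum_fun_apply qsc_def fun_apply u q)
    finally have "(\<Sum>v\<in>B. qsc (u v) v) = 0" using a vs(1) by (simp add: zero_fun_def)
    then have "u v = 0" if "v \<in> B" for v using qv.independentD[OF assms(2,1) subset_refl] that by blast
    then have "cs ! i = 0" if "i < length vs" for i using u[OF that] q[OF that] vs(1) nth_mem[OF that] by auto
    then show "set cs \<subseteq> {0}" using a by (auto simp: in_set_conv_nth)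
  qed
  moreover have "X = span_in \<rat> (set vs)" unfolding assms(3) vs(1) by (rule span_in_Rats[symmetric])
  moreover have "set vs \<subseteq> X" unfolding assms(3) vs(1) by (rule qv.span_superset)
  ultimately show ?thesis unfolding has_qdim_def using vs(2) len by blast
qed

text \<open>Independence of an indexed family also yields that its members are distinct, so that the
  set of values has the cardinality of the index set.\<close>

lemma qv_family:
  assumes fin: "finite I" and ind: "\<And>u. (\<Sum>i\<in>I. qsc (u i) (f i)) = 0 \<Longrightarrow> \<forall>i\<in>I. u i = 0"
  shows "inj_on f I" "qv.independent (f ` I)"
proof -
  show inj: "inj_on f I"
  proof (rule inj_onI, rule ccontr)
    fix a b assume ab: "a \<in> I" "b \<in> I" "f a = f b" "a \<noteq> b"
    let ?u = "\<lambda>i. if i = a then 1 else if i = b then -1 else 0 :: rat"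
    have "(\<Sum>i\<in>I. qsc (?u i) (f i)) = (\<Sum>i\<in>{a, b}. qsc (?u i) (f i))"
      using fin ab by (intro sum.mono_neutral_right) auto
    also have "\<dots> = 0" using ab by simp
    finally show False using ind[of ?u] ab by auto
  qed
  show "qv.independent (f ` I)"
  proof
    assume "qv.dependent (f ` I)"
    then obtain u where u: "\<exists>v\<in>f ` I. u v \<noteq> 0" "(\<Sum>v\<in>f ` I. qsc (u v) v) = 0"
      unfolding qv.dependent_finite[OF finite_imageI[OF fin]] by blast
    have "(\<Sum>i\<in>I. qsc (u (f i)) (f i)) = 0" using u(2) by (simp add: sum.reindex[OF inj])
    from ind[OF this] u(1) show False by auto
  qed
qed

section \<open>Generic integers and Vandermonde arguments\<close>

lemma exists_nat_nonroot:
  assumes "finite F" "0 \<notin> F"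
  shows "\<exists>N::nat. \<forall>p\<in>F. poly p (of_nat N :: complex) \<noteq> 0"
proof -
  have "finite {x. poly p x = 0}" if "p \<in> F" for p
    using assms(2) that by (intro poly_roots_finite) auto
  then have "finite (\<Union>p\<in>F. {x. poly p x = 0})" using assms(1) by (intro finite_UN_I) auto
  then have "finite ((of_nat :: nat \<Rightarrow> complex) -` (\<Union>p\<in>F. {x. poly p x = 0}))"
    by (rule finite_vimageI) (rule inj_of_nat)
  then obtain N where "N \<notin> (of_nat :: nat \<Rightarrow> complex) -` (\<Union>p\<in>F. {x. poly p x = 0})"
    using ex_new_if_finite[OF infinite_UNIV_nat] by blast
  then show ?thesis by auto
qed

lemma poly_monoms: "poly (\<Sum>j<n. monom (c j) j) x = (\<Sum>j<n. c j * x ^ j :: complex)"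
  by (simp add: poly_sum poly_monom)

lemma monoms_eq_0:
  assumes "(\<Sum>j<n. monom (c j) j) = 0" "j < n" shows "c j = (0::complex)"
proof -
  have "coeff (\<Sum>j<n. monom (c j) j) j = (\<Sum>i<n. if i = j then c i else 0)"
    by (simp add: coeff_sum)
  then show ?thesis using assms by simp
qed

text \<open>The u j are the coefficients of a polynomial of degree below card A with card A distinct
  roots, so it is zero.\<close>

lemma vandermonde_rows:
  fixes x :: "'i \<Rightarrow> complex"
  assumes fin: "finite A" and inj: "inj_on x A" and z: "\<And>a. a \<in> A \<Longrightarrow> (\<Sum>j<card A. u j * x a ^ j) = 0" and j: "j < card A"
  shows "u j = 0"
proof -
  let ?p = "\<Sum>j<card A. monom (u j) j"
  have "?p = 0"
  proof (rule ccontr)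
    assume nz: "?p \<noteq> 0"
    have "degree ?p < card A"
    proof (rule degree_lessI)
      show "?p \<noteq> 0 \<or> 0 < card A" using nz by simp
      show "\<forall>k\<ge>card A. coeff ?p k = 0" by (auto simp: coeff_sum)
    qed
    moreover have "x ` A \<subseteq> {y. poly ?p y = 0}" using z by (auto simp: poly_monoms)
    then have "card A \<le> card {y. poly ?p y = 0}"
      using card_mono[OF poly_roots_finite[OF nz], of "x ` A"] card_image[OF inj] by simp
    moreover have "card {y. poly ?p y = 0} \<le> degree ?p" by (rule card_poly_roots_bound[OF nz])
    ultimately show False by simp
  qed
  then show ?thesis using j by (rule monoms_eq_0)
qed

text \<open>Testing the relation on the Lagrange polynomial that vanishes at all nodes except that
  of a isolates \<open>c a\<close>.\<close>

lemma vandermonde_columns: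
  fixes x c :: "'i \<Rightarrow> complex"
  assumes fin: "finite A" and inj: "inj_on x A" and z: "\<And>j. j < card A \<Longrightarrow> (\<Sum>a\<in>A. c a * x a ^ j) = 0" and a: "a \<in> A"
  shows "c a = 0"
proof -
  define p where "p = (\<Prod>b\<in>A - {a}. [:- x b, 1:])"
  have deg: "degree p < card A"
  proof -
    have "degree p = (\<Sum>b\<in>A - {a}. degree [:- x b, 1:])" unfolding p_def by (rule degree_prod_sum_eq) simp
    also have "\<dots> = card A - 1" using fin a by simp
    finally have "degree p = card A - 1" .
    moreover have "card A > 0" using fin a by (auto simp: card_gt_0_iff)
    ultimately show ?thesis by simp
  qed
  have pv: "poly p y = (\<Sum>j<card A. coeff p j * y ^ j)" for y
    unfolding poly_altdef using deg by (intro sum.mono_neutral_left) (auto simp: coeff_eq_0)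
  have "(\<Sum>b\<in>A. c b * poly p (x b)) = (\<Sum>j<card A. coeff p j * (\<Sum>b\<in>A. c b * x b ^ j))"
    unfolding pv sum_distrib_left by (subst sum.swap) (simp add: mult.left_commute)
  also have "\<dots> = 0" using z by simp
  finally have 0: "(\<Sum>b\<in>A. c b * poly p (x b)) = 0" .
  have "poly p (x b) = 0" if "b \<in> A" "b \<noteq> a" for b
    using that fin by (auto simp: p_def poly_prod prod_zero_iff)
  then have "(\<Sum>b\<in>A. c b * poly p (x b)) = c a * poly p (x a)"
    using fin a by (subst sum.remove[OF fin a]) simp
  moreover have "poly p (x a) \<noteq> 0"
    using fin a inj by (auto simp: p_def poly_prod prod_zero_iff inj_on_def)
  ultimately show ?thesis using 0 by simp
qed

section \<open>Rational matrices acting on forms\<close>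

lemma lin_qfapp: "lin (qfapp M)"
  by (auto simp: lin_def qfapp_def fapp_def fun_eq_iff fun_apply algebra_simps sum.distrib sum_distrib_left)

lemma qfapp_comp: "qfapp M (qfapp N \<phi>) = qfapp (\<lambda>S T. \<Sum>R\<in>Pow idx. M S R * N R T) \<phi>"
proof
  fix S
  have "(\<Sum>R\<in>Pow idx. of_rat (M S R) * (\<Sum>T\<in>Pow idx. of_rat (N R T) * \<phi> T))
      = (\<Sum>T\<in>Pow idx. (\<Sum>R\<in>Pow idx. of_rat (M S R) * of_rat (N R T)) * \<phi> T)"
    unfolding sum_distrib_left sum_distrib_right by (subst sum.swap) (simp add: mult.assoc)
  then show "qfapp M (qfapp N \<phi>) S = qfapp (\<lambda>S T. \<Sum>R\<in>Pow idx. M S R * N R T) \<phi> S"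
    by (simp add: qfapp_def fapp_def of_rat_sum of_rat_mult)
qed

lemma qfapp_id:
  assumes "valid_form \<phi>" shows "qfapp (\<lambda>S T. if S = T then 1 else 0) \<phi> = \<phi>"
proof
  fix S
  have "(\<Sum>T\<in>Pow idx. of_rat (if S = T then 1 else 0) * \<phi> T) = (\<Sum>T\<in>Pow idx. if T = S then \<phi> T else 0)"
    by (intro sum.cong) auto
  also have "\<dots> = (if S \<in> Pow idx then \<phi> S else 0)" by (rule sum.delta) simp
  finally show "qfapp (\<lambda>S T. if S = T then 1 else 0) \<phi> S = \<phi> S"
    using assms by (auto simp: qfapp_def fapp_def valid_form_def)
qed

lemma qfapp_add: "qfapp (\<lambda>S T. M S T + N S T) \<phi> = qfapp M \<phi> + qfapp N \<phi>"
  and qfapp_scale: "qfapp (\<lambda>S T. q * M S T) \<phi> = sc (of_rat q) (qfapp M \<phi>)"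
  and qfapp_zero: "qfapp (\<lambda>S T. 0) \<phi> = 0"
  by (auto simp: qfapp_def fapp_def fun_eq_iff fun_apply of_rat_add of_rat_mult algebra_simps sum.distrib sum_distrib_left)

text \<open>The abstract situation behind complex multiplication: the complexification of L has a
  basis e adapted to the Hodge decomposition, \<open>w i\<close> being the p of \<open>e i\<close>,
  and a rational operator T is diagonal in it with simple spectrum.\<close>

locale diag_rational =
  fixes L :: "complex form set" and hp :: "nat \<Rightarrow> complex form set" and k :: nat
    and I :: "'i set" and e :: "'i \<Rightarrow> complex form" and w :: "'i \<Rightarrow> nat"
    and T :: "nat set \<Rightarrow> nat set \<Rightarrow> rat" and t :: "'i \<Rightarrow> complex"
  assumes fin: "finite I"
    and L_valid: "\<And>\<phi>. \<phi> \<in> L \<Longrightarrow> valid_form \<phi>"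
    and L_dim: "has_qdim L (card I)"
    and U_eq: "span_in UNIV L = range (\<lambda>c. \<Sum>i\<in>I. sc (c i) (e i))"
    and e_ind: "\<And>c. (\<Sum>i\<in>I. sc (c i) (e i)) = 0 \<Longrightarrow> \<forall>i\<in>I. c i = 0"
    and hp_eq: "\<And>p. p \<le> k \<Longrightarrow> hp p = {(\<Sum>i\<in>I. sc (c i) (e i)) | c. \<forall>i\<in>I. c i \<noteq> 0 \<longrightarrow> w i = p}"
    and T_L: "qfapp T ` L \<subseteq> L"
    and T_e: "\<And>i. i \<in> I \<Longrightarrow> qfapp T (e i) = sc (t i) (e i)"
    and t_inj: "inj_on t I"
begin

abbreviation "U \<equiv> span_in UNIV L"

lemma e_U: assumes "i \<in> I" shows "e i \<in> U"
proof -
  have "(\<Sum>j\<in>I. sc (if j = i then 1 else 0) (e j)) = (\<Sum>j\<in>I. if j = i then e j else 0)"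
    by (intro sum.cong) auto
  also have "\<dots> = e i" using assms fin by simp
  finally have "(\<Sum>j\<in>I. sc (if j = i then 1 else 0) (e j)) = e i" .
  moreover have "(\<Sum>j\<in>I. sc (if j = i then 1 else 0) (e j)) \<in> U" unfolding U_eq by (rule rangeI)
  ultimately show ?thesis by simp
qed

lemma e_nz: assumes "i \<in> I" shows "e i \<noteq> 0"
proof
  assume 0: "e i = 0"
  have "(\<Sum>j\<in>I. sc (if j = i then 1 else 0) (e j)) = 0" using 0 by (intro sum.neutral) auto
  from e_ind[OF this] assms show False by auto
qed

lemma comb_eq:
  assumes "(\<Sum>i\<in>I. sc (c i) (e i)) = (\<Sum>i\<in>I. sc (d i) (e i))" "i \<in> I" shows "c i = d i"
proof -
  have "(\<Sum>i\<in>I. sc (c i - d i) (e i)) = 0"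
    using assms(1) by (simp add: sc.scale_left_diff_distrib sum_subtractf)
  from e_ind[OF this] assms(2) show ?thesis by simp
qed

lemma U_valid: assumes "\<phi> \<in> U" shows "valid_form \<phi>"
proof -
  have "U \<subseteq> {\<phi>. valid_form \<phi>}"
    by (rule span_in_minimal) (auto simp: valid_form_add valid_form_sc L_valid)
  then show ?thesis using assms by blast
qed

lemma L_U: "L \<subseteq> U" using span_in_base[OF qclosed_UNIV] by blast

definition diag :: "(nat set \<Rightarrow> nat set \<Rightarrow> rat) \<Rightarrow> ('i \<Rightarrow> complex) \<Rightarrow> bool" where
  "diag M c \<longleftrightarrow> qfapp M ` L \<subseteq> L \<and> (\<forall>i\<in>I. qfapp M (e i) = sc (c i) (e i))"

text \<open>All rational operators diagonal in the basis e, and not just polynomials in T: this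
  gives closure under the algebra operations directly, and being diagonal in an adapted basis they
  respect the Hodge decomposition.\<close>

definition Alg :: "(complex form \<Rightarrow> complex form) set" where
  "Alg = {restr_end L M | M c. diag M c}"

lemma diag_comb: "diag M c \<Longrightarrow> qfapp M (\<Sum>i\<in>I. sc (a i) (e i)) = (\<Sum>i\<in>I. sc (a i * c i) (e i))"
  by (simp add: lin_sum[OF lin_qfapp] lin_sc[OF lin_qfapp] diag_def)

lemma diag_U: "diag M c \<Longrightarrow> \<phi> \<in> U \<Longrightarrow> qfapp M \<phi> \<in> U"
  unfolding U_eq using diag_comb by fastforce

lemma diag_mult: "diag M c \<Longrightarrow> diag N d \<Longrightarrow> diag (\<lambda>S T. \<Sum>R\<in>Pow idx. M S R * N R T) (\<lambda>i. c i * d i)"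
  unfolding diag_def qfapp_comp[symmetric]
  by (intro conjI ballI image_subsetI) (blast, simp add: lin_sc[OF lin_qfapp] mult.commute)

lemma L_space: "0 \<in> L" "\<phi> \<in> L \<Longrightarrow> \<psi> \<in> L \<Longrightarrow> \<phi> + \<psi> \<in> L" "\<phi> \<in> L \<Longrightarrow> sc (of_rat q) \<phi> \<in> L"
proof -
  obtain vs where L: "L = span_in \<rat> (set vs)" using L_dim by (auto simp: has_qdim_def)
  show "0 \<in> L" "\<phi> \<in> L \<Longrightarrow> \<psi> \<in> L \<Longrightarrow> \<phi> + \<psi> \<in> L" "\<phi> \<in> L \<Longrightarrow> sc (of_rat q) \<phi> \<in> L"
    unfolding L by (auto intro: span_in_0 span_in_add span_in_sc[OF qclosed_Rats])
qed

lemma diag_add: "diag M c \<Longrightarrow> diag N d \<Longrightarrow> diag (\<lambda>S T. M S T + N S T) (\<lambda>i. c i + d i)"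
  unfolding diag_def qfapp_add by (auto simp: sc.scale_left_distrib intro!: L_space)

lemma diag_scale: "diag M c \<Longrightarrow> diag (\<lambda>S T. q * M S T) (\<lambda>i. of_rat q * c i)"
  unfolding diag_def qfapp_scale by (auto intro!: L_space)

lemma diag_zero: "diag (\<lambda>S T. 0) (\<lambda>i. 0)"
  unfolding diag_def qfapp_zero using L_space(1) by auto

lemma diag_id: "diag (\<lambda>S T. if S = T then 1 else 0) (\<lambda>i. 1)"
  unfolding diag_def using qfapp_id L_valid U_valid e_U by auto

lemma restr_U: "\<phi> \<in> U \<Longrightarrow> restr_end L M \<phi> = qfapp M \<phi>" and restr_notU: "\<phi> \<notin> U \<Longrightarrow> restr_end L M \<phi> = 0"
  by (simp_all add: restr_end_def zero_fun_def)

lemma restr_comp: assumes "diag N d" shows "restr_end L M \<circ> restr_end L N = restr_end L (\<lambda>S T. \<Sum>R\<in>Pow idx. M S R * N R T)"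
proof
  fix \<phi>
  have "0 \<in> U" by (rule span_in_0)
  then show "(restr_end L M \<circ> restr_end L N) \<phi> = restr_end L (\<lambda>S T. \<Sum>R\<in>Pow idx. M S R * N R T) \<phi>"
    using diag_U[OF assms] by (cases "\<phi> \<in> U") (simp_all add: restr_U restr_notU qfapp_comp lin_0[OF lin_qfapp])
qed

lemma restr_eq:
  assumes "diag M c" "diag N d" "\<And>i. i \<in> I \<Longrightarrow> c i = d i" shows "restr_end L M = restr_end L N"
proof
  fix \<phi>
  show "restr_end L M \<phi> = restr_end L N \<phi>"
  proof (cases "\<phi> \<in> U")
    case True
    then obtain a where \<phi>: "\<phi> = (\<Sum>i\<in>I. sc (a i) (e i))" unfolding U_eq by blast
    have "qfapp M \<phi> = qfapp N \<phi>" unfolding \<phi> diag_comb[OF assms(1)] diag_comb[OF assms(2)]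
      by (intro sum.cong refl) (simp add: assms(3))
    then show ?thesis using True by (simp add: restr_U)
  qed (simp add: restr_notU)
qed

lemma restr_zero: "restr_end L (\<lambda>S T. 0) = end_zero"
  by (auto simp: fun_eq_iff restr_end_def end_zero_def qfapp_zero fun_apply)

lemma restr_id: "restr_end L (\<lambda>S T. if S = T then 1 else 0) = end_id L"
  using qfapp_id U_valid by (auto simp: fun_eq_iff restr_end_def end_id_def)

lemma Alg_subalgebra: "q_subalgebra L Alg"
  unfolding q_subalgebra_def
proof (intro conjI ballI)
  show "end_id L \<in> Alg" unfolding Alg_def restr_id[symmetric] using diag_id by blast
  show "end_zero \<in> Alg" unfolding Alg_def restr_zero[symmetric] using diag_zero by blast
  fix E F assume "E \<in> Alg" "F \<in> Alg"
  then obtain M c N d where M: "diag M c" "E = restr_end L M" and N: "diag N d" "F = restr_end L N"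
    unfolding Alg_def by blast
  have "end_add E F = restr_end L (\<lambda>S T. M S T + N S T)"
    by (auto simp: M N end_add_def restr_end_def fun_eq_iff qfapp_add fun_apply)
  then show "end_add E F \<in> Alg" unfolding Alg_def using diag_add[OF M(1) N(1)] by blast
  show "E \<circ> F \<in> Alg" unfolding M N restr_comp[OF N(1)] Alg_def using diag_mult[OF M(1) N(1)] by blast
next
  fix q :: complex and E assume "q \<in> \<rat>" "E \<in> Alg"
  then obtain M c r where M: "diag M c" "E = restr_end L M" and q: "q = of_rat r"
    unfolding Alg_def by (auto elim: Rats_cases)
  have "end_scale q E = restr_end L (\<lambda>S T. r * M S T)"
    by (auto simp: M q end_scale_def restr_end_def fun_eq_iff qfapp_scale fun_apply)
  then show "end_scale q E \<in> Alg" unfolding Alg_def using diag_scale[OF M(1)] by blast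
qed

lemma Alg_commute: assumes "E \<in> Alg" "F \<in> Alg" shows "E \<circ> F = F \<circ> E"
proof -
  obtain M c N d where M: "diag M c" "E = restr_end L M" and N: "diag N d" "F = restr_end L N"
    using assms unfolding Alg_def by blast
  show ?thesis unfolding M(2) N(2) restr_comp[OF N(1)] restr_comp[OF M(1)]
    by (rule restr_eq[OF diag_mult[OF M(1) N(1)] diag_mult[OF N(1) M(1)]]) simp
qed

text \<open>Repeating one member of a nilpotent ideal shows that a power of each of its eigenvalues
  is zero, and a diagonal operator with zero eigenvalues is zero.\<close>

lemma Alg_semisimple: "semisimple_alg L Alg"
  unfolding semisimple_alg_def
proof (intro allI impI)
  fix J assume J: "ideal_in Alg J \<and> nilpotent_ideal L J"
  then obtain n where n: "n > 0" "\<And>xs. length xs = n \<Longrightarrow> set xs \<subseteq> J \<Longrightarrow> foldr (\<circ>) xs (end_id L) = end_zero"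
    unfolding nilpotent_ideal_def by blast
  have "E = end_zero" if E: "E \<in> J" for E
  proof -
    obtain M c where M: "diag M c" "E = restr_end L M" using E J unfolding ideal_in_def Alg_def by blast
    have pow: "foldr (\<circ>) (replicate m E) (end_id L) (e i) = sc (c i ^ m) (e i)" if i: "i \<in> I" for m i
    proof (induction m)
      case 0 then show ?case using e_U[OF i] by (simp add: end_id_def)
    next
      case (Suc m)
      have "sc (c i ^ m) (e i) \<in> U" using e_U[OF i] by (intro span_in_sc qclosed_UNIV) auto
      then have "E (sc (c i ^ m) (e i)) = sc (c i ^ Suc m) (e i)"
        using M i by (simp add: restr_U lin_sc[OF lin_qfapp] diag_def mult.commute)
      then show ?case using Suc by simp
    qed
    have "c i = 0" if i: "i \<in> I" for i
    proof -
      have "foldr (\<circ>) (replicate n E) (end_id L) = end_zero" by (rule n(2)) (use E in auto)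
      then have "sc (c i ^ n) (e i) = 0" using pow[OF i, of n] by (simp add: end_zero_def zero_fun_def)
      then show ?thesis using e_nz[OF i] by simp
    qed
    then have "restr_end L M = restr_end L (\<lambda>S T. 0)" by (intro restr_eq[OF M(1) diag_zero])
    then show ?thesis using M(2) restr_zero by simp
  qed
  moreover have "end_zero \<in> J" using J by (simp add: ideal_in_def)
  ultimately show "J = {end_zero}" by blast
qed

lemma Alg_hdg: "Alg \<subseteq> hdg_end L hp k"
proof
  fix E assume "E \<in> Alg"
  then obtain M c where M: "diag M c" "E = restr_end L M" unfolding Alg_def by blast
  have "qfapp M ` hp p \<subseteq> hp p" if pk: "p \<le> k" for p
  proof
    fix y assume "y \<in> qfapp M ` hp p"
    then obtain a where a: "\<forall>i\<in>I. a i \<noteq> 0 \<longrightarrow> w i = p" "y = qfapp M (\<Sum>i\<in>I. sc (a i) (e i))"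
      unfolding hp_eq[OF pk] by blast
    have "y = (\<Sum>i\<in>I. sc (a i * c i) (e i))" unfolding a(2) by (rule diag_comb[OF M(1)])
    moreover have "\<forall>i\<in>I. a i * c i \<noteq> 0 \<longrightarrow> w i = p" using a(1) by auto
    ultimately show "y \<in> hp p"
      unfolding hp_eq[OF pk] by (intro CollectI exI[of _ "\<lambda>i. a i * c i"] conjI)
  qed
  then show "E \<in> hdg_end L hp k" using M unfolding hdg_end_def diag_def by blast
qed

text \<open>No eigencoordinate can vanish on all of L, since L spans over the complex numbers. Along
  the rational curve with coefficients N^j on a basis of L, each eigencoordinate is a nonzero
  polynomial in N, so some integer avoids all roots.\<close>

lemma generic_vector: "\<exists>v\<in>L. \<exists>a. v = (\<Sum>i\<in>I. sc (a i) (e i)) \<and> (\<forall>i\<in>I. a i \<noteq> 0)"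
proof -
  let ?n = "card I"
  obtain vs where vs: "length vs = ?n" "set vs \<subseteq> L" "L = span_in \<rat> (set vs)"
    using L_dim by (auto simp: has_qdim_def)
  have "\<forall>j<?n. \<exists>c. vs ! j = (\<Sum>i\<in>I. sc (c i) (e i))"
  proof (intro allI impI)
    fix j assume "j < ?n"
    then have "vs ! j \<in> set vs" using vs(1) by simp
    then have "vs ! j \<in> U" using vs(2) L_U by blast
    then show "\<exists>c. vs ! j = (\<Sum>i\<in>I. sc (c i) (e i))" unfolding U_eq by blast
  qed
  then obtain C where C: "\<And>j. j < ?n \<Longrightarrow> vs ! j = (\<Sum>i\<in>I. sc (C j i) (e i))" by metis
  define p where "p i = (\<Sum>j<?n. monom (C j i) j)" for i
  have p0: "p i \<noteq> 0" if i: "i \<in> I" for i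
  proof
    assume "p i = 0"
    then have Ci: "C j i = 0" if "j < ?n" for j 
      using monoms_eq_0[of "\<lambda>j. C j i" ?n j] that unfolding p_def by blast
    \<comment> \<open>The hyperplane where the i-th eigencoordinate is zero. It would contain L,
      hence the complex span, hence \<open>e i\<close> itself.\<close>
    let ?Y = "{(\<Sum>j\<in>I. sc (c j) (e j)) | c. c i = 0}"
    have Y0: "0 \<in> ?Y" by (intro CollectI exI[of _ "\<lambda>_. 0"]) simp
    have Yadd: "\<phi> + \<psi> \<in> ?Y" if Y: "\<phi> \<in> ?Y" "\<psi> \<in> ?Y" for \<phi> \<psi>
    proof -
      obtain c d where c: "\<phi> = (\<Sum>j\<in>I. sc (c j) (e j))" "c i = 0" and d: "\<psi> = (\<Sum>j\<in>I. sc (d j) (e j))" "d i = 0"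
        using Y by blast
      have "\<phi> + \<psi> = (\<Sum>j\<in>I. sc (c j + d j) (e j))" unfolding c(1) d(1) by (simp add: sc.scale_left_distrib sum.distrib)
      then show ?thesis using c(2) d(2) by (intro CollectI exI[of _ "\<lambda>j. c j + d j"]) simp
    qed
    have Ysc: "sc q \<phi> \<in> ?Y" if Y: "\<phi> \<in> ?Y" for q \<phi>
    proof -
      obtain c where c: "\<phi> = (\<Sum>j\<in>I. sc (c j) (e j))" "c i = 0" using Y by blast
      have "sc q \<phi> = (\<Sum>j\<in>I. sc (q * c j) (e j))" unfolding c(1) by (simp add: sc.scale_sum_right)
      then show ?thesis using c(2) by (intro CollectI exI[of _ "\<lambda>j. q * c j"]) simp
    qed
    have vsY: "set vs \<subseteq> ?Y"
    proof
      fix x assume "x \<in> set vs"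
      then obtain j where j: "j < ?n" "x = vs ! j" using vs(1) by (auto simp: in_set_conv_nth)
      then show "x \<in> ?Y" using C[OF j(1)] Ci[OF j(1)] by blast
    qed
    have LY: "L \<subseteq> ?Y" unfolding vs(3)
    proof (rule span_in_minimal[OF Y0 Yadd])
      show "sc c v \<in> ?Y" if "v \<in> set vs" for c v by (rule Ysc[OF subsetD[OF vsY that]])
    qed
    have "U \<subseteq> ?Y"
    proof (rule span_in_minimal[OF Y0 Yadd])
      show "sc c v \<in> ?Y" if "v \<in> L" for c v by (rule Ysc[OF subsetD[OF LY that]])
    qed
    then have "e i \<in> ?Y" using e_U[OF i] by blast
    then obtain c where c: "e i = (\<Sum>j\<in>I. sc (c j) (e j))" "c i = 0" by blast
    have "(\<Sum>j\<in>I. sc (if j = i then 1 else 0) (e j)) = (\<Sum>j\<in>I. if j = i then e j else 0)"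
      by (intro sum.cong) auto
    also have "\<dots> = e i" using i fin by simp
    finally have "(\<Sum>j\<in>I. sc (if j = i then 1 else 0) (e j)) = (\<Sum>j\<in>I. sc (c j) (e j))" using c(1) by simp
    from comb_eq[OF this i] c(2) show False by simp
  qed
  obtain N :: nat where N: "\<And>i. i \<in> I \<Longrightarrow> poly (p i) (of_nat N) \<noteq> 0"
    using exists_nat_nonroot[of "p ` I"] fin p0 by fastforce
  define v where "v = (\<Sum>j<?n. sc (of_nat N ^ j) (vs ! j))"
  have vL: "v \<in> L" unfolding vs(3) v_def using vs(1)
    by (intro span_in_sum span_in_sc span_in_base qclosed_Rats) auto
  have v: "v = (\<Sum>i\<in>I. sc (poly (p i) (of_nat N)) (e i))"
  proof -
    have "v = (\<Sum>j<?n. \<Sum>i\<in>I. sc (of_nat N ^ j * C j i) (e i))"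
      unfolding v_def by (intro sum.cong refl) (simp add: C sc.scale_sum_right)
    also have "\<dots> = (\<Sum>i\<in>I. \<Sum>j<?n. sc (of_nat N ^ j * C j i) (e i))" by (rule sum.swap)
    also have "\<dots> = (\<Sum>i\<in>I. sc (poly (p i) (of_nat N)) (e i))"
      unfolding p_def poly_monoms by (simp add: sc.scale_sum_left mult.commute)
    finally show ?thesis .
  qed
  show ?thesis
  proof (rule bexI[OF _ vL], rule exI[of _ "\<lambda>i. poly (p i) (of_nat N)"], rule conjI[OF v])
    show "\<forall>i\<in>I. poly (p i) (of_nat N) \<noteq> 0" using N by blast
  qed
qed

lemma end_uncurry_add: "end_uncurry (end_add E F) = end_uncurry E + end_uncurry F"
  and end_uncurry_scale: "end_uncurry (end_scale c E) = sc c (end_uncurry E)"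
  and end_uncurry_zero: "end_uncurry end_zero = 0"
  by (auto simp: fun_eq_iff end_uncurry_def end_add_def end_scale_def end_zero_def fun_apply)

text \<open>Evaluation at a vector with no zero eigencoordinate is injective on the algebra and
  lands in L, which bounds the dimension above. The powers of T with exponent below card I are
  independent by the simple spectrum, which bounds it below.\<close>

lemma Alg_dim: "has_qdim (end_uncurry ` Alg) (card I)"
proof -
  let ?n = "card I" and ?W = "end_uncurry ` Alg"
  have sub: "qv.subspace ?W"
    unfolding qv.subspace_def
  proof (intro conjI ballI allI)
    show "0 \<in> ?W" using Alg_subalgebra end_uncurry_zero unfolding q_subalgebra_def by (metis imageI)
    show "f + h \<in> ?W" if "f \<in> ?W" "h \<in> ?W" for f h
      using that Alg_subalgebra unfolding q_subalgebra_def by (auto simp: end_uncurry_add[symmetric])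
    show "qsc q f \<in> ?W" if "f \<in> ?W" for q f
      using that Alg_subalgebra unfolding q_subalgebra_def by (auto simp: qsc_def end_uncurry_scale[symmetric])
  qed
  \<comment> \<open>At this point B is only a maximal independent set; its finiteness comes from
    embedding it in L.\<close>
  obtain B where B: "B \<subseteq> ?W" "qv.independent B" "?W \<subseteq> qv.span B"
    using qv.maximal_independent_subset[of ?W] by blast
  obtain v a where v: "v \<in> L" "v = (\<Sum>i\<in>I. sc (a i) (e i))" "\<And>i. i \<in> I \<Longrightarrow> a i \<noteq> 0"
    using generic_vector by blast
  \<comment> \<open>Evaluation at the generic vector v, in the uncurried picture in which
    endomorphisms are functions of (form, index set).\<close>
  define ev where "ev f = (\<lambda>S. f (v, S))" for f :: "complex form \<times> nat set \<Rightarrow> complex"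
  have ev_sum: "ev (\<Sum>f\<in>A. qsc (u f) f) = (\<Sum>f\<in>A. qsc (u f) (ev f))" for A u
    by (rule ext) (simp add: ev_def sum_fun_apply qsc_def fun_apply)
  have ev_diff: "ev (f - h) = ev f - ev h" for f h
    by (rule ext) (simp add: ev_def fun_apply)
  have ev_W: "ev f \<in> L" and ev_0: "ev f = 0 \<Longrightarrow> f = 0" if f: "f \<in> ?W" for f
  proof -
    obtain M c where M: "diag M c" "f = end_uncurry (restr_end L M)" using f unfolding Alg_def by blast
    have evf: "ev f = qfapp M v" unfolding M(2) ev_def end_uncurry_def using v(1) L_U by (auto simp: restr_U)
    show "ev f \<in> L" unfolding evf using M(1) v(1) by (auto simp: diag_def)
    show "f = 0" if "ev f = 0"
    proof -
      have "(\<Sum>i\<in>I. sc (a i * c i) (e i)) = 0" using that unfolding evf v(2) diag_comb[OF M(1)] .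
      from e_ind[OF this] have "c i = 0" if "i \<in> I" for i using v(3) that by auto
      then have "restr_end L M = restr_end L (\<lambda>S T. 0)" by (intro restr_eq[OF M(1) diag_zero])
      then show ?thesis unfolding M(2) restr_zero by (simp add: end_uncurry_zero)
    qed
  qed
  have ev_inj: "inj_on ev ?W"
  proof (rule inj_onI)
    fix f h assume fh: "f \<in> ?W" "h \<in> ?W" "ev f = ev h"
    have "f - h \<in> ?W" using qv.subspace_diff[OF sub fh(1,2)] .
    moreover have "ev (f - h) = 0" using fh(3) by (simp add: ev_diff)
    ultimately have "f - h = 0" using ev_0 by blast
    then show "f = h" by simp
  qed
  have evB: "qv.independent (ev ` B)"
    unfolding qv.independent_explicit_finite_subsets
  proof (intro allI impI ballI)
    fix S u x assume S: "S \<subseteq> ev ` B" "finite S" and 0: "(\<Sum>x\<in>S. qsc (u x) x) = 0" and x: "x \<in> S"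
    obtain S' where S': "S' \<subseteq> B" "finite S'" "S = ev ` S'" using finite_subset_image[OF S(2,1)] by blast
    have inj': "inj_on ev S'" using ev_inj S'(1) B(1) by (meson inj_on_subset subset_trans)
    have "ev (\<Sum>f\<in>S'. qsc (u (ev f)) f) = 0"
      using 0 unfolding S'(3) ev_sum by (simp add: sum.reindex[OF inj'])
    moreover have "(\<Sum>f\<in>S'. qsc (u (ev f)) f) \<in> ?W"
      using S'(1) B(1) by (intro qv.subspace_sum[OF sub] qv.subspace_scale[OF sub]) auto
    ultimately have "(\<Sum>f\<in>S'. qsc (u (ev f)) f) = 0" using ev_0 by blast
    then have "u (ev f) = 0" if "f \<in> S'" for f
      using qv.independentD[OF B(2) S'(2,1), of "\<lambda>f. u (ev f)"] that by blast
    then show "u x = 0" using x S'(3) by auto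
  qed
  obtain vs where vs: "length vs = ?n" "distinct vs" "L = span_in \<rat> (set vs)"
    using L_dim by (auto simp: has_qdim_def)
  have "ev ` B \<subseteq> qv.span (set vs)" using ev_W B(1) vs(3) span_in_Rats by blast
  then have bnd: "finite (ev ` B) \<and> card (ev ` B) \<le> card (set vs)"
    by (intro qv.independent_span_bound evB) auto
  have injB: "inj_on ev B" using ev_inj B(1) by (rule inj_on_subset)
  have finB: "finite B" using bnd finite_imageD injB by blast
  have le: "card B \<le> ?n" using bnd card_image[OF injB] distinct_card[OF vs(2)] vs(1) by simp
  have "\<exists>M. diag M (\<lambda>i. t i ^ j)" for j
  proof (induction j)
    case 0 then show ?case using diag_id by auto
  next
    case (Suc j)
    then obtain M where "diag M (\<lambda>i. t i ^ j)" by blast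
    moreover have "diag T t" using T_L T_e by (simp add: diag_def)
    ultimately have "diag (\<lambda>S Ta. \<Sum>R\<in>Pow idx. T S R * M R Ta) (\<lambda>i. t i * t i ^ j)" by (rule diag_mult[rotated])
    then show ?case by auto
  qed
  then obtain M where M: "\<And>j. diag (M j) (\<lambda>i. t i ^ j)" by metis
  define tau where "tau j = end_uncurry (restr_end L (M j))" for j
  have tau_ind: "\<forall>j\<in>{..<?n}. u j = 0" if 0: "(\<Sum>j\<in>{..<?n}. qsc (u j) (tau j)) = 0" for u
  proof -
    have z: "(\<Sum>j<?n. of_rat (u j) * t i ^ j) = 0" if i: "i \<in> I" for i
    proof -
      obtain S where S: "e i S \<noteq> 0" using e_nz[OF i] by (auto simp: fun_eq_iff fun_apply)
      have "tau j (e i, S) = t i ^ j * e i S" for j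
        using M[of j] i e_U[OF i] by (simp add: tau_def end_uncurry_def restr_U diag_def fun_apply)
      then have "(\<Sum>j<?n. of_rat (u j) * t i ^ j) * e i S = (\<Sum>j\<in>{..<?n}. qsc (u j) (tau j)) (e i, S)"
        by (simp add: sum_fun_apply qsc_def fun_apply sum_distrib_right mult.assoc)
      then show ?thesis using S 0 by (simp add: fun_apply)
    qed
    have "complex_of_rat (u j) = 0" if "j < ?n" for j
      by (rule vandermonde_rows[OF fin t_inj z that])
    then show ?thesis by auto
  qed
  have tau_fam: "inj_on tau {..<?n}" "qv.independent (tau ` {..<?n})"
    using qv_family[of "{..<?n}" tau] tau_ind by blast+
  have "tau ` {..<?n} \<subseteq> qv.span B" using B(3) M unfolding tau_def Alg_def by blast
  then have "card (tau ` {..<?n}) \<le> card B"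
    using qv.independent_span_bound[OF finB tau_fam(2)] by blast
  then have "card B = ?n" using le card_image[OF tau_fam(1)] by simp
  moreover have "?W = qv.span B" using B(1,3) qv.span_minimal[OF B(1) sub] by blast
  ultimately show ?thesis using has_qdim_basis[OF finB B(2)] by simp
qed

lemma cm: "cm_type L hp k"
  unfolding cm_type_def using Alg_hdg Alg_subalgebra Alg_commute Alg_semisimple Alg_dim L_dim by blast

end

context mirror begin

section \<open>A rational derivation with simple spectrum on k-forms\<close>

primrec Tpow :: "nat \<Rightarrow> rat mat" where
  "Tpow 0 = (\<lambda>K L. if K = L then 1 else 0)"
| "Tpow (Suc j) = (\<lambda>K L. \<Sum>M\<in>idx. T1 K M * Tpow j M L)"

lemma Tpow_z: "i \<in> idx \<Longrightarrow> A \<in> idx \<Longrightarrow> (\<Sum>L\<in>idx. of_rat (Tpow j A L) * z i L) = t i ^ j * z i A"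
proof (induction j arbitrary: A)
  case 0
  have "(\<Sum>L\<in>idx. of_rat (Tpow 0 A L) * z i L) = (\<Sum>L\<in>idx. z i L * (if A = L then 1 else 0))"
    by (intro sum.cong refl) auto
  also have "\<dots> = z i A" using 0 by (simp only: sum_delta_idx)
  finally show ?case by simp
next
  case (Suc j)
  have "(\<Sum>L\<in>idx. of_rat (Tpow (Suc j) A L) * z i L) = (\<Sum>L\<in>idx. \<Sum>M\<in>idx. of_rat (T1 A M) * (of_rat (Tpow j M L) * z i L))"
    by (simp add: of_rat_sum of_rat_mult sum_distrib_right mult.assoc)
  also have "\<dots> = (\<Sum>M\<in>idx. of_rat (T1 A M) * (\<Sum>L\<in>idx. of_rat (Tpow j M L) * z i L))"
    unfolding sum_distrib_left by (rule sum.swap)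
  also have "\<dots> = (\<Sum>M\<in>idx. t i ^ j * (of_rat (T1 A M) * z i M))"
    by (intro sum.cong refl) (simp add: Suc mult.left_commute)
  also have "\<dots> = t i ^ j * (t i * z i A)" using Suc.prems by (simp add: T1_z flip: sum_distrib_left)
  finally show ?case by simp
qed

text \<open>A polynomial in \<open>T1\<close> with coefficients N^j. Four powers suffice, one for
  each of the four distinct eigenvalues, and N is left free for the generic choice.\<close>

definition Xmat :: "nat \<Rightarrow> rat mat" where
  "Xmat N A L = (\<Sum>j<4. of_nat N ^ j * Tpow j A L)"

text \<open>The eigenvalues of \<open>Xmat N\<close>. By the Vandermonde determinant, distinct index sets give distinct polynomials
  in \<open>N\<close> as sums of eigenvalues, so a suitable \<open>N\<close> separates all of them.\<close>

definition xval :: "nat \<Rightarrow> nat \<Rightarrow> complex" where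
  "xval N i = (\<Sum>j<4. of_nat N ^ j * t i ^ j)"

lemma Xmat_zt:
  assumes "i \<in> idx" "L \<in> idx" shows "(\<Sum>A\<in>idx. zt i A * of_rat (Xmat N A L)) = xval N i * zt i L"
proof (rule eigen_dual[OF _ assms])
  fix i A assume iA: "i \<in> idx" "A \<in> idx"
  have "(\<Sum>L\<in>idx. of_rat (Xmat N A L) * z i L) = (\<Sum>L\<in>idx. \<Sum>j<4. of_nat N ^ j * (of_rat (Tpow j A L) * z i L))"
    by (simp add: Xmat_def of_rat_sum of_rat_mult of_rat_power sum_distrib_right mult.assoc)
  also have "\<dots> = (\<Sum>j<4. of_nat N ^ j * (\<Sum>L\<in>idx. of_rat (Tpow j A L) * z i L))"
    unfolding sum_distrib_left by (rule sum.swap)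
  also have "\<dots> = xval N i * z i A"
    using iA by (simp add: Tpow_z xval_def sum_distrib_right mult.assoc)
  finally show "(\<Sum>L\<in>idx. of_rat (Xmat N A L) * z i L) = xval N i * z i A" .
qed

lemma distinct_sums: "\<exists>N. inj_on (\<lambda>S. \<Sum>i\<in>S. xval N i) (Pow idx)"
proof -
  define d where "d S S' j = (\<Sum>i\<in>S. t i ^ j) - (\<Sum>i\<in>S'. t i ^ j)" for S S' and j :: nat
  define p where "p = (\<lambda>(S, S'). \<Sum>j<4. monom (d S S' j) j)"
  let ?P = "{(S, S'). S \<subseteq> idx \<and> S' \<subseteq> idx \<and> S \<noteq> S'}"
  have "finite ?P" by (rule finite_subset[of _ "Pow idx \<times> Pow idx"]) auto
  then have finP: "finite (p ` ?P)" by simp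
  have nz: "p (S, S') \<noteq> 0" if S: "S \<subseteq> idx" "S' \<subseteq> idx" "S \<noteq> S'" for S S'
  proof
    assume 0: "p (S, S') = 0"
    have d0: "d S S' j = 0" if "j < 4" for j
      using monoms_eq_0[of "d S S'" 4 j] 0 that by (simp add: p_def)
    \<comment> \<open>The difference of the indicators of S and S'. If the polynomial were zero, its
      first four moments against the t i would vanish, and the Vandermonde argument would make it
      zero at each index.\<close>
    let ?c = "\<lambda>i. (if i \<in> S then 1 else 0) - (if i \<in> S' then 1 else 0) :: complex"
    have "?c i = 0" if i: "i \<in> idx" for i
    proof (rule vandermonde_columns[OF finite_idx t_inj _ i])
      fix j assume "j < card idx"
      then have j: "j < 4" by (simp add: idx_def)
      have e: "(\<Sum>i\<in>idx. (if i \<in> R then 1 else 0) * t i ^ j) = (\<Sum>i\<in>R. t i ^ j)" if "R \<subseteq> idx" for R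
      proof -
        have "(\<Sum>i\<in>idx. (if i \<in> R then 1 else 0) * t i ^ j) = (\<Sum>i\<in>idx. if i \<in> R then t i ^ j else 0)"
          by (intro sum.cong) auto
        also have "\<dots> = (\<Sum>i\<in>idx \<inter> R. t i ^ j)" by (simp add: sum.inter_restrict)
        finally show ?thesis using that by (simp add: Int_absorb1)
      qed
      show "(\<Sum>i\<in>idx. ?c i * t i ^ j) = 0"
        using d0[OF j] e[OF S(1)] e[OF S(2)] by (simp add: left_diff_distrib sum_subtractf d_def)
    qed
    then have "(i \<in> S) = (i \<in> S')" if "i \<in> idx" for i using that by (force split: if_splits)
    then have "S = S'" using S by blast
    then show False using S(3) by simp
  qed
  obtain N where N: "\<forall>r\<in>p ` ?P. poly r (of_nat N :: complex) \<noteq> 0"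
  proof -
    have "0 \<notin> p ` ?P"
    proof
      assume "0 \<in> p ` ?P"
      then show False
      proof (rule imageE)
        fix x assume "0 = p x" "x \<in> ?P"
        then show False using nz[of "fst x" "snd x"] by (cases x) simp
      qed
    qed
    from exists_nat_nonroot[OF finP this] that show ?thesis by blast
  qed
  have "inj_on (\<lambda>S. \<Sum>i\<in>S. xval N i) (Pow idx)"
  proof (rule inj_onI, rule ccontr)
    fix S S' assume S: "S \<in> Pow idx" "S' \<in> Pow idx" "(\<Sum>i\<in>S. xval N i) = (\<Sum>i\<in>S'. xval N i)" "S \<noteq> S'"
    have x: "(\<Sum>i\<in>R. xval N i) = (\<Sum>j<4. of_nat N ^ j * (\<Sum>i\<in>R. t i ^ j))" for R
      unfolding xval_def sum_distrib_left by (rule sum.swap)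
    have "poly (p (S, S')) (of_nat N) = (\<Sum>j<4. of_nat N ^ j * d S S' j)"
      by (simp add: p_def poly_monoms mult.commute)
    also have "\<dots> = 0" using S(3) unfolding x d_def by (simp add: right_diff_distrib sum_subtractf)
    finally have "poly (p (S, S')) (of_nat N) = 0" .
    moreover have "p (S, S') \<in> p ` ?P" using S by (intro imageI) simp
    ultimately show False using N by blast
  qed
  then show ?thesis by blast
qed

text \<open>The k-fold products of eigencovectors, carried over by \<open>F.Psi\<close>, diagonalise
  the transported derivation of \<open>Xmat N\<close>. Their eigenvalues are the subset sums of the
  \<open>xval N i\<close>, distinct for the chosen N, so the abstract criterion applies.\<close>

lemma cm_mirror: "cm_type (VQ Pinv k) (hpV G Icx Bm Pinv k) k"
proof -
  obtain N where N: "inj_on (\<lambda>S. \<Sum>i\<in>S. xval N i) (Pow idx)" using distinct_sums by blast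
  define X where "X = (\<lambda>K L. complex_of_rat (Xmat N K L))"
  define I where "I = {S. S \<subseteq> idx \<and> card S = k}"
  define e where "e S = F.Psi (Z.st S)" for S
  have I_Pow: "I \<subseteq> Pow idx" by (auto simp: I_def)
  have finI: "finite I" using I_Pow by (rule finite_subset) simp
  have DX: "Der X (Z.st S) = sc (\<Sum>i\<in>S. xval N i) (Z.st S)" if "S \<subseteq> idx" for S
    by (rule Der_Z_st[OF _ that]) (simp add: X_def Xmat_zt)
  have DXK: "Der X \<phi> \<in> Kf \<rat> D" if "\<phi> \<in> Kf \<rat> D" for \<phi> D
    by (rule Kf_Der[OF qclosed_Rats that]) (simp add: X_def)
  \<comment> \<open>Sums over k-element sets are padded with zeros to sums over all subsets, the
    shape in which both maps \<open>Psi\<close> are defined.\<close>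
  have res: "(\<Sum>S\<in>I. sc (c S) (f S)) = (\<Sum>S\<in>Pow idx. sc (if S \<in> I then c S else 0) (f S))" for c and f :: "nat set \<Rightarrow> complex form"
    using I_Pow by (intro sum.mono_neutral_cong_left) auto
  have resF: "(\<Sum>S\<in>I. sc (c S) (F.st S)) = F.Psi (\<lambda>S. if S \<in> I then c S else 0)" for c
    unfolding F.Psi_def by (rule res)
  have resZ: "(\<Sum>S\<in>I. sc (c S) (e S)) = F.Psi (Z.Psi (\<lambda>S. if S \<in> I then c S else 0))" for c
  proof -
    have "(\<Sum>S\<in>I. sc (c S) (Z.st S)) = Z.Psi (\<lambda>S. if S \<in> I then c S else 0)"
      unfolding Z.Psi_def by (rule res)
    then show ?thesis unfolding e_def by (simp only: lin_sum[OF F.lin_Psi, symmetric] lin_sc[OF F.lin_Psi, symmetric])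
  qed
  have rv: "valid_form (\<lambda>S. if S \<in> I then c S else 0 :: complex)" for c
    by (simp add: valid_form_def I_def)
  have rK: "(\<lambda>S. if S \<in> I then c S else 0) \<in> Kf UNIV {k}" for c
    by (auto simp: Kf_def valid_form_def I_def)
  have Kr: "(\<lambda>S. if S \<in> I then \<psi> S else 0) = \<psi>" if "\<psi> \<in> Kf R {k}" for \<psi> R
    using that by (auto simp: Kf_def valid_form_def I_def fun_eq_iff)
  have dim: "has_qdim (VQ Pinv k) (card I)"
  proof -
    have ind: "\<forall>S\<in>I. u S = 0" if 0: "(\<Sum>S\<in>I. qsc (u S) (F.st S)) = 0" for u
    proof -
      have "F.Psi (\<lambda>S. if S \<in> I then of_rat (u S) else 0) = 0"
        using 0 unfolding qsc_def resF .
      then have "(\<lambda>S. if S \<in> I then complex_of_rat (u S) else 0) = 0" by (rule F.Psi_inj_0[OF rv])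
      then have "(if S \<in> I then complex_of_rat (u S) else 0) = 0" for S
        by (drule_tac fun_cong[of _ _ S]) (simp add: fun_apply)
      then show ?thesis by (metis of_rat_eq_0_iff)
    qed
    note fam = qv_family[OF finI ind]
    have "VQ Pinv k = qv.span (F.st ` I)"
    proof
      show "VQ Pinv k \<subseteq> qv.span (F.st ` I)"
      proof
        fix x assume "x \<in> VQ Pinv k"
        then obtain \<phi> where \<phi>: "\<phi> \<in> Kf \<rat> {k}" "x = F.Psi \<phi>" unfolding VQ_eq by blast
        have "x = (\<Sum>S\<in>I. sc (\<phi> S) (F.st S))" unfolding resF Kr[OF \<phi>(1)] \<phi>(2) ..
        moreover have "\<dots> \<in> span_in \<rat> (F.st ` I)"
          using \<phi>(1) by (intro span_in_sum span_in_sc span_in_base qclosed_Rats) (auto simp: Kf_def)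
        ultimately show "x \<in> qv.span (F.st ` I)" by (simp add: span_in_Rats)
      qed
      show "qv.span (F.st ` I) \<subseteq> VQ Pinv k"
      proof (rule qv.span_minimal)
        show "F.st ` I \<subseteq> VQ Pinv k"
        proof
          fix x assume "x \<in> F.st ` I"
          then obtain S where S: "S \<subseteq> idx" "card S = k" "x = F.st S" by (auto simp: I_def)
          then show "x \<in> VQ Pinv k" unfolding VQ_eq using F.Psi_dl[OF S(1)] Kf_dl[OF qclosed_Rats S(1)] by (metis imageI)
        qed
        show "qv.subspace (VQ Pinv k)" unfolding VQ_def span_in_Rats by (rule qv.subspace_span)
      qed
    qed
    from has_qdim_basis[OF finite_imageI[OF finI] fam(2) this] show ?thesis by (simp add: card_image[OF fam(1)])
  qed
  \<comment> \<open>The derivation is conjugated to the vertical side. It is rational because X,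
    \<open>F.Psi\<close> and its inverse \<open>Om\<close> all are.\<close>
  obtain T where T: "\<And>\<phi>. valid_form \<phi> \<Longrightarrow> qfapp T \<phi> = F.Psi (Der X (Om \<phi>))"
  proof -
    have "\<exists>M. \<forall>\<phi>. valid_form \<phi> \<longrightarrow> qfapp M \<phi> = F.Psi (Der X (Om \<phi>))"
    proof (rule qfapp_exists)
      show "lin (\<lambda>\<phi>. F.Psi (Der X (Om \<phi>)))" by (rule lin_comp[OF F.lin_Psi lin_comp[OF lin_Der lin_Om]])
      show "valid_form (F.Psi (Der X (Om \<phi>)))" for \<phi> by (rule F.valid_Psi)
      fix R assume "R \<subseteq> idx"
      then have "dl R \<in> Kf \<rat> UNIV" using Kf_dl[OF qclosed_Rats] Kf_mono[of \<rat> \<rat> "{card R}" UNIV] by auto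
      then show "F.Psi (Der X (Om (dl R))) \<in> Kf \<rat> UNIV"
        by (intro Psi_rational DXK Om_Kf qclosed_Rats)
    qed
    then show ?thesis using that by blast
  qed
  have TP: "qfapp T (F.Psi \<phi>) = F.Psi (Der X \<phi>)" if "valid_form \<phi>" for \<phi>
    using T[OF F.valid_Psi] Om_Psi[OF that] by simp
  have "diag_rational (VQ Pinv k) (hpV G Icx Bm Pinv k) k I e (\<lambda>S. card (S \<inter> {1, 2})) T (\<lambda>S. \<Sum>i\<in>S. xval N i)"
  proof
    show "finite I" by (rule finI)
    show "valid_form \<phi>" if "\<phi> \<in> VQ Pinv k" for \<phi> using that unfolding VQ_eq by (auto simp: F.valid_Psi)
    show "has_qdim (VQ Pinv k) (card I)" by (rule dim)
    show "span_in UNIV (VQ Pinv k) = range (\<lambda>c. \<Sum>i\<in>I. sc (c i) (e i))"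
    proof
      show "span_in UNIV (VQ Pinv k) \<subseteq> range (\<lambda>c. \<Sum>i\<in>I. sc (c i) (e i))"
      proof
        fix x assume "x \<in> span_in UNIV (VQ Pinv k)"
        then obtain \<psi> where \<psi>: "\<psi> \<in> Kf UNIV {k}" "x = F.Psi (Z.Psi \<psi>)"
          unfolding VC_eq using Z_Psi_surj by blast
        have "x = (\<Sum>i\<in>I. sc (\<psi> i) (e i))" unfolding resZ Kr[OF \<psi>(1)] \<psi>(2) ..
        then show "x \<in> range (\<lambda>c. \<Sum>i\<in>I. sc (c i) (e i))" by blast
      qed
      show "range (\<lambda>c. \<Sum>i\<in>I. sc (c i) (e i)) \<subseteq> span_in UNIV (VQ Pinv k)"
        unfolding VC_eq resZ using Z_Psi_Kf[OF rK] by blast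
    qed
    show "\<forall>i\<in>I. c i = 0" if 0: "(\<Sum>i\<in>I. sc (c i) (e i)) = 0" for c
    proof -
      have "Z.Psi (\<lambda>S. if S \<in> I then c S else 0) = 0" using 0 unfolding resZ by (rule F.Psi_inj_0[OF Z.valid_Psi])
      then have "(\<lambda>S. if S \<in> I then c S else 0) = 0" by (rule Z.Psi_inj_0[OF rv])
      then have "(if S \<in> I then c S else 0) = 0" for S
        by (drule_tac fun_cong[of _ _ S]) (simp add: fun_apply)
      then show ?thesis by metis
    qed
    show "hpV G Icx Bm Pinv k p = {(\<Sum>i\<in>I. sc (c i) (e i)) | c. \<forall>i\<in>I. c i \<noteq> 0 \<longrightarrow> card (i \<inter> {1, 2}) = p}" if p: "p \<le> k" for p
    proof (intro set_eqI iffI)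
      fix x assume "x \<in> hpV G Icx Bm Pinv k p"
      then obtain \<psi> where \<psi>: "\<psi> \<in> HK k p" "x = F.Psi (Z.Psi \<psi>)" unfolding hpV_eq[OF p] by blast
      then have k: "\<psi> \<in> Kf UNIV {k}" by (simp add: HK_def)
      have "x = (\<Sum>i\<in>I. sc (\<psi> i) (e i))" unfolding resZ Kr[OF k] \<psi>(2) ..
      then show "x \<in> {(\<Sum>i\<in>I. sc (c i) (e i)) | c. \<forall>i\<in>I. c i \<noteq> 0 \<longrightarrow> card (i \<inter> {1, 2}) = p}"
        using \<psi>(1) unfolding HK_def by blast
    next
      fix x assume "x \<in> {(\<Sum>i\<in>I. sc (c i) (e i)) | c. \<forall>i\<in>I. c i \<noteq> 0 \<longrightarrow> card (i \<inter> {1, 2}) = p}"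
      then obtain c where c: "x = (\<Sum>i\<in>I. sc (c i) (e i))" "\<forall>i\<in>I. c i \<noteq> 0 \<longrightarrow> card (i \<inter> {1, 2}) = p" by blast
      have "(\<lambda>S. if S \<in> I then c S else 0) \<in> HK k p" using rK[of c] c(2) by (auto simp: HK_def)
      then show "x \<in> hpV G Icx Bm Pinv k p" unfolding hpV_eq[OF p] c(1) resZ by blast
    qed
    show "qfapp T ` VQ Pinv k \<subseteq> VQ Pinv k"
      unfolding VQ_eq using TP Kf_valid DXK by fastforce
    show "qfapp T (e S) = sc (\<Sum>i\<in>S. xval N i) (e S)" if "S \<in> I" for S
      unfolding e_def TP[OF Z.valid_st] using DX[of S] that by (simp add: I_def lin_sc[OF F.lin_Psi])
    show "inj_on (\<lambda>S. \<Sum>i\<in>S. xval N i) I" using N I_Pow by (rule inj_on_subset)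
  qed
  then show ?thesis by (rule diag_rational.cm)
qed

end

text \<open>Pulling back the product of a (1,0) and a (0,1) covector along I multiplies it by i (-i)
  = 1. Invariance is linear in the form, so it extends from these products to all (1,1)
  forms.\<close>

lemma form2_bil_invariant:
  fixes M :: "complex mat"
  assumes anti: "\<And>I J. I \<in> idx \<Longrightarrow> J \<in> idx \<Longrightarrow> M I J = - M J I"
    and M: "form2 M \<in> Hpq Icx 1 1"
  shows "I \<in> idx \<Longrightarrow> J \<in> idx \<Longrightarrow> (\<Sum>K\<in>idx. \<Sum>L\<in>idx. of_real (Icx K I) * M K L * of_real (Icx L J)) = M I J"
proof -
  \<comment> \<open>Recovers the antisymmetric matrix from the coefficients of a 2-form, undoing
    \<open>form2\<close>. Working with it makes the invariance condition linear in \<phi>.\<close>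
  define mt where "mt \<phi> = (\<lambda>I J. if I < J then \<phi> {I, J} else if J < I then - \<phi> {I, J} else (0::complex))" for \<phi> :: "complex form" and I J :: nat
  define good where "good \<phi> \<longleftrightarrow> (\<forall>I\<in>idx. \<forall>J\<in>idx. (\<Sum>K\<in>idx. \<Sum>L\<in>idx. of_real (Icx K I) * mt \<phi> K L * of_real (Icx L J)) = mt \<phi> I J)" for \<phi>
  have mt_add: "mt (\<phi> + \<psi>) I J = mt \<phi> I J + mt \<psi> I J" and mt_sc: "mt (sc c \<phi>) I J = c * mt \<phi> I J" for \<phi> \<psi> c I J
    by (auto simp: mt_def fun_apply)
  have gadd: "good (\<phi> + \<psi>)" if "good \<phi>" "good \<psi>" for \<phi> \<psi>
    using that by (simp add: good_def mt_add distrib_left distrib_right sum.distrib)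
  have gsc: "good (sc c \<phi>)" if "good \<phi>" for c \<phi>
  proof -
    have "(\<Sum>K\<in>idx. \<Sum>L\<in>idx. of_real (Icx K I) * mt (sc c \<phi>) K L * of_real (Icx L J))
      = c * (\<Sum>K\<in>idx. \<Sum>L\<in>idx. of_real (Icx K I) * mt \<phi> K L * of_real (Icx L J))" for I J
      by (simp add: mt_sc sum_distrib_left algebra_simps)
    then show ?thesis using that by (simp add: good_def mt_sc)
  qed
  have "mt 0 I J = 0" for I J by (auto simp: mt_def fun_apply)
  then have g0: "good 0" by (simp add: good_def)
  have gw: "good (wedge_list (map form1 (xs @ ys)))"
    if xy: "length xs = 1" "set xs \<subseteq> H10 Icx" "length ys = 1" "set ys \<subseteq> H01 Icx" for xs ys
  proof -
    obtain x y where x: "xs = [x]" "x \<in> H10 Icx" and y: "ys = [y]" "y \<in> H01 Icx"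
      using xy by (auto simp: length_Suc_conv)
    have wl: "wedge_list (map form1 (xs @ ys)) = ext1 x (ext1 y unit_form)"
      by (simp add: x y wedge_form1 valid_ext1 unit_form_dl valid_dl)
    have e1: "ext1 y unit_form S = (if \<exists>i\<in>idx. S = {i} then y (the_elem S) else 0)" for S
    proof -
      have "ext1 y (unit_form :: complex form) = form1 y"
      proof -
        have "wedge (form1 y) unit_form = ext1 y unit_form" by (simp add: wedge_form1 unit_form_dl valid_dl)
        moreover have "ext1 y (dl {}) = (\<Sum>i\<in>idx. sc (y i) (dl {i}))"
          unfolding ext1_def by (intro sum.cong refl) (simp add: cr0_dl sg_def)
        moreover have "(\<Sum>i\<in>idx. sc (y i) (dl {i})) = form1 y"
        proof
          fix U
          show "(\<Sum>i\<in>idx. sc (y i) (dl {i})) U = form1 y U"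
          proof (cases "\<exists>i\<in>idx. U = {i}")
            case True
            then obtain i where i: "i \<in> idx" "U = {i}" by blast
            have "(\<Sum>j\<in>idx. y j * dl {j} U) = (\<Sum>j\<in>idx. y j * (if j = i then 1 else 0))"
              by (intro sum.cong refl) (auto simp: dl_def i)
            then show ?thesis using i by (simp add: sum_fun_apply fun_apply form1_def sum_delta_idx)
          next
            case False
            then have "(\<Sum>j\<in>idx. y j * dl {j} U) = 0" by (intro sum.neutral) (auto simp: dl_def)
            then show ?thesis using False by (simp add: sum_fun_apply fun_apply form1_def)
          qed
        qed
        ultimately show ?thesis by (simp add: unit_form_dl)
      qed
      then show ?thesis by (simp add: form1_def)
    qed
    have e2: "ext1 x (ext1 y unit_form) {I, J} = x I * y J - x J * y I" if IJ: "I \<in> idx" "J \<in> idx" "I < J" for I J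
    proof -
      have "ext1 x (ext1 y unit_form) {I, J} = (\<Sum>i\<in>idx. x i * cr0 i (ext1 y unit_form) {I, J})"
        by (simp add: ext1_def sum_fun_apply fun_apply)
      also have "\<dots> = (\<Sum>i\<in>{I, J}. x i * cr0 i (ext1 y unit_form) {I, J})"
        using IJ by (intro sum.mono_neutral_right) (auto simp: cr0_def)
      also have "\<dots> = x I * cr0 I (ext1 y unit_form) {I, J} + x J * cr0 J (ext1 y unit_form) {I, J}"
        using IJ by simp
      also have "cr0 I (ext1 y unit_form) {I, J} = y J"
      proof -
        have "{j \<in> {I, J}. j < I} = {}" using IJ by auto
        then have "sg I {I, J} = (1 :: complex)" unfolding sg_def by (simp only: card.empty power_0)
        moreover have "{I, J} - {I} = {J}" using IJ by auto
        ultimately show ?thesis using IJ by (simp add: cr0_def e1)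
      qed
      also have "cr0 J (ext1 y unit_form) {I, J} = - y I"
      proof -
        have "{j \<in> {I, J}. j < J} = {I}" using IJ by auto
        then have "sg J {I, J} = (- 1 :: complex)" unfolding sg_def by simp
        moreover have "{I, J} - {J} = {I}" using IJ by auto
        ultimately show ?thesis using IJ by (simp add: cr0_def e1)
      qed
      finally show ?thesis by simp
    qed
    have mtw: "mt (ext1 x (ext1 y unit_form)) I J = x I * y J - x J * y I" if "I \<in> idx" "J \<in> idx" for I J
      using e2[OF that] e2[OF that(2,1)] that by (auto simp: mt_def insert_commute)
    have xI: "(\<Sum>K\<in>idx. x K * of_real (Icx K I)) = \<i> * x I" if "I \<in> idx" for I using x(2) that by (simp add: H10_def)
    have yI: "(\<Sum>K\<in>idx. y K * of_real (Icx K I)) = - \<i> * y I" if "I \<in> idx" for I using y(2) that by (simp add: H01_def)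
    show ?thesis unfolding wl good_def
    proof (intro ballI)
      fix I J assume IJ: "I \<in> idx" "J \<in> idx"
      have "(\<Sum>K\<in>idx. \<Sum>L\<in>idx. of_real (Icx K I) * mt (ext1 x (ext1 y unit_form)) K L * of_real (Icx L J))
        = (\<Sum>K\<in>idx. \<Sum>L\<in>idx. (x K * of_real (Icx K I)) * (y L * of_real (Icx L J)) - (y K * of_real (Icx K I)) * (x L * of_real (Icx L J)))"
        by (intro sum.cong refl) (simp add: mtw algebra_simps)
      also have "\<dots> = (\<Sum>K\<in>idx. x K * of_real (Icx K I)) * (\<Sum>L\<in>idx. y L * of_real (Icx L J))
         - (\<Sum>K\<in>idx. y K * of_real (Icx K I)) * (\<Sum>L\<in>idx. x L * of_real (Icx L J))"
        by (simp add: sum_subtractf sum_product)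
      also have "\<dots> = mt (ext1 x (ext1 y unit_form)) I J"
        unfolding xI[OF IJ(1)] xI[OF IJ(2)] yI[OF IJ(1)] yI[OF IJ(2)] mtw[OF IJ] by (simp add: algebra_simps)
      finally show "(\<Sum>K\<in>idx. \<Sum>L\<in>idx. of_real (Icx K I) * mt (ext1 x (ext1 y unit_form)) K L * of_real (Icx L J)) = mt (ext1 x (ext1 y unit_form)) I J" .
    qed
  qed
  have "Hpq Icx 1 1 \<subseteq> {\<phi>. good \<phi>}"
    unfolding Hpq_def by (rule span_in_minimal) (use g0 gadd gsc gw in blast)+
  then have good: "good (form2 M)" using M by blast
  have mtM: "mt (form2 M) I J = M I J" if IJ: "I \<in> idx" "J \<in> idx" for I J
  proof -
    have f: "form2 M {I, J} = M I J" if "I \<in> idx" "J \<in> idx" "I < J" for I J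
    proof -
      have "Min {I, J} = I" "Max {I, J} = J" using that by simp_all
      then show ?thesis using that by (auto simp: form2_def)
    qed
    have "M I I = 0" if "I \<in> idx" using anti[OF that that] by simp
    then show ?thesis using f[OF IJ] f[OF IJ(2,1)] anti[OF IJ] IJ
      by (cases I J rule: linorder_cases) (auto simp: mt_def insert_commute)
  qed
  show "(\<Sum>K\<in>idx. \<Sum>L\<in>idx. of_real (Icx K I) * M K L * of_real (Icx L J)) = M I J" if IJ: "I \<in> idx" "J \<in> idx"
  proof -
    have "(\<Sum>K\<in>idx. \<Sum>L\<in>idx. of_real (Icx K I) * mt (form2 M) K L * of_real (Icx L J)) = mt (form2 M) I J"
      using good IJ unfolding good_def by blast
    then show ?thesis using IJ by (simp add: mtM)
  qed
qed

lemma bil_mvec_invariant: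
  fixes M Icx :: "real mat"
  assumes "\<And>I J. I \<in> idx \<Longrightarrow> J \<in> idx \<Longrightarrow> (\<Sum>K\<in>idx. \<Sum>L\<in>idx. Icx K I * M K L * Icx L J) = M I J"
  shows "bil M (mvec Icx u) (mvec Icx v) = bil M u v"
proof -
  have "bil M (mvec Icx u) (mvec Icx v) = (\<Sum>K\<in>idx. \<Sum>L\<in>idx. \<Sum>I\<in>idx. \<Sum>J\<in>idx. u I * (Icx K I * M K L * Icx L J) * v J)"
    unfolding bil_def by (intro sum.cong refl)
      (simp add: mvec_def sum_distrib_left sum_distrib_right algebra_simps)
  also have "\<dots> = (\<Sum>K\<in>idx. \<Sum>I\<in>idx. \<Sum>J\<in>idx. \<Sum>L\<in>idx. u I * (Icx K I * M K L * Icx L J) * v J)"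
    by (intro sum.cong refl sum_swap3)
  also have "\<dots> = (\<Sum>I\<in>idx. \<Sum>J\<in>idx. \<Sum>K\<in>idx. \<Sum>L\<in>idx. u I * (Icx K I * M K L * Icx L J) * v J)"
    by (rule sum_swap3)
  also have "\<dots> = (\<Sum>I\<in>idx. \<Sum>J\<in>idx. u I * (\<Sum>K\<in>idx. \<Sum>L\<in>idx. Icx K I * M K L * Icx L J) * v J)"
    by (simp only: sum_distrib_left sum_distrib_right)
  also have "\<dots> = bil M u v" unfolding bil_def by (intro sum.cong refl) (simp add: assms)
  finally show ?thesis .
qed

theorem theorem5p5:
  fixes G Bm Icx :: "real mat" and P Pinv :: "int mat"
  assumes G_sym: "\<forall>I\<in>idx. \<forall>J\<in>idx. G I J = G J I"
    and G_pos: "\<forall>u. valid_vec u \<and> u \<noteq> (\<lambda>_. 0) \<longrightarrow> bil G u u > 0"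
    and G_rat: "\<forall>I\<in>idx. \<forall>J\<in>idx. G I J \<in> \<rat>"
    and B_anti: "\<forall>I\<in>idx. \<forall>J\<in>idx. Bm I J = - Bm J I"
    and B_rat: "\<forall>I\<in>idx. \<forall>J\<in>idx. Bm I J \<in> \<rat>"
    and I_cx: "\<forall>u. valid_vec u \<longrightarrow> mvec Icx (mvec Icx u) = (\<lambda>K. - u K)"
    and compat: "\<forall>u v. valid_vec u \<and> valid_vec v \<longrightarrow> bil G (mvec Icx u) (mvec Icx v) = bil G u v"
    and polar: "\<exists>\<psi>::int mat. (\<forall>I\<in>idx. \<forall>J\<in>idx. \<psi> I J = - \<psi> J I)
                 \<and> form2 (\<lambda>I J. complex_of_int (\<psi> I J)) \<in> Hpq Icx 1 1
                 \<and> (\<forall>u. valid_vec u \<and> u \<noteq> (\<lambda>_. 0) \<longrightarrow>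
                        bil (\<lambda>I J. real_of_int (\<psi> I J)) (mvec Icx u) u > 0)"
    and B20: "\<exists>x y. x \<in> Hpq Icx 1 1 \<and> y \<in> Hpq Icx 0 2 \<and> form2 (cmat Bm) = (\<lambda>S. x S + y S)"
    and basis1: "\<forall>I\<in>idx. \<forall>J\<in>idx. (\<Sum>K\<in>idx. Pinv I K * P K J) = (if I = J then 1 else 0)"
    and basis2: "\<forall>I\<in>idx. \<forall>J\<in>idx. (\<Sum>K\<in>idx. P I K * Pinv K J) = (if I = J then 1 else 0)"
    and fib_omega: "\<forall>a b c d :: real.
          bil (omega G Icx)
              (\<lambda>K. if K \<in> idx then a * of_int (P K 1) + b * of_int (P K 2) else 0)
              (\<lambda>K. if K \<in> idx then c * of_int (P K 1) + d * of_int (P K 2) else 0) = 0"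
    and fib_B: "\<forall>a b c d :: real.
          bil Bm
              (\<lambda>K. if K \<in> idx then a * of_int (P K 1) + b * of_int (P K 2) else 0)
              (\<lambda>K. if K \<in> idx then c * of_int (P K 1) + d * of_int (P K 2) else 0) = 0"
  shows "\<forall>k\<le>4.
           (\<forall>\<alpha> \<phi>. \<phi> \<in> WR Pinv k \<longrightarrow> rho G Icx Bm \<alpha> \<phi> \<in> WR Pinv k)
         \<and> (\<forall>\<alpha> \<phi>. \<phi> \<in> WR Pinv (k + 2) \<longrightarrow> rho G Icx Bm \<alpha> \<phi> \<in> WR Pinv (k + 2))
         \<and> cm_type (VQ Pinv k) (hpV G Icx Bm Pinv k) k
         \<and> hs_iso (VQ Pinv k) (hpV G Icx Bm Pinv k) (HQ k) (hpH Icx k) k"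
proof -
  interpret torus G Icx Bm P Pinv
    by unfold_locales (fact G_sym G_pos I_cx compat G_rat B_anti B_rat basis1 basis2 fib_omega fib_B)+
  obtain \<psi> :: "int mat" where psi: "\<forall>I\<in>idx. \<forall>J\<in>idx. \<psi> I J = - \<psi> J I"
      "form2 (\<lambda>I J. complex_of_int (\<psi> I J)) \<in> Hpq Icx 1 1"
      "\<forall>u. valid_vec u \<and> u \<noteq> (\<lambda>_. 0) \<longrightarrow> bil (\<lambda>I J. real_of_int (\<psi> I J)) (mvec Icx u) u > 0"
    using polar by blast
  have inv: "(\<Sum>K\<in>idx. \<Sum>L\<in>idx. Icx K I * real_of_int (\<psi> K L) * Icx L J) = real_of_int (\<psi> I J)"
    if "I \<in> idx" "J \<in> idx" for I J
  proof -
    have anti: "complex_of_int (\<psi> I J) = - complex_of_int (\<psi> J I)" if "I \<in> idx" "J \<in> idx" for I J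
    proof -
      have "\<psi> I J = - \<psi> J I" using psi(1) that by blast
      then have "complex_of_int (\<psi> I J) = complex_of_int (- \<psi> J I)" by (rule arg_cong)
      then show ?thesis by simp
    qed
    \<comment> \<open>The type condition is a statement about complex forms; injectivity of the
      embedding of the reals returns the identity for the real form.\<close>
    have "complex_of_real (\<Sum>K\<in>idx. \<Sum>L\<in>idx. Icx K I * real_of_int (\<psi> K L) * Icx L J)
        = complex_of_real (real_of_int (\<psi> I J))"
      using form2_bil_invariant[OF anti psi(2) that] by simp
    then show ?thesis by (simp only: of_real_eq_iff)
  qed
  have inv': "bil (\<lambda>I J. real_of_int (\<psi> I J)) (mvec Icx u) (mvec Icx v) = bil (\<lambda>I J. real_of_int (\<psi> I J)) u v" for u v
    by (rule bil_mvec_invariant) (rule inv)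
  interpret polarized G Icx \<psi>
    by unfold_locales (rule G_rat psi(1) psi(3) inv')+
  obtain T1 z zt t where "eigenframe Icx T1 z zt t" using eigenframe_exists by blast
  then interpret E: eigenframe Icx T1 z zt t .
  obtain H Hi K where HK: "hframe P Pinv H Hi"
    "\<forall>\<phi>. valid_form \<phi> \<longrightarrow> capp (dJ G Icx Bm) (frame.Psi (fl P Pinv Hi) (vac0 Pinv) \<phi>)
        = frame.Psi (fl P Pinv Hi) (vac0 Pinv) (hop Icx K \<phi>)"
    using dJ_frame by blast
  interpret hframe P Pinv H Hi by (rule HK(1))
  interpret mirror P Pinv H Hi Icx T1 z zt t G Bm K
    by unfold_locales (use HK(2) in blast)
  show ?thesis using WR_invariant cm_mirror hs_iso_mirror by blast
qed

end
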